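(* Let $F\in\mathcal{C}^2_{\mathbb{X}_n}$ be such that $\mathbb{E}[F]=0$ and $\mathrm{Var}(F)=1$. Then, for any differentiable decomposition $\{\mathcal{M}_1F,\dots,\mathcal{M}_nF\}$ of $F$ with $\Theta_F\neq 0$ a.s., and for any $p,q,r,s,t>1$ with $\frac1p+\frac1q+\frac1r=\frac1s+\frac1t=1$, we have $$I(F\|Z)\le 2\|F\|_{2p}^2\,\|\Theta_F^{-1}\|_{2q}^2\,\|1-\Theta_F\|_{2r}^2+2\left\|\frac{\sum_{k=1}^n\frac{|\mathcal{L}_k\mathcal{M}_kF|^2}{\tau_k(X_k)}}{\Theta_F^4}\right\|_s\left\|\sum_{k=1}^n|\partial_k\Theta_F|^2\tau_k(X_k)\right\|_t,$$ provided that the norms on the right-hand side are finite.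
   Context: Setting. $(X_k)_{k\ge1}$ are independent real random variables (not necessarily identically distributed) with $\mathbb{E}[X_k]=0$, $\mathrm{Var}(X_k)=1$. Each $X_k$ has a density $p_k$ supported on a connected interval $I_k\subseteq\mathbb{R}$ (taken open), $p_k$ being positive and differentiable on $I_k$ and zero outside. $\mathbb{X}_n=(X_1,\dots,X_n)$, with range $I_1\times\cdots\times I_n$; $\mathbb{E}_k$ is the expectation with respect to $X_k$ only (the other variables being held fixed); $\|X\|_p=(\mathbb{E}|X|^p)^{1/p}$, and $L^p(\Omega)$ is the space of random variables with $\|X\|_p<\infty$. $\mathcal{C}^k_{\mathbb{X}_n}$ is the set of random variables $F(\mathbb{X}_n)$ with $F$ a $k$-times continuously differentiable function on the range of $\mathbb{X}_n$; one writes $F$ for $F(\mathbb{X}_n)$, and $\partial_kF$ for the partial derivative in the $k$-th variable evaluated at $\mathbb{X}_n$. $F(\mathbb{X}_n,X_k=x)$ means that the $k$-th argument is replaced by $x$. Stein kernel: $\tau_k(x)=\frac{1}{p_k(x)}\int_x^\infty y\,p_k(y)\,dy$ for $x\in I_k$. For $F\in\mathcal{C}^0_{\mathbb{X}_n}\cap L^1(\Omega)$: $\mathcal{L}_kF=\frac{1}{p_k(X_k)}\int_{X_k}^\infty\big(F(\mathbb{X}_n,X_k=x)-\mathbb{E}_k[F]\big)p_k(x)\,dx$. Decomposition: for $F\in\mathcal{C}^0_{\mathbb{X}_n}\cap L^1(\Omega)$, a set $\{\mathcal{M}_1F,\dots,\mathcal{M}_nF\}$ is a decomposition of $F$ if (i)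 $F-\mathbb{E}[F]=\sum_{k=1}^n\mathcal{M}_kF$; (ii) $\mathbb{E}_k[\mathcal{M}_kF]=0$ for all $1\le k\le n$; (iii) $\mathcal{M}_kF\in\mathcal{C}^0_{\mathbb{X}_n}\cap L^1(\Omega)$ for all $k$. It is a differentiable decomposition if in addition $\mathcal{M}_kF\in\mathcal{C}^1_{\mathbb{X}_n}$ and $\partial_i\mathcal{M}_kF\in L^1(\Omega)$ for all $1\le i,k\le n$. Given a decomposition of $F\in\mathcal{C}^1_{\mathbb{X}_n}$, $\Theta_F=\Theta_F(\mathbb{X}_n):=\sum_{k=1}^n\partial_kF\,\mathcal{L}_k\mathcal{M}_kF$. Fisher information distance: $Z\sim N(0,1)$. For $F$ with mean $0$, variance $1$ and absolutely continuous density $p_F$, with score function $\rho_F=p_F'/p_F$, $I(F\|Z)=\mathbb{E}[(\rho_F(F)+F)^2]$. (Under the theorem's hypotheses $F$ has such a density; this is part of the assertion.) *)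

theory Defs
  imports "HOL-Probability.Probability"
begin

definition upd :: "real ^ 'n \<Rightarrow> 'n \<Rightarrow> real \<Rightarrow> real ^ 'n" where
  "upd x k y = (\<chi> i. if i = k then y else x $ i)"

definition partial :: "'n \<Rightarrow> (real ^ 'n \<Rightarrow> real) \<Rightarrow> real ^ 'n \<Rightarrow> real" where
  "partial k f x = deriv (\<lambda>y. f (upd x k y)) (x $ k)"

(* Used for open S only. *)
primrec C_k_on :: "nat \<Rightarrow> (real ^ 'n) set \<Rightarrow> (real ^ 'n::finite \<Rightarrow> real) \<Rightarrow> bool" where
  "C_k_on 0 S f \<longleftrightarrow> continuous_on S f"
| "C_k_on (Suc m) S f \<longleftrightarrow> f differentiable_on S \<and> (\<forall>k. C_k_on m S (partial k f))"

definition box_range :: "('n \<Rightarrow> real set) \<Rightarrow> (real ^ 'n) set" where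
  "box_range I = {x. \<forall>k. x $ k \<in> I k}"

(* A random variable F(X) of class C^m is represented by the function F, of which only the values
   on box_range I matter; the operators below act on such functions, and their values as random
   variables are obtained by evaluation at the random vector X.
   d k is the density of the k-th coordinate of X; it vanishes outside I k. *)

definition partial_expectation ::
  "('n \<Rightarrow> real set) \<Rightarrow> ('n \<Rightarrow> real \<Rightarrow> real) \<Rightarrow> 'n \<Rightarrow> (real ^ 'n \<Rightarrow> real) \<Rightarrow> real ^ 'n \<Rightarrow> real" where
  "partial_expectation I d k f x = (LBINT y:I k. f (upd x k y) * d k y)"

definition stein_kernel :: "(real \<Rightarrow> real) \<Rightarrow> real \<Rightarrow> real" where
  "stein_kernel g x = 1 / g x * (LBINT y:{x<..}. y * g y)"

(* The integration over (x_k, infinity) is restricted to I k, outside of which d k vanishes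
   and f (upd x k y) is meaningless. *)
definition L_op ::
  "('n \<Rightarrow> real set) \<Rightarrow> ('n \<Rightarrow> real \<Rightarrow> real) \<Rightarrow> 'n \<Rightarrow> (real ^ 'n \<Rightarrow> real) \<Rightarrow> real ^ 'n \<Rightarrow> real" where
  "L_op I d k f x = 1 / d k (x $ k) *
     (LBINT y:I k \<inter> {x $ k<..}. (f (upd x k y) - partial_expectation I d k f x) * d k y)"

(* Identities between random variables are almost sure identities. *)
definition decomposition ::
  "'a measure \<Rightarrow> ('a \<Rightarrow> real ^ 'n::finite) \<Rightarrow> ('n \<Rightarrow> real set) \<Rightarrow> ('n \<Rightarrow> real \<Rightarrow> real) \<Rightarrow>
   (real ^ 'n \<Rightarrow> real) \<Rightarrow> ('n \<Rightarrow> real ^ 'n \<Rightarrow> real) \<Rightarrow> bool" where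
  "decomposition M X I d F m \<longleftrightarrow>
     (AE \<omega> in M. F (X \<omega>) - (LINT \<omega>'|M. F (X \<omega>')) = (\<Sum>k\<in>UNIV. m k (X \<omega>))) \<and>
     (\<forall>k. AE \<omega> in M. partial_expectation I d k (m k) (X \<omega>) = 0) \<and>
     (\<forall>k. C_k_on 0 (box_range I) (m k) \<and> integrable M (\<lambda>\<omega>. m k (X \<omega>)))"

definition differentiable_decomposition ::
  "'a measure \<Rightarrow> ('a \<Rightarrow> real ^ 'n::finite) \<Rightarrow> ('n \<Rightarrow> real set) \<Rightarrow> ('n \<Rightarrow> real \<Rightarrow> real) \<Rightarrow>
   (real ^ 'n \<Rightarrow> real) \<Rightarrow> ('n \<Rightarrow> real ^ 'n \<Rightarrow> real) \<Rightarrow> bool" where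
  "differentiable_decomposition M X I d F m \<longleftrightarrow>
     decomposition M X I d F m \<and>
     (\<forall>k. C_k_on 1 (box_range I) (m k)) \<and>
     (\<forall>i k. integrable M (\<lambda>\<omega>. partial i (m k) (X \<omega>)))"

definition Theta ::
  "('n::finite \<Rightarrow> real set) \<Rightarrow> ('n \<Rightarrow> real \<Rightarrow> real) \<Rightarrow> (real ^ 'n \<Rightarrow> real) \<Rightarrow>
   ('n \<Rightarrow> real ^ 'n \<Rightarrow> real) \<Rightarrow> real ^ 'n \<Rightarrow> real" where
  "Theta I d F m x = (\<Sum>k\<in>UNIV. partial k F x * L_op I d k (m k) x)"

definition in_Lp :: "'a measure \<Rightarrow> real \<Rightarrow> ('a \<Rightarrow> real) \<Rightarrow> bool" where
  "in_Lp M p Y \<longleftrightarrow> Y \<in> borel_measurable M \<and> integrable M (\<lambda>\<omega>. \<bar>Y \<omega>\<bar> powr p)"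

definition Lp_norm :: "'a measure \<Rightarrow> real \<Rightarrow> ('a \<Rightarrow> real) \<Rightarrow> real" where
  "Lp_norm M p Y = (LINT \<omega>|M. \<bar>Y \<omega>\<bar> powr p) powr (1 / p)"

definition absolutely_continuous_fun :: "(real \<Rightarrow> real) \<Rightarrow> bool" where
  "absolutely_continuous_fun g \<longleftrightarrow>
     (\<forall>e>0. \<exists>\<delta>>0. \<forall>(N::nat) a b.
        (\<forall>i<N. a i \<le> b i) \<and> disjoint_family_on (\<lambda>i. {a i<..<b i}) {..<N} \<and>
        (\<Sum>i<N. b i - a i) < \<delta> \<longrightarrow> (\<Sum>i<N. \<bar>g (b i) - g (a i)\<bar>) < e)"

(* Nonnegativity is stated because distributed only sees ennreal (g x); together with
   continuity it makes g unique. *)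
definition has_ac_density :: "'a measure \<Rightarrow> ('a \<Rightarrow> real) \<Rightarrow> (real \<Rightarrow> real) \<Rightarrow> bool" where
  "has_ac_density M Y g \<longleftrightarrow>
     (\<forall>x. 0 \<le> g x) \<and> absolutely_continuous_fun g \<and> distributed M lborel Y (\<lambda>x. ennreal (g x))"

definition score :: "(real \<Rightarrow> real) \<Rightarrow> real \<Rightarrow> real" where
  "score g x = deriv g x / g x"

(* The Fisher information distance of Y, having absolutely continuous density g, to the standard
   normal distribution; possibly infinite, hence valued in ennreal. *)
definition fisher_distance :: "'a measure \<Rightarrow> ('a \<Rightarrow> real) \<Rightarrow> (real \<Rightarrow> real) \<Rightarrow> ennreal" where
  "fisher_distance M Y g = (\<integral>\<^sup>+ \<omega>. ennreal ((score g (Y \<omega>) + Y \<omega>)\<^sup>2) \<partial>M)"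

end

theory Submission
  imports Defs
begin

text \<open>
  Write L_k for the operator L_op applied to the k-th summand m_k, partial_k for the derivative in
  direction k, d_k for the k-th density and theta for Theta. On almost every line in direction k,
  the function d_k L_k is a primitive of - m_k d_k that vanishes at both ends of the interval,
  because m_k is centred in that direction. Integrating by parts on each line and adding up
  therefore gives, for bounded smooth psi and h,

      E[psi(F) h(theta) F] = E[psi'(F) h(theta) theta] + E[psi(F) h'(theta) (sum_k L_k partial_k theta)].

  Formally h(u) = 1 / u yields E[psi'(F)] = E[psi(F) W] with W = F / theta + sum_k L_k partial_k
  theta / theta^2. This says that - E[W | F] is the score of F. Hence F has the density g(y) =
  E[W; F >= y], and the Fisher distance is at most E[(F - W)^2] = E[(F (1 - theta) / theta + sum_k
  L_k partial_k theta / theta^2)^2]. The inequality (a + b)^2 <= 2 a^2 + 2 b^2, the Hoelder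
  inequality with three factors for the first summand, and the Cauchy-Schwarz inequality with
  weights tau_k followed by the Hoelder inequality for the second one give the bound.

  Four points need care.

  (1) Regularity of theta. The functions L_j are integrals over one coordinate, and nothing
  dominates the derivative of m_j in another coordinate k. By Fubini, however, on almost every
  line in direction k the function L_j is locally absolutely continuous
  (weak_derivative_on_parametric_integral), and by Lebesgue differentiation it is differentiable
  almost everywhere on that line. The term with j = k is differentiable everywhere, but its
  derivative involves that of d_k, which need not be locally integrable. The finite norm of sum_k
  (partial_k theta)^2 tau_k repairs this: it makes the whole derivative of theta locally
  integrable on almost every line, and an everywhere differentiable function with integrable
  derivative is the integral of its derivative (AE_Theta_weak_derivative).

  (2) Integrability. The separate terms partial_k F L_k need not be integrable; only their sum
  theta is controlled. So the integration by parts is done on boxes that exhaust the range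
  (box_integration_by_parts). The boundary term on a face is bounded by the integral of |m_k|
  beyond that face, which tends to 0 (global_integration_by_parts).

  (3) Zeros of theta. A null set of zeros may meet every line, so 1 / u is replaced by u / (u^2 +
  epsilon), and epsilon tends to 0 at the end (score_identity).

  (4) The density. The identity E[psi'(F)] = E[psi(F) W] is turned into an absolutely continuous
  density and a bound on its Fisher distance in the locale score_representation. The conditional
  expectation is replaced there by a duality argument against truncations of the score.

  Lines are handled without lower-dimensional product measures: the law N of the vector is
  unchanged when one coordinate is redrawn independently from its own law (locale product_law),
  and this is all that is used of independence.
\<close>

section \<open>Lebesgue differentiation on the real line\<close>

text \<open>
  Since g vanishes on A, outer regularity of the measure with density g yields an open neighbourhood
  of A of arbitrarily small g-mass.  The Vitali covering theorem covers almost all of the bad set by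
  disjoint intervals inside this neighbourhood, each of length at most a constant times its g-mass.
\<close>

lemma negligible_frequently_large_averages:
  fixes g :: "real \<Rightarrow> real"
  assumes g: "integrable lborel g" "\<And>x. g x \<ge> 0"
    and A: "A \<in> sets borel" "\<And>x. x \<in> A \<Longrightarrow> g x = 0" and e: "e > 0"
  shows "negligible {x \<in> A. \<forall>\<delta>>0. \<exists>h. 0 < h \<and> h < \<delta> \<and> (LBINT t:{x-h..x+h}. g t) > e * h}"
    (is "negligible ?E")
  unfolding negligible_outer_le
proof (intro allI impI)
  fix \<eta> :: real assume \<eta>: "\<eta> > 0"
  define \<nu> where "\<nu> = density lborel (\<lambda>x. ennreal (g x))"
  have gm [measurable]: "g \<in> borel_measurable borel"
    using g(1) by (simp add: integrable_iff_bounded)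
  have em\<nu>: "emeasure \<nu> B = ennreal (LBINT t:B. g t)" if "B \<in> sets borel" for B
  proof -
    have "emeasure \<nu> B = (\<integral>\<^sup>+x. ennreal (indicator B x * g x) \<partial>lborel)"
      using that unfolding \<nu>_def
      by (auto simp: emeasure_density intro!: nn_integral_cong split: split_indicator)
    also have "\<dots> = ennreal (LBINT t:B. g t)"
      unfolding set_lebesgue_integral_def real_scaleR_def
      by (intro nn_integral_eq_integral)
         (auto intro!: integrable_real_mult_indicator simp: g that mult.commute[of "indicator _ _"])
    finally show ?thesis .
  qed
  have sets_\<nu>: "sets \<nu> = sets borel" by (simp add: \<nu>_def)
  have fin: "emeasure \<nu> (space \<nu>) \<noteq> \<infinity>"
    using em\<nu>[of UNIV] by (simp add: \<nu>_def)
  have "(LBINT t:A. g t) = (LBINT t:A. 0)"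
    using A by (intro set_lebesgue_integral_cong) auto
  then have "emeasure \<nu> A = 0" using em\<nu>[OF A(1)] by simp
  then have "(INF U \<in> {U. A \<subseteq> U \<and> open U}. emeasure \<nu> U) = 0"
    using outer_regular[OF sets_\<nu> fin A(1)] by simp
  moreover have "ennreal (\<eta> * e / 2) > 0" using \<eta> e by simp
  ultimately have "(INF U \<in> {U. A \<subseteq> U \<and> open U}. emeasure \<nu> U) < ennreal (\<eta> * e / 2)"
    by simp
  then have "\<exists>U\<in>{U. A \<subseteq> U \<and> open U}. emeasure \<nu> U < ennreal (\<eta> * e / 2)"
    unfolding INF_less_iff .
  then obtain U where U: "A \<subseteq> U" "open U" "emeasure \<nu> U < ennreal (\<eta> * e / 2)" by auto
  define K where "K = {(x,h). x \<in> ?E \<and> 0 < h \<and> cball x h \<subseteq> U \<and> (LBINT t:cball x h. g t) > e * h}"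
  have V: "\<exists>i\<in>K. x \<in> cball (fst i) (snd i) \<and> snd i < \<delta>" if x: "x \<in> ?E" and "\<delta> > 0" for x \<delta>
  proof -
    have "x \<in> U" using x U(1) by auto
    then obtain \<rho> where \<rho>: "\<rho> > 0" "ball x \<rho> \<subseteq> U"
      using U(2) open_contains_ball_eq by blast
    then have "min \<delta> \<rho> > 0" using \<open>\<delta> > 0\<close> by simp
    then obtain h where h: "0 < h" "h < min \<delta> \<rho>" "(LBINT t:{x-h..x+h}. g t) > e * h"
      using x by blast
    have "cball x h \<subseteq> U" using h by (intro subset_trans[OF _ \<rho>(2)]) auto
    then have "(x,h) \<in> K" using x h unfolding K_def by (auto simp: cball_eq_atLeastAtMost)
    then show ?thesis using h by (intro bexI[of _ "(x,h)"]) auto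
  qed
  have V0: "0 < snd i" if "i \<in> K" for i using that by (auto simp: K_def)
  obtain C where C: "countable C" "C \<subseteq> K"
    "pairwise (\<lambda>i j. disjnt (cball (fst i) (snd i)) (cball (fst j) (snd j))) C"
    "negligible (?E - (\<Union>i \<in> C. cball (fst i) (snd i)))"
      proof (rule Vitali_covering_theorem_cballs[of K snd ?E fst])
    show "\<exists>i. i \<in> K \<and> x \<in> cball (fst i) (snd i) \<and> snd i < d" if "x \<in> ?E" "0 < d" for x d
      using V[OF that] by blast
  qed (use V0 that in auto)
  define D where "D = (\<Union>i \<in> C. cball (fst i) (snd i))"
  have Dm [measurable]: "D \<in> sets borel" unfolding D_def using C(1) by auto
  have dis: "disjoint_family_on (\<lambda>i. cball (fst i) (snd i)) C"
    using C(3) by (auto simp: disjoint_family_on_def pairwise_def disjnt_def)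
  have "emeasure lborel D = (\<integral>\<^sup>+i. emeasure lborel (cball (fst i) (snd i)) \<partial>count_space C)"
    unfolding D_def using C(1) dis by (intro emeasure_UN_countable) auto
  also have "\<dots> \<le> (\<integral>\<^sup>+i. ennreal (2/e) * emeasure \<nu> (cball (fst i) (snd i)) \<partial>count_space C)"
  proof (intro nn_integral_mono)
    fix i assume "i \<in> space (count_space C)"
    then have i: "i \<in> K" using C by auto
    have "emeasure lborel (cball (fst i) (snd i)) = ennreal (2 * snd i)"
      using V0[OF i] by (simp add: cball_eq_atLeastAtMost)
    also have "\<dots> \<le> ennreal (2/e * (LBINT t:cball (fst i) (snd i). g t))"
      using i e by (intro ennreal_leI) (auto simp: K_def field_simps split: prod.splits)
    also have "\<dots> = ennreal (2/e) * emeasure \<nu> (cball (fst i) (snd i))"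
      using e by (subst em\<nu>, simp, subst ennreal_mult'[symmetric]) auto
    finally show "emeasure lborel (cball (fst i) (snd i))
        \<le> ennreal (2/e) * emeasure \<nu> (cball (fst i) (snd i))" .
  qed
  also have "\<dots> = ennreal (2/e) * (\<integral>\<^sup>+i. emeasure \<nu> (cball (fst i) (snd i)) \<partial>count_space C)"
    by (intro nn_integral_cmult) auto
  also have "\<dots> = ennreal (2/e) * emeasure \<nu> D"
    unfolding D_def using C(1) dis
    by (subst emeasure_UN_countable) (auto simp: sets_\<nu>)
  also have "\<dots> \<le> ennreal (2/e) * emeasure \<nu> U"
  proof (intro mult_left_mono emeasure_mono)
    show "D \<subseteq> U" unfolding D_def
    proof (rule UN_least)
      fix i assume "i \<in> C"
      then have "i \<in> K" using C(2) by auto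
      then show "cball (fst i) (snd i) \<subseteq> U" by (cases i) (simp add: K_def)
    qed
    show "U \<in> sets \<nu>" using U(2) by (simp add: sets_\<nu>)
  qed auto
  also have "\<dots> \<le> ennreal (2/e) * ennreal (\<eta> * e / 2)"
    using U(3) by (intro mult_left_mono) auto
  also have "\<dots> = ennreal \<eta>" using e \<eta> by (simp flip: ennreal_mult)
  finally have D: "emeasure lborel D \<le> ennreal \<eta>" .
  have Dl: "D \<in> lmeasurable"
    using D Dm by (auto simp: fmeasurable_def le_less_trans[OF _ ennreal_less_top])
  have Nl: "?E - D \<in> lmeasurable" "measure lebesgue (?E - D) = 0"
    using C(4) unfolding D_def by (auto simp: negligible_imp_measurable negligible_imp_measure0)
  show "\<exists>T. ?E \<subseteq> T \<and> T \<in> lmeasurable \<and> measure lebesgue T \<le> \<eta>"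
  proof (intro exI[of _ "(?E - D) \<union> D"] conjI)
    show "(?E - D) \<union> D \<in> lmeasurable" using Dl Nl by (intro fmeasurable.Un) auto
    have "measure lebesgue ((?E - D) \<union> D) \<le> measure lebesgue (?E - D) + measure lebesgue D"
      using Dl Nl by (intro measure_Un_le) auto
    also have "\<dots> = measure lborel D" using Nl Dm by simp
    also have "\<dots> \<le> \<eta>" using D \<eta>
      by (metis enn2real_leI measure_def less_imp_le)
    finally show "measure lebesgue ((?E - D) \<union> D) \<le> \<eta>" .
  qed auto
qed

lemma averages_vanish:
  fixes g :: "real \<Rightarrow> real"
  assumes g: "integrable lborel g" "\<And>x. g x \<ge> 0"
    and A: "A \<in> sets borel" "\<And>x. x \<in> A \<Longrightarrow> g x = 0"
  shows "AE x in lborel. x \<in> A \<longrightarrow>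
    (\<forall>e>0. \<exists>\<delta>>0. \<forall>h. 0 < h \<and> h < \<delta> \<longrightarrow> (LBINT t:{x-h..x+h}. g t) \<le> e * h)"
proof -
  define E where "E n = {x \<in> A. \<forall>\<delta>>0. \<exists>h. 0 < h \<and> h < \<delta> \<and>
      (LBINT t:{x-h..x+h}. g t) > inverse (real (Suc n)) * h}" for n
  have "E n \<in> null_sets lebesgue" for n
    using negligible_frequently_large_averages[OF g A, of "inverse (real (Suc n))"]
    by (simp add: negligible_iff_null_sets E_def)
  then have "AE x in lebesgue. x \<notin> E n" for n by (rule AE_not_in)
  then have "AE x in lborel. \<forall>n. x \<notin> E n" by (simp add: AE_all_countable AE_completion_iff)
  then show ?thesis
  proof eventually_elim
    case (elim x)
    show ?case
    proof (intro impI allI)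
      fix e :: real assume "x \<in> A" "e > 0"
      obtain n where n: "inverse (real (Suc n)) < e" using reals_Archimedean[OF \<open>e > 0\<close>] by auto
      with elim[rule_format, of n] \<open>x \<in> A\<close> obtain \<delta> where "\<delta> > 0"
        and \<delta>: "\<And>h. 0 < h \<Longrightarrow> h < \<delta> \<Longrightarrow> (LBINT t:{x-h..x+h}. g t) \<le> inverse (real (Suc n)) * h"
        unfolding E_def by (force simp: not_less)
      show "\<exists>\<delta>>0. \<forall>h. 0 < h \<and> h < \<delta> \<longrightarrow> (LBINT t:{x-h..x+h}. g t) \<le> e * h"
      proof (intro exI[of _ \<delta>] conjI allI impI \<open>\<delta> > 0\<close>)
        fix h assume "0 < h \<and> h < \<delta>"
        then have "(LBINT t:{x-h..x+h}. g t) \<le> inverse (real (Suc n)) * h" using \<delta> by auto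
        also have "\<dots> \<le> e * h" using n \<open>0 < h \<and> h < \<delta>\<close> by (intro mult_right_mono) auto
        finally show "(LBINT t:{x-h..x+h}. g t) \<le> e * h" .
      qed
    qed
  qed
qed

text \<open>
  The averages of f exceed a rational q by at most the averages of the positive part of f - q, which
  vanishes where f is at most q; taking q slightly above f x gives the claim at almost every x.  The
  truncation to bounded intervals keeps this positive part integrable when q is negative.
\<close>

lemma upper_averages:
  fixes f :: "real \<Rightarrow> real"
  assumes f: "integrable lborel f"
  shows "AE x in lborel. \<forall>e>0. \<exists>\<delta>>0. \<forall>u v. u \<le> x \<and> x \<le> v \<and> v - u < \<delta> \<longrightarrow>
     (LBINT t:{u..v}. f t) \<le> (f x + e) * (v - u)"
proof -
  have fm [measurable]: "f \<in> borel_measurable borel"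
    using f by (simp add: integrable_iff_bounded)
  define g where "g n q t = indicator {-real n..real n} t * max 0 (f t - q)" for n q t
  define A where "A n q = {-real n<..<real n} \<inter> {x. f x \<le> q}" for n q
  have [measurable]: "g n q \<in> borel_measurable borel" for n q
    unfolding g_def by measurable
  have int_g: "integrable lborel (g n q)" for n q
  proof -
    have "integrable lborel (\<lambda>t. indicator {-real n..real n} t * (\<bar>f t\<bar> + \<bar>q\<bar>))"
    proof -
      have "integrable lborel (\<lambda>t. \<bar>f t\<bar> * indicator {-real n..real n} t + \<bar>q\<bar> * indicator {-real n..real n} t)"
        using f by (intro Bochner_Integration.integrable_add integrable_real_mult_indicator
            integrable_mult_right) auto
      then show ?thesis by (simp add: distrib_left mult.commute[of "indicator _ _"])
    qed
    then show ?thesis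
      by (rule Bochner_Integration.integrable_bound)
         (auto simp: g_def split: split_indicator)
  qed
  have "AE x in lborel. x \<in> A n q \<longrightarrow>
    (\<forall>e>0. \<exists>\<delta>>0. \<forall>h. 0 < h \<and> h < \<delta> \<longrightarrow> (LBINT t:{x-h..x+h}. g n q t) \<le> e * h)" for n q
    by (rule averages_vanish[OF int_g]) (auto simp: g_def A_def)
  then have "AE x in lborel. \<forall>n. \<forall>q\<in>\<rat>. x \<in> A n q \<longrightarrow>
    (\<forall>e>0. \<exists>\<delta>>0. \<forall>h. 0 < h \<and> h < \<delta> \<longrightarrow> (LBINT t:{x-h..x+h}. g n q t) \<le> e * h)"
    by (simp add: AE_all_countable AE_ball_countable countable_rat)
  then show ?thesis
  proof eventually_elim
    case (elim x)
    show ?case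
    proof (intro allI impI)
      fix e :: real assume e: "e > 0"
      obtain n where n: "real n > \<bar>x\<bar>" using reals_Archimedean2 by blast
      obtain q where q: "q \<in> \<rat>" "f x < q" "q < f x + e/2"
        using Rats_dense_in_real[of "f x" "f x + e/2"] e by auto
      have "x \<in> A n q" using n q by (auto simp: A_def)
      with elim q e obtain \<delta> where \<delta>: "\<delta> > 0"
        "\<And>h. 0 < h \<Longrightarrow> h < \<delta> \<Longrightarrow> (LBINT t:{x-h..x+h}. g n q t) \<le> e/2 * h"
        by (metis half_gt_zero)
      show "\<exists>\<delta>>0. \<forall>u v. u \<le> x \<and> x \<le> v \<and> v - u < \<delta> \<longrightarrow>
         (LBINT t:{u..v}. f t) \<le> (f x + e) * (v - u)"
      proof (intro exI[of _ "min \<delta> (real n - \<bar>x\<bar>)"] conjI allI impI)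
        show "min \<delta> (real n - \<bar>x\<bar>) > 0" using \<delta> n by auto
        fix u v assume uv: "u \<le> x \<and> x \<le> v \<and> v - u < min \<delta> (real n - \<bar>x\<bar>)"
        define h where "h = v - u"
        show "(LBINT t:{u..v}. f t) \<le> (f x + e) * (v - u)"
        proof (cases "u = v")
          case True
          have "(LBINT t:{v}. f t) = f v * measure lborel {v}"
            unfolding set_lebesgue_integral_def
            by (subst Bochner_Integration.integral_cong[where g="\<lambda>t. indicator {v} t *\<^sub>R f v"])
               (auto split: split_indicator)
          then show ?thesis using True by simp
        next
          case False
          then have h: "0 < h" "h < \<delta>" using uv by (auto simp: h_def)
          have "(LBINT t:{u..v}. f t) \<le> (LBINT t. indicator {u..v} t *\<^sub>R q + indicator {x-h..x+h} t *\<^sub>R g n q t)"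
            unfolding set_lebesgue_integral_def
          proof (rule integral_mono)
            show "integrable lborel (\<lambda>t. indicator {u..v} t *\<^sub>R f t)"
              using f by (intro integrable_mult_indicator) auto
            show "integrable lborel (\<lambda>t. indicator {u..v} t *\<^sub>R q + indicator {x-h..x+h} t *\<^sub>R g n q t)"
            proof (rule Bochner_Integration.integrable_add)
              show "integrable lborel (\<lambda>t. indicator {u..v} t *\<^sub>R q)"
                by (rule integrable_scaleR_left, rule integrable_real_indicator) (auto simp: emeasure_lborel_Icc_eq)
              show "integrable lborel (\<lambda>t. indicator {x-h..x+h} t *\<^sub>R g n q t)"
                by (rule integrable_mult_indicator[OF _ int_g]) auto
            qed
            fix t
            show "indicator {u..v} t *\<^sub>R f t \<le> indicator {u..v} t *\<^sub>R q + indicator {x-h..x+h} t *\<^sub>R g n q t"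
              using uv by (auto simp: g_def h_def split: split_indicator)
          qed
          also have "\<dots> = q * h + (LBINT t:{x-h..x+h}. g n q t)"
            unfolding set_lebesgue_integral_def
            using h integrable_mult_indicator[OF _ int_g[of n q], of "{x-h..x+h}"]
            by (subst Bochner_Integration.integral_add) (auto simp: h_def)
          also have "\<dots> \<le> q * h + e/2 * h" using \<delta>(2) h by auto
          also have "\<dots> \<le> (f x + e/2) * h + e/2 * h"
            using q h by (intro add_right_mono mult_right_mono) auto
          also have "\<dots> = (f x + e) * h" by (simp add: algebra_simps)
          finally show ?thesis by (simp add: h_def)
        qed
      qed
    qed
  qed
qed

lemma LBINT_lower_diff:
  fixes f :: "real \<Rightarrow> real"
  assumes f: "integrable lborel f" and uv: "u \<le> v"
  shows "(LBINT t:{..v}. f t) - (LBINT t:{..u}. f t) = (LBINT t:{u..v}. f t)"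
proof -
  have [measurable]: "f \<in> borel_measurable borel" using f by (simp add: integrable_iff_bounded)
  have s: "set_integrable lborel J f" if "J \<in> sets borel" for J
    using integrable_mult_indicator[OF _ f, of J] that by (simp add: set_integrable_def)
  have "(LBINT t:{..v}. f t) = (LBINT t:{..u} \<union> {u<..v}. f t)" using uv by (simp add: ivl_disj_un)
  also have "\<dots> = (LBINT t:{..u}. f t) + (LBINT t:{u<..v}. f t)"
    by (intro set_integral_Un s) auto
  also have "(LBINT t:{u<..v}. f t) = (LBINT t:{u..v}. f t)"
    by (intro set_integral_cong_set)
       (auto simp: set_borel_measurable_def intro: eventually_mono[OF AE_lborel_singleton[of u]])
  finally show ?thesis by simp
qed

lemma LBINT_upper:
  fixes f :: "real \<Rightarrow> real"
  assumes f: "integrable lborel f"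
  shows "(LBINT t:{u<..}. f t) = (LBINT t. f t) - (LBINT t:{..u}. f t)"
proof -
  have s: "set_integrable lborel J f" if "J \<in> sets borel" for J
    using integrable_mult_indicator[OF _ f, of J] that by (simp add: set_integrable_def)
  have U: "{..u} \<union> {u<..} = UNIV" by auto
  have "(LBINT t. f t) = (LBINT t:{..u} \<union> {u<..}. f t)"
    unfolding U by (simp add: set_lebesgue_integral_def)
  also have "\<dots> = (LBINT t:{..u}. f t) + (LBINT t:{u<..}. f t)"
    by (intro set_integral_Un s) auto
  finally show ?thesis by simp
qed

lemma lower_integral_has_derivative:
  fixes f :: "real \<Rightarrow> real"
  assumes f: "integrable lborel f" and c: "continuous_on {a..b} f" and y: "a < y" "y < b"
  shows "((\<lambda>u. LBINT t:{..u}. f t) has_real_derivative f y) (at y)"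
proof -
  have "((\<lambda>u. integral {a..u} f) has_real_derivative f y) (at y within {a..b})"
    using y by (intro integral_has_real_derivative c) auto
  then have D: "((\<lambda>u. integral {a..u} f) has_real_derivative f y) (at y)"
    using y by (simp add: at_within_Icc_at)
  have D': "((\<lambda>u. (LBINT t:{..a}. f t) + integral {a..u} f) has_real_derivative 0 + f y) (at y)"
    by (intro DERIV_add DERIV_const D)
  have eq: "(LBINT t:{..a}. f t) + integral {a..u} f = (LBINT t:{..u}. f t)" if "u \<in> {a<..<b}" for u
  proof -
    have "set_integrable lborel {a..u} f"
      using integrable_mult_indicator[OF _ f, of "{a..u}"] by (simp add: set_integrable_def)
    then show ?thesis
      using LBINT_lower_diff[OF f, of a u] that by (simp add: set_borel_integral_eq_integral)
  qed
  have "((\<lambda>u. LBINT t:{..u}. f t) has_real_derivative 0 + f y) (at y)"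
    by (rule has_field_derivative_transform_within_open[OF D', of "{a<..<b}"]) (use y eq in auto)
  then show ?thesis by simp
qed

theorem lebesgue_differentiation:
  fixes f :: "real \<Rightarrow> real"
  assumes f: "integrable lborel f"
  shows "AE x in lborel. ((\<lambda>u. LBINT t:{..u}. f t) has_real_derivative f x) (at x)"
proof -
  have f': "integrable lborel (\<lambda>x. - f x)" using f by simp
  from upper_averages[OF f] upper_averages[OF f'] show ?thesis
  proof eventually_elim
    case (elim x)
    define G where "G u = (LBINT t:{..u}. f t)" for u
    have G: "G v - G u = (LBINT t:{u..v}. f t)" if "u \<le> v" for u v
      unfolding G_def by (rule LBINT_lower_diff[OF f that])
    have "(G has_real_derivative f x) (at x)"
      unfolding DERIV_def
    proof (rule LIM_I)
      fix r :: real assume "r > 0"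
      then have "r/2 > 0" by simp
      from elim[rule_format, OF this] obtain \<delta>1 \<delta>2 where d: "\<delta>1 > 0" "\<delta>2 > 0"
        "\<And>u v. u \<le> x \<Longrightarrow> x \<le> v \<Longrightarrow> v - u < \<delta>1 \<Longrightarrow> (LBINT t:{u..v}. f t) \<le> (f x + r/2) * (v - u)"
        "\<And>u v. u \<le> x \<Longrightarrow> x \<le> v \<Longrightarrow> v - u < \<delta>2 \<Longrightarrow> (LBINT t:{u..v}. - f t) \<le> (- f x + r/2) * (v - u)"
        by blast
      have key: "\<bar>G v - G u - f x * (v - u)\<bar> \<le> r/2 * (v - u)"
        if "u \<le> x" "x \<le> v" "v - u < min \<delta>1 \<delta>2" for u v
      proof -
        have "u \<le> v" using that by simp
        have "(LBINT t:{u..v}. - f t) = - (LBINT t:{u..v}. f t)"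
          by (simp add: set_lebesgue_integral_def)
        then have *: "G v - G u \<le> (f x + r/2) * (v - u)" "- (G v - G u) \<le> (- f x + r/2) * (v - u)"
          using d(3)[of u v] d(4)[of u v] that G[OF \<open>u \<le> v\<close>] by auto
        define A B where "A = f x * (v - u)" and "B = r/2 * (v - u)"
        have "(f x + r/2) * (v - u) = A + B" "(- f x + r/2) * (v - u) = - A + B"
          unfolding A_def B_def by (rule distrib_right, subst distrib_right, simp)
        with * have "\<bar>G v - G u - A\<bar> \<le> B" by (simp add: abs_le_iff)
        then show ?thesis by (simp add: A_def B_def)
      qed
      show "\<exists>s>0. \<forall>h. h \<noteq> 0 \<and> norm (h - 0) < s \<longrightarrow> norm ((G (x + h) - G x) / h - f x) < r"
      proof (intro exI[of _ "min \<delta>1 \<delta>2"] conjI allI impI)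
        show "min \<delta>1 \<delta>2 > 0" using d by simp
        fix h :: real assume h: "h \<noteq> 0 \<and> norm (h - 0) < min \<delta>1 \<delta>2"
        have "\<bar>G (x + h) - G x - f x * h\<bar> \<le> r/2 * \<bar>h\<bar>"
        proof (cases "h \<ge> 0")
          case True
          then show ?thesis using key[of x "x+h"] h by simp
        next
          case False
          have "\<bar>G (x + h) - G x - f x * h\<bar> = \<bar>G x - G (x + h) - f x * (x - (x + h))\<bar>"
            by (simp add: abs_minus_commute algebra_simps flip: abs_minus_cancel[of "G (x + h) - G x - f x * h"])
          then show ?thesis using key[of "x+h" x] False h by simp
        qed
        moreover have eq: "\<bar>(G (x + h) - G x) / h - f x\<bar> = \<bar>G (x + h) - G x - f x * h\<bar> / \<bar>h\<bar>"
          using h by (simp add: diff_divide_distrib flip: abs_divide)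
        ultimately have "\<bar>(G (x + h) - G x) / h - f x\<bar> \<le> r/2"
          using h by (subst eq) (simp add: pos_divide_le_eq)
        then show "norm ((G (x + h) - G x) / h - f x) < r" using \<open>r > 0\<close> by simp
      qed
    qed
    then show ?case unfolding G_def .
  qed
qed

section \<open>Weak derivatives on an interval\<close>

text \<open>
  Local absolute continuity in integral form: f is a primitive of the locally integrable function f'
  on the interval S.
\<close>

definition weak_derivative_on :: "real set \<Rightarrow> (real \<Rightarrow> real) \<Rightarrow> (real \<Rightarrow> real) \<Rightarrow> bool" where
  "weak_derivative_on S f f' \<longleftrightarrow> (\<forall>a\<in>S. \<forall>b\<in>S. a \<le> b \<longrightarrow>
     set_integrable lborel {a..b} f' \<and> f b - f a = (LBINT t:{a..b}. f' t))"

lemma Icc_subset_connected: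
  fixes S :: "real set"
  shows "connected S \<Longrightarrow> a \<in> S \<Longrightarrow> b \<in> S \<Longrightarrow> {a..b} \<subseteq> S"
  by (simp add: connected_contains_Icc)

lemma AE_lborel_imp_negligible:
  assumes "AE x in lborel. P x"
  shows "negligible {x::real. \<not> P x}"
proof -
  from assms obtain N where "{x. \<not> P x} \<subseteq> N" "N \<in> null_sets lborel"
    by (auto simp: eventually_ae_filter)
  then show ?thesis
    by (meson negligible_iff_null_sets negligible_subset null_sets_completionI)
qed

lemma set_integral_split_Icc:
  fixes f :: "real \<Rightarrow> real"
  assumes "set_integrable lborel {a..b} f" "a \<le> c" "c \<le> b"
  shows "(LBINT t:{a..b}. f t) = (LBINT t:{a..c}. f t) + (LBINT t:{c..b}. f t)"
proof -
  have "set_integrable lborel {a..c} f" "set_integrable lborel {c..b} f"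
    using assms by (auto intro: set_integrable_subset)
  then show ?thesis
    using assms by (simp add: set_borel_integral_eq_integral Henstock_Kurzweil_Integration.integral_combine)
qed

lemma set_integrable_continuous_mult:
  fixes f :: "real \<Rightarrow> real"
  assumes c: "continuous_on {a..b} c" and f: "set_integrable lborel {a..b} f"
  shows "set_integrable lborel {a..b} (\<lambda>x. c x * f x)"
proof -
  have "bounded (c ` {a..b})"
    using c by (simp add: compact_continuous_image compact_imp_bounded)
  then obtain B where B: "\<And>x. x \<in> {a..b} \<Longrightarrow> \<bar>c x\<bar> \<le> B"
    unfolding bounded_iff real_norm_def by blast
  have m: "(\<lambda>x. indicator {a..b} x *\<^sub>R c x) \<in> borel_measurable borel"
    using c by (intro borel_measurable_continuous_on_indicator) auto
  have "integrable lborel (\<lambda>x. B * (indicator {a..b} x *\<^sub>R f x))"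
    using f unfolding set_integrable_def by (intro integrable_mult_right) auto
  then have "integrable lborel (\<lambda>x. (indicator {a..b} x *\<^sub>R c x) * (indicator {a..b} x *\<^sub>R f x))"
  proof (rule Bochner_Integration.integrable_bound)
    show "(\<lambda>x. (indicator {a..b} x *\<^sub>R c x) * (indicator {a..b} x *\<^sub>R f x)) \<in> borel_measurable lborel"
      using f m unfolding set_integrable_def by (intro borel_measurable_times) auto
    show "AE x in lborel. norm ((indicator {a..b} x *\<^sub>R c x) * (indicator {a..b} x *\<^sub>R f x))
        \<le> norm (B * (indicator {a..b} x *\<^sub>R f x))"
    proof (intro AE_I2)
      fix x show "norm ((indicator {a..b} x *\<^sub>R c x) * (indicator {a..b} x *\<^sub>R f x))
        \<le> norm (B * (indicator {a..b} x *\<^sub>R f x))"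
        using B[of x] by (auto simp: abs_mult split: split_indicator intro!: mult_right_mono)
    qed
  qed
  moreover have "(indicator {a..b} x *\<^sub>R c x) * (indicator {a..b} x *\<^sub>R f x)
      = indicator {a..b} x *\<^sub>R (c x * f x)" for x by (simp split: split_indicator)
  ultimately show ?thesis unfolding set_integrable_def by (simp only:)
qed

lemma weak_derivative_onD:
  assumes "weak_derivative_on S f f'" "a \<in> S" "b \<in> S" "a \<le> b"
  shows "set_integrable lborel {a..b} f'" "f b - f a = (LBINT t:{a..b}. f' t)"
  using assms by (auto simp: weak_derivative_on_def)

lemma weak_derivative_on_continuous_Icc:
  assumes S: "connected S" and f: "weak_derivative_on S f f'" and "a \<in> S" "b \<in> S"
  shows "continuous_on {a..b} f"
proof (cases "a \<le> b")
  case True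
  have i: "set_integrable lborel {a..b} f'" using weak_derivative_onD[OF f] assms True by auto
  have "continuous_on {a..b} (\<lambda>x. f a + integral {a..x} f')"
    using set_borel_integral_eq_integral(1)[OF i]
    by (intro continuous_intros indefinite_integral_continuous_1)
  moreover have "f a + integral {a..x} f' = f x" if "x \<in> {a..b}" for x
  proof -
    have "x \<in> S" using Icc_subset_connected[OF S] assms that by blast
    then have "f x - f a = (LBINT t:{a..x}. f' t)" "set_integrable lborel {a..x} f'"
      using weak_derivative_onD[OF f, of a x] assms that by auto
    then show ?thesis by (simp add: set_borel_integral_eq_integral)
  qed
  ultimately show ?thesis by (rule continuous_on_eq)
qed auto

lemma Icc_nhd_in_open:
  fixes S :: "real set"
  assumes "open S" "x \<in> S"
  obtains a b where "a \<in> \<rat>" "b \<in> \<rat>" "a < x" "x < b" "a \<in> S" "b \<in> S"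
proof -
  obtain e where e: "e > 0" "ball x e \<subseteq> S" using assms open_contains_ball_eq by blast
  obtain a where "a \<in> \<rat>" "x - e < a" "a < x" using Rats_dense_in_real[of "x-e" x] e by auto
  moreover obtain b where "b \<in> \<rat>" "x < b" "b < x + e" using Rats_dense_in_real[of x "x+e"] e by auto
  moreover have "y \<in> S" if "x - e < y" "y < x + e" for y
    using e(2) that by (auto simp: subset_iff dist_real_def abs_less_iff)
  ultimately show ?thesis using that[of a b] by auto
qed

lemma weak_derivative_on_continuous:
  assumes "open S" and S: "connected S" and f: "weak_derivative_on S f f'"
  shows "continuous_on S f"
proof (rule continuous_at_imp_continuous_on, rule ballI)
  fix x assume "x \<in> S"
  obtain a b where ab: "a < x" "x < b" "a \<in> S" "b \<in> S"
    by (rule Icc_nhd_in_open[OF \<open>open S\<close> \<open>x \<in> S\<close>]) blast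
  then have "continuous_on {a<..<b} f"
    using weak_derivative_on_continuous_Icc[OF S f, of a b]
    by (auto intro: continuous_on_subset)
  then show "isCont f x" using ab by (simp add: continuous_on_eq_continuous_at)
qed

lemma weak_derivative_on_AE_deriv:
  assumes "open S" and S: "connected S" and f: "weak_derivative_on S f f'"
  shows "AE x in lborel. x \<in> S \<longrightarrow> (f has_real_derivative f' x) (at x)"
proof -
  have "AE x in lborel. a < x \<and> x < b \<longrightarrow> (f has_real_derivative f' x) (at x)"
    if ab: "a \<in> S" "b \<in> S" for a b
  proof (cases "a < b")
    case True
    let ?g = "\<lambda>t. indicator {a..b} t *\<^sub>R f' t"
    have "integrable lborel ?g"
      using weak_derivative_onD[OF f ab] True by (simp add: set_integrable_def)
    from lebesgue_differentiation[OF this] show ?thesis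
    proof eventually_elim
      case (elim x)
      show ?case
      proof (intro impI)
        assume x: "a < x \<and> x < b"
        have "(LBINT t:{..u}. ?g t) = f u - f a" if "u \<in> {a<..<b}" for u
        proof -
          have "u \<in> S" using Icc_subset_connected[OF S ab] that by auto
          then have "f u - f a = (LBINT t:{a..u}. f' t)"
            using weak_derivative_onD(2)[OF f ab(1)] that by auto
          also have "\<dots> = (LBINT t:{..u}. ?g t)"
            unfolding set_lebesgue_integral_def using that
            by (intro Bochner_Integration.integral_cong) (auto split: split_indicator)
          finally show ?thesis by simp
        qed
        moreover have "((\<lambda>u. LBINT t:{..u}. ?g t) has_real_derivative f' x) (at x)"
          using elim x by simp
        ultimately have "((\<lambda>u. f u - f a) has_real_derivative f' x) (at x)"
          using x by (elim has_field_derivative_transform_within_open[where S="{a<..<b}"]) auto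
        then have "((\<lambda>u. (f u - f a) + f a) has_real_derivative f' x + 0) (at x)"
          by (intro DERIV_add DERIV_const)
        then show "(f has_real_derivative f' x) (at x)" by simp
      qed
    qed
  qed auto
  then have "AE x in lborel. \<forall>p\<in>(\<rat> \<inter> S) \<times> (\<rat> \<inter> S). fst p < x \<and> x < snd p \<longrightarrow>
      (f has_real_derivative f' x) (at x)"
    by (subst AE_ball_countable) (auto intro: countable_rat countable_Int1)
  then show ?thesis
  proof eventually_elim
    case (elim x)
    show ?case
    proof
      assume "x \<in> S"
      then obtain a b where "a \<in> \<rat> \<inter> S" "b \<in> \<rat> \<inter> S" "a < x" "x < b"
        by (rule Icc_nhd_in_open[OF \<open>open S\<close>]) blast
      with elim show "(f has_real_derivative f' x) (at x)" by (auto dest: bspec[where x="(a,b)"])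
    qed
  qed
qed

lemma MVT_unordered:
  fixes H :: "real \<Rightarrow> real"
  assumes "\<And>u. (H has_real_derivative H' u) (at u)"
  shows "\<exists>\<xi>. min p q \<le> \<xi> \<and> \<xi> \<le> max p q \<and> H q - H p = H' \<xi> * (q - p)"
proof (cases p q rule: linorder_cases)
  case less
  then obtain z where "z > p" "z < q" "H q - H p = (q - p) * H' z"
    using MVT2[of p q H H'] assms by auto
  then show ?thesis by (intro exI[of _ z]) auto
next
  case greater
  then obtain z where "z > q" "z < p" "H p - H q = (p - q) * H' z"
    using MVT2[of q p H H'] assms by auto
  then show ?thesis by (intro exI[of _ z]) (auto simp: algebra_simps)
qed auto

text \<open>
  By the mean value theorem, over a short interval the increment of H o f differs from the integral of
  (H' o f) f' by at most e times the integral of |f'|.  Such an estimate is additive over adjacent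
  intervals, so Bolzano's bisection principle propagates it to the whole interval, and e is arbitrary.
\<close>

lemma weak_derivative_on_chain:
  assumes S: "connected S" and f: "weak_derivative_on S f f'"
    and H: "\<And>u. (H has_real_derivative H' u) (at u)" and H': "continuous_on UNIV H'"
  shows "weak_derivative_on S (\<lambda>x. H (f x)) (\<lambda>x. H' (f x) * f' x)"
  unfolding weak_derivative_on_def
proof (intro ballI impI conjI)
  fix a b assume ab: "a \<in> S" "b \<in> S" "a \<le> b"
  have fi: "set_integrable lborel {a..b} f'" using weak_derivative_onD[OF f ab] by auto
  have fc: "continuous_on {a..b} f" using weak_derivative_on_continuous_Icc[OF S f] ab by auto
  show int: "set_integrable lborel {a..b} (\<lambda>x. H' (f x) * f' x)"
    by (rule set_integrable_continuous_mult[OF _ fi])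
       (auto intro: continuous_on_compose2[OF H' fc])
  have fi': "set_integrable lborel {a..b} (\<lambda>x. \<bar>f' x\<bar>)" using fi by (rule set_integrable_abs)
  define D where "D x y = H (f y) - H (f x) - (LBINT t:{x..y}. H' (f t) * f' t)" for x y
  have bound: "\<bar>D a b\<bar> \<le> e * (LBINT t:{a..b}. \<bar>f' t\<bar>)" if e: "e > 0" for e
  proof -
    define P where "P x y \<longleftrightarrow> (a \<le> x \<and> y \<le> b \<longrightarrow> \<bar>D x y\<bar> \<le> e * (LBINT t:{x..y}. \<bar>f' t\<bar>))" for x y
    have "P a b"
      using \<open>a \<le> b\<close>
    proof (induction rule: Bolzano)
      case (trans x y z)
      show ?case
        unfolding P_def
      proof
        assume xz: "a \<le> x \<and> z \<le> b"
        then have 1: "\<bar>D x y\<bar> \<le> e * (LBINT t:{x..y}. \<bar>f' t\<bar>)" "\<bar>D y z\<bar> \<le> e * (LBINT t:{y..z}. \<bar>f' t\<bar>)"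
          using trans by (auto simp: P_def)
        have "{x..z} \<subseteq> {a..b}" using xz by auto
        then have "set_integrable lborel {x..z} (\<lambda>x. H' (f x) * f' x)"
          "set_integrable lborel {x..z} (\<lambda>x. \<bar>f' x\<bar>)"
          using int fi' by (auto intro: set_integrable_subset)
        then have "D x z = D x y + D y z"
          "(LBINT t:{x..z}. \<bar>f' t\<bar>) = (LBINT t:{x..y}. \<bar>f' t\<bar>) + (LBINT t:{y..z}. \<bar>f' t\<bar>)"
          using trans by (simp_all add: D_def set_integral_split_Icc[where c=y])
        then show "\<bar>D x z\<bar> \<le> e * (LBINT t:{x..z}. \<bar>f' t\<bar>)" using 1 by (simp add: algebra_simps)
      qed
    next
      case (local x)
      have "isCont H' (f x)" using H' by (simp add: continuous_on_eq_continuous_at)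
      then obtain \<eta> where \<eta>: "\<eta> > 0" "\<And>v. \<bar>v - f x\<bar> < \<eta> \<Longrightarrow> \<bar>H' v - H' (f x)\<bar> < e/2"
        using e unfolding continuous_at_eps_delta by (metis dist_real_def half_gt_zero)
      from fc local obtain \<delta> where \<delta>: "\<delta> > 0" "\<And>y. y \<in> {a..b} \<Longrightarrow> \<bar>y - x\<bar> < \<delta> \<Longrightarrow> \<bar>f y - f x\<bar> < \<eta>"
        using \<eta>(1) unfolding continuous_on_iff dist_real_def by (metis atLeastAtMost_iff)
      show ?case
        unfolding P_def
      proof (intro exI[of _ \<delta>] conjI allI impI \<open>\<delta> > 0\<close>)
        fix u v assume uv: "u \<le> x \<and> x \<le> v \<and> v - u < \<delta>" and uv': "a \<le> u \<and> v \<le> b"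
        have near: "\<bar>f s - f x\<bar> < \<eta>" if "s \<in> {u..v}" for s
          using \<delta>(2)[of s] that uv uv' by (auto simp: abs_less_iff)
        obtain \<xi> where \<xi>: "min (f u) (f v) \<le> \<xi>" "\<xi> \<le> max (f u) (f v)"
          "H (f v) - H (f u) = H' \<xi> * (f v - f u)"
          using MVT_unordered[OF H] by blast
        have "\<bar>\<xi> - f x\<bar> < \<eta>" using near[of u] near[of v] \<xi>(1,2) uv
          by (auto simp: abs_less_iff min_def max_def split: if_splits)
        then have *: "\<bar>H' \<xi> - H' (f s)\<bar> \<le> e" if "s \<in> {u..v}" for s
          using \<eta>(2)[of \<xi>] \<eta>(2)[OF near[OF that]] by linarith
        have uvS: "u \<in> S" "v \<in> S" using Icc_subset_connected[OF S ab(1,2)] uv uv' by auto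
        have sub: "{u..v} \<subseteq> {a..b}" using uv' by auto
        have i1: "set_integrable lborel {u..v} f'" "set_integrable lborel {u..v} (\<lambda>x. H' (f x) * f' x)"
          "set_integrable lborel {u..v} (\<lambda>x. \<bar>f' x\<bar>)"
          using fi int fi' sub by (auto intro: set_integrable_subset)
        have "f v - f u = (LBINT t:{u..v}. f' t)" using weak_derivative_onD(2)[OF f uvS] uv by simp
        then have "D u v = (LBINT t:{u..v}. H' \<xi> * f' t) - (LBINT t:{u..v}. H' (f t) * f' t)"
          unfolding D_def \<xi>(3) by simp
        also have "\<dots> = (LBINT t:{u..v}. H' \<xi> * f' t - H' (f t) * f' t)"
          using i1 by (intro set_integral_diff(2)[symmetric]) auto
        also have "\<bar>\<dots>\<bar> \<le> (LBINT t:{u..v}. e * \<bar>f' t\<bar>)"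
          unfolding set_lebesgue_integral_def
        proof (rule integral_abs_bound_integral)
          show "integrable lborel (\<lambda>t. indicator {u..v} t *\<^sub>R (H' \<xi> * f' t - H' (f t) * f' t))"
            using set_integral_diff(1)[OF set_integrable_mult_right[OF i1(1)] i1(2)]
            unfolding set_integrable_def .
          show "integrable lborel (\<lambda>t. indicator {u..v} t *\<^sub>R (e * \<bar>f' t\<bar>))"
            using set_integrable_mult_right[OF i1(3), of e] unfolding set_integrable_def .
          fix t
          show "\<bar>indicator {u..v} t *\<^sub>R (H' \<xi> * f' t - H' (f t) * f' t)\<bar> \<le> indicator {u..v} t *\<^sub>R (e * \<bar>f' t\<bar>)"
            using *[of t] by (auto split: split_indicator simp: abs_mult left_diff_distrib[symmetric]
                intro!: mult_right_mono)
        qed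
        also have "\<dots> = e * (LBINT t:{u..v}. \<bar>f' t\<bar>)" by simp
        finally show "\<bar>D u v\<bar> \<le> e * (LBINT t:{u..v}. \<bar>f' t\<bar>)" .
      qed
    qed
    then show ?thesis by (simp add: P_def)
  qed
  have "D a b = 0"
  proof (rule ccontr)
    assume "D a b \<noteq> 0"
    define K where "K = (LBINT t:{a..b}. \<bar>f' t\<bar>)"
    have "K \<ge> 0" unfolding K_def set_lebesgue_integral_def by (rule Bochner_Integration.integral_nonneg) auto
    then have "\<bar>D a b\<bar> * (2 * (K + 1)) \<le> \<bar>D a b\<bar> * K"
      using bound[of "\<bar>D a b\<bar> / (2 * (K + 1))"] \<open>D a b \<noteq> 0\<close>
      by (simp add: K_def[symmetric] field_simps)
    then have "2 * (K + 1) \<le> K" using \<open>D a b \<noteq> 0\<close> by simp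
    then show False using \<open>K \<ge> 0\<close> by simp
  qed
  then show "H (f b) - H (f a) = (LBINT t:{a..b}. H' (f t) * f' t)" by (simp add: D_def)
qed

lemma weak_derivative_on_add:
  assumes "weak_derivative_on S f f'" "weak_derivative_on S g g'"
  shows "weak_derivative_on S (\<lambda>x. f x + g x) (\<lambda>x. f' x + g' x)"
  unfolding weak_derivative_on_def
proof (intro ballI impI)
  fix a b assume ab: "a \<in> S" "b \<in> S" "a \<le> b"
  note f = weak_derivative_onD[OF assms(1) ab] and g = weak_derivative_onD[OF assms(2) ab]
  show "set_integrable lborel {a..b} (\<lambda>x. f' x + g' x) \<and>
      f b + g b - (f a + g a) = (LBINT t:{a..b}. f' t + g' t)"
    using set_integral_add[OF f(1) g(1)] f(2) g(2) by simp
qed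

lemma weak_derivative_on_cmult:
  assumes "weak_derivative_on S f f'"
  shows "weak_derivative_on S (\<lambda>x. c * f x) (\<lambda>x. c * f' x)"
  unfolding weak_derivative_on_def
  using weak_derivative_onD[OF assms] by (auto simp: right_diff_distrib[symmetric])

lemma weak_derivative_on_cong:
  assumes "weak_derivative_on S f f'" "connected S"
    "\<And>x. x \<in> S \<Longrightarrow> f x = g x" "\<And>x. x \<in> S \<Longrightarrow> f' x = g' x"
  shows "weak_derivative_on S g g'"
  unfolding weak_derivative_on_def
proof (intro ballI impI)
  fix a b assume ab: "a \<in> S" "b \<in> S" "a \<le> b"
  then have "\<And>x. x \<in> {a..b} \<Longrightarrow> f' x = g' x"
    using Icc_subset_connected[OF assms(2) ab(1,2)] assms(4) by auto
  then have "indicator {a..b} x *\<^sub>R f' x = indicator {a..b} x *\<^sub>R g' x" for x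
    by (auto split: split_indicator)
  then have "set_integrable lborel {a..b} f' = set_integrable lborel {a..b} g'"
    "(LBINT t:{a..b}. f' t) = (LBINT t:{a..b}. g' t)"
    unfolding set_integrable_def set_lebesgue_integral_def by (simp_all only:)
  then show "set_integrable lborel {a..b} g' \<and> g b - g a = (LBINT t:{a..b}. g' t)"
    using weak_derivative_onD[OF assms(1) ab] assms(3) ab by simp
qed

lemma weak_derivative_on_sum:
  assumes "\<And>i. i \<in> J \<Longrightarrow> weak_derivative_on S (f i) (f' i)"
  shows "weak_derivative_on S (\<lambda>x. \<Sum>i\<in>J. f i x) (\<lambda>x. \<Sum>i\<in>J. f' i x)"
  using assms
proof (induction J rule: infinite_finite_induct)
  case (insert i J)
  then show ?case by (simp add: weak_derivative_on_add)
qed (auto simp: weak_derivative_on_def set_integrable_def set_lebesgue_integral_def)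

text \<open>Polarisation reduces the product rule to the chain rule for the square.\<close>

lemma weak_derivative_on_mult:
  assumes S: "connected S" and fg: "weak_derivative_on S f f'" "weak_derivative_on S g g'"
  shows "weak_derivative_on S (\<lambda>x. f x * g x) (\<lambda>x. f' x * g x + f x * g' x)"
proof -
  have sq: "weak_derivative_on S (\<lambda>x. (h x)\<^sup>2) (\<lambda>x. 2 * h x * h' x)" if "weak_derivative_on S h h'" for h h'
    by (rule weak_derivative_on_chain[OF S that, of "\<lambda>u. u\<^sup>2" "\<lambda>u. 2 * u"])
       (auto intro!: derivative_eq_intros continuous_intros)
  have "weak_derivative_on S
    (\<lambda>x. (1/2) * (((f x + g x)\<^sup>2) + ((-1) * (f x)\<^sup>2 + (-1) * (g x)\<^sup>2)))
    (\<lambda>x. (1/2) * ((2 * (f x + g x) * (f' x + g' x)) + ((-1) * (2 * f x * f' x) + (-1) * (2 * g x * g' x))))"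
    by (intro weak_derivative_on_cmult weak_derivative_on_add sq fg)
  then show ?thesis
    by (rule weak_derivative_on_cong[OF _ S]) (auto simp: field_simps power2_eq_square)
qed

text \<open>
  The derivative of an everywhere differentiable function is always Henstock-Kurzweil integrable with
  the expected integral; if it agrees almost everywhere with a Lebesgue integrable function, both
  integrals coincide.
\<close>

lemma weak_derivative_on_everywhere_diff:
  assumes S: "connected S" and f: "\<And>x. x \<in> S \<Longrightarrow> (f has_real_derivative f' x) (at x)"
    and eq: "AE x in lborel. x \<in> S \<longrightarrow> f' x = g x"
    and g: "\<And>a b. a \<in> S \<Longrightarrow> b \<in> S \<Longrightarrow> a \<le> b \<Longrightarrow> set_integrable lborel {a..b} g"
  shows "weak_derivative_on S f g"
  unfolding weak_derivative_on_def
proof (intro ballI impI conjI g)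
  fix a b assume ab: "a \<in> S" "b \<in> S" "a \<le> b"
  have sub: "{a..b} \<subseteq> S" by (rule Icc_subset_connected[OF S ab(1,2)])
  have "(f' has_integral (f b - f a)) {a..b}"
  proof (rule fundamental_theorem_of_calculus[OF ab(3)])
    fix x assume "x \<in> {a..b}"
    then show "(f has_vector_derivative f' x) (at x within {a..b})"
      unfolding has_real_derivative_iff_has_vector_derivative[symmetric]
      using sub by (intro has_field_derivative_at_within[OF f]) auto
  qed
  then have "(g has_integral (f b - f a)) {a..b}"
    by (rule has_integral_spike[OF AE_lborel_imp_negligible[OF eq], rotated]) (use sub in auto)
  then show "f b - f a = (LBINT t:{a..b}. g t)"
    using g[OF ab] by (simp add: set_borel_integral_eq_integral integral_unique)
qed

lemma weak_derivative_on_C1: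
  assumes S: "connected S" and f: "\<And>x. x \<in> S \<Longrightarrow> (f has_real_derivative f' x) (at x)"
    and c: "continuous_on S f'"
  shows "weak_derivative_on S f f'"
  using S f
proof (rule weak_derivative_on_everywhere_diff)
  fix a b assume "a \<in> S" "b \<in> S" "a \<le> b"
  then show "set_integrable lborel {a..b} f'"
    using Icc_subset_connected[OF S] c
    by (intro borel_integrable_atLeastAtMost') (blast intro: continuous_on_subset)
qed auto

section \<open>Differentiation under the integral sign along almost every line\<close>

lemma nonempty_open_not_AE_outside:
  fixes S :: "real set"
  assumes "open S" "x \<in> S" "AE y in lborel. y \<in> S \<longrightarrow> P y"
  obtains y where "y \<in> S" "P y"
proof -
  obtain a b where ab: "a < x" "x < b" "a \<in> S" "b \<in> S"
    by (rule Icc_nhd_in_open[OF assms(1,2)]) blast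
  have "\<not> negligible S"
    using assms(1,2) open_not_negligible by blast
  then have "\<not> S \<subseteq> {y. \<not> (y \<in> S \<longrightarrow> P y)}"
    using AE_lborel_imp_negligible[OF assms(3)] negligible_subset by blast
  then show ?thesis using that by blast
qed

text \<open>
  A substitute for dominated differentiation under the integral sign: instead of a majorant, only a
  finite double integral of the derivative is required.  The weight v, bounded below on compact
  intervals, comes from the density of the variable y.
\<close>

lemma weak_derivative_on_parametric_integral:
  fixes a b :: "real \<Rightarrow> real \<Rightarrow> real" and v :: "real \<Rightarrow> real"
  assumes \<mu>: "sigma_finite_measure \<mu>" "sets \<mu> = sets borel"
    and I: "open I" "connected I"
    and J: "AE z in \<mu>. z \<in> J"
    and a [measurable]: "case_prod a \<in> borel_measurable (borel \<Otimes>\<^sub>M borel)"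
    and b [measurable]: "case_prod b \<in> borel_measurable (borel \<Otimes>\<^sub>M borel)"
    and deriv: "\<And>y z. y \<in> I \<Longrightarrow> z \<in> J \<Longrightarrow> ((\<lambda>y. a y z) has_real_derivative b y z) (at y)"
    and cont: "\<And>z. z \<in> J \<Longrightarrow> continuous_on I (\<lambda>y. b y z)"
    and v: "continuous_on I v" "\<And>y. y \<in> I \<Longrightarrow> v y > 0"
    and fin_a: "(\<integral>\<^sup>+y. indicator I y * ennreal (v y) * (\<integral>\<^sup>+z. ennreal \<bar>a y z\<bar> \<partial>\<mu>) \<partial>lborel) < \<infinity>"
    and fin_b: "(\<integral>\<^sup>+y. indicator I y * ennreal (v y) * (\<integral>\<^sup>+z. ennreal \<bar>b y z\<bar> \<partial>\<mu>) \<partial>lborel) < \<infinity>"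
  shows "\<And>y. y \<in> I \<Longrightarrow> integrable \<mu> (a y)"
    and "\<And>A. A \<in> sets borel \<Longrightarrow>
      weak_derivative_on I (\<lambda>y. LINT z:A|\<mu>. a y z) (\<lambda>y. LINT z:A|\<mu>. b y z)"
proof -
  interpret \<mu>: sigma_finite_measure \<mu> by fact
  interpret P: pair_sigma_finite lborel \<mu> ..
  note [measurable_cong] = \<mu>(2)
  have [measurable]: "I \<in> sets borel" using I by auto
  have vm [measurable]: "(\<lambda>y. indicator I y * ennreal (v y)) \<in> borel_measurable borel"
  proof -
    have "(\<lambda>y. indicator I y *\<^sub>R v y) \<in> borel_measurable borel"
      using v(1) by (intro borel_measurable_continuous_on_indicator) auto
    then have "(\<lambda>y. ennreal (indicator I y *\<^sub>R v y)) \<in> borel_measurable borel" by measurable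
    also have "(\<lambda>y. ennreal (indicator I y *\<^sub>R v y)) = (\<lambda>y. indicator I y * ennreal (v y))"
      by (auto split: split_indicator)
    finally show ?thesis .
  qed
  have bfin: "(\<integral>\<^sup>+y. indicator {p..q} y * (\<integral>\<^sup>+z. ennreal \<bar>b y z\<bar> \<partial>\<mu>) \<partial>lborel) < \<infinity>"
    if pq: "p \<in> I" "q \<in> I" for p q
  proof (cases "p \<le> q")
    case True
    have sub: "{p..q} \<subseteq> I" by (rule Icc_subset_connected[OF I(2) pq])
    obtain y0 where y0: "y0 \<in> {p..q}" "\<And>y. y \<in> {p..q} \<Longrightarrow> v y0 \<le> v y"
      using continuous_attains_inf[of "{p..q}" v] continuous_on_subset[OF v(1) sub] True by auto
    define c where "c = v y0"
    have c: "c > 0" "\<And>y. y \<in> {p..q} \<Longrightarrow> c \<le> v y" using y0 v(2) sub by (auto simp: c_def)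
    have "ennreal c * (\<integral>\<^sup>+y. indicator {p..q} y * (\<integral>\<^sup>+z. ennreal \<bar>b y z\<bar> \<partial>\<mu>) \<partial>lborel)
      = (\<integral>\<^sup>+y. ennreal c * (indicator {p..q} y * (\<integral>\<^sup>+z. ennreal \<bar>b y z\<bar> \<partial>\<mu>)) \<partial>lborel)"
      by (intro nn_integral_cmult[symmetric]) measurable
    also have "\<dots> \<le> (\<integral>\<^sup>+y. indicator I y * ennreal (v y) * (\<integral>\<^sup>+z. ennreal \<bar>b y z\<bar> \<partial>\<mu>) \<partial>lborel)"
    proof (intro nn_integral_mono)
      fix y show "ennreal c * (indicator {p..q} y * (\<integral>\<^sup>+z. ennreal \<bar>b y z\<bar> \<partial>\<mu>))
        \<le> indicator I y * ennreal (v y) * (\<integral>\<^sup>+z. ennreal \<bar>b y z\<bar> \<partial>\<mu>)"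
        using c(2)[of y] sub by (auto split: split_indicator intro!: mult_right_mono ennreal_leI)
    qed
    also have "\<dots> < \<infinity>" by fact
    finally show ?thesis using c(1) by (auto simp: ennreal_mult_less_top top_unique less_top)
  qed simp
  have FTC: "integral {p..q} (\<lambda>y. b y z) = a q z - a p z"
    "(\<lambda>y. b y z) integrable_on {p..q}" "set_integrable lborel {p..q} (\<lambda>y. b y z)"
    if pq: "p \<in> I" "q \<in> I" "p \<le> q" "z \<in> J" for p q z
  proof -
    have sub: "{p..q} \<subseteq> I" by (rule Icc_subset_connected[OF I(2) pq(1,2)])
    have "((\<lambda>y. b y z) has_integral (a q z - a p z)) {p..q}"
    proof (rule fundamental_theorem_of_calculus[OF pq(3)])
      fix x assume "x \<in> {p..q}"
      then show "((\<lambda>y. a y z) has_vector_derivative b x z) (at x within {p..q})"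
        unfolding has_real_derivative_iff_has_vector_derivative[symmetric]
        using sub by (intro has_field_derivative_at_within[OF deriv[OF _ pq(4)]]) auto
    qed
    then show "integral {p..q} (\<lambda>y. b y z) = a q z - a p z" "(\<lambda>y. b y z) integrable_on {p..q}"
      by (auto simp: integral_unique has_integral_integrable)
    show "set_integrable lborel {p..q} (\<lambda>y. b y z)"
      by (intro borel_integrable_atLeastAtMost' continuous_on_subset[OF cont[OF pq(4)] sub])
  qed
  have AE_fin: "AE y in lborel. y \<in> I \<longrightarrow> (\<integral>\<^sup>+z. ennreal \<bar>a y z\<bar> \<partial>\<mu>) < \<infinity>"
  proof -
    have "AE y in lborel. indicator I y * ennreal (v y) * (\<integral>\<^sup>+z. ennreal \<bar>a y z\<bar> \<partial>\<mu>) \<noteq> \<infinity>"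
      using fin_a by (intro nn_integral_PInf_AE) auto
    then show ?thesis
    proof eventually_elim
      case (elim y)
      show ?case using elim v(2)[of y]
        by (auto simp: ennreal_mult_eq_top_iff less_top)
    qed
  qed
  show int_a: "integrable \<mu> (a y)" if y: "y \<in> I" for y
  proof -
    obtain y0 where y0: "y0 \<in> I" "(\<integral>\<^sup>+z. ennreal \<bar>a y0 z\<bar> \<partial>\<mu>) < \<infinity>"
      using nonempty_open_not_AE_outside[OF I(1) y AE_fin] .
    define p q where "p = min y y0" and "q = max y y0"
    have pq: "p \<in> I" "q \<in> I" "p \<le> q" using y y0 by (auto simp: p_def q_def min_def max_def)
    have "(\<integral>\<^sup>+z. ennreal \<bar>a y z\<bar> \<partial>\<mu>) \<le>
      (\<integral>\<^sup>+z. ennreal \<bar>a y0 z\<bar> + (\<integral>\<^sup>+u. indicator {p..q} u * ennreal \<bar>b u z\<bar> \<partial>lborel) \<partial>\<mu>)"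
    proof (rule nn_integral_mono_AE, use J in eventually_elim)
      case (elim z)
      note F = FTC[OF pq elim]
      have i: "set_integrable lborel {p..q} (\<lambda>u. \<bar>b u z\<bar>)" using F(3) by (rule set_integrable_abs)
      have "\<bar>a q z - a p z\<bar> = \<bar>LBINT u:{p..q}. b u z\<bar>"
        using F by (simp add: set_borel_integral_eq_integral)
      also have "\<dots> \<le> (LBINT u:{p..q}. \<bar>b u z\<bar>)"
        unfolding set_lebesgue_integral_def
        by (rule order_trans[OF integral_abs_bound])
           (auto intro!: eq_refl Bochner_Integration.integral_cong simp: abs_mult split: split_indicator)
      finally have "ennreal \<bar>a q z - a p z\<bar> \<le> ennreal (LBINT u:{p..q}. \<bar>b u z\<bar>)"
        by (rule ennreal_leI)
      also have "\<dots> = (\<integral>\<^sup>+u. ennreal (indicator {p..q} u *\<^sub>R \<bar>b u z\<bar>) \<partial>lborel)"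
        using i unfolding set_lebesgue_integral_def set_integrable_def
        by (intro nn_integral_eq_integral[symmetric]) auto
      also have "\<dots> = (\<integral>\<^sup>+u. indicator {p..q} u * ennreal \<bar>b u z\<bar> \<partial>lborel)"
        by (intro nn_integral_cong) (auto split: split_indicator)
      finally have *: "ennreal \<bar>a q z - a p z\<bar> \<le> \<dots>" .
      have "\<bar>a y z\<bar> \<le> \<bar>a y0 z\<bar> + \<bar>a q z - a p z\<bar>"
        unfolding p_def q_def by (cases "y \<le> y0") auto
      then have "ennreal \<bar>a y z\<bar> \<le> ennreal \<bar>a y0 z\<bar> + ennreal \<bar>a q z - a p z\<bar>"
        by (simp flip: ennreal_plus)
      also have "\<dots> \<le> ennreal \<bar>a y0 z\<bar> + (\<integral>\<^sup>+u. indicator {p..q} u * ennreal \<bar>b u z\<bar> \<partial>lborel)"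
        by (intro add_left_mono *)
      finally show ?case .
    qed
    also have "\<dots> = (\<integral>\<^sup>+z. ennreal \<bar>a y0 z\<bar> \<partial>\<mu>) +
        (\<integral>\<^sup>+z. (\<integral>\<^sup>+u. indicator {p..q} u * ennreal \<bar>b u z\<bar> \<partial>lborel) \<partial>\<mu>)"
      by (intro nn_integral_add) measurable
    also have "(\<integral>\<^sup>+z. (\<integral>\<^sup>+u. indicator {p..q} u * ennreal \<bar>b u z\<bar> \<partial>lborel) \<partial>\<mu>)
       = (\<integral>\<^sup>+u. (\<integral>\<^sup>+z. indicator {p..q} u * ennreal \<bar>b u z\<bar> \<partial>\<mu>) \<partial>lborel)"
      by (intro P.Fubini') measurable
    also have "\<dots> = (\<integral>\<^sup>+u. indicator {p..q} u * (\<integral>\<^sup>+z. ennreal \<bar>b u z\<bar> \<partial>\<mu>) \<partial>lborel)"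
      by (intro nn_integral_cong nn_integral_cmult) measurable
    finally have "(\<integral>\<^sup>+z. ennreal \<bar>a y z\<bar> \<partial>\<mu>) < \<infinity>"
      using y0 bfin[OF pq(1,2)] by (auto simp: le_less_trans)
    then show ?thesis by (simp add: integrable_iff_bounded)
  qed
  show "weak_derivative_on I (\<lambda>y. LINT z:A|\<mu>. a y z) (\<lambda>y. LINT z:A|\<mu>. b y z)"
    if A [measurable]: "A \<in> sets borel" for A
    unfolding weak_derivative_on_def
  proof (intro ballI impI)
    fix p q assume pq: "p \<in> I" "q \<in> I" "p \<le> q"
    let ?h = "\<lambda>u z. indicator {p..q} u * (indicator A z * b u z)"
    have ih: "integrable (lborel \<Otimes>\<^sub>M \<mu>) (case_prod ?h)"
      unfolding integrable_iff_bounded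
    proof
      show hm: "case_prod ?h \<in> borel_measurable (lborel \<Otimes>\<^sub>M \<mu>)" by measurable
      have hm': "(\<lambda>x. ennreal (norm (case_prod ?h x))) \<in> borel_measurable (lborel \<Otimes>\<^sub>M \<mu>)"
        by (rule measurable_compose[OF hm]) measurable
      have "(\<integral>\<^sup>+x. ennreal (norm (case x of (u, z) \<Rightarrow> ?h u z)) \<partial>(lborel \<Otimes>\<^sub>M \<mu>))
        = (\<integral>\<^sup>+u. (\<integral>\<^sup>+z. ennreal (norm (?h u z)) \<partial>\<mu>) \<partial>lborel)"
        using \<mu>.nn_integral_fst[OF hm'] by simp
      also have "\<dots> \<le> (\<integral>\<^sup>+u. (\<integral>\<^sup>+z. indicator {p..q} u * ennreal \<bar>b u z\<bar> \<partial>\<mu>) \<partial>lborel)"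
        by (intro nn_integral_mono) (auto split: split_indicator)
      also have "\<dots> = (\<integral>\<^sup>+u. indicator {p..q} u * (\<integral>\<^sup>+z. ennreal \<bar>b u z\<bar> \<partial>\<mu>) \<partial>lborel)"
        by (intro nn_integral_cong nn_integral_cmult) measurable
      also have "\<dots> < \<infinity>" by (rule bfin[OF pq(1,2)])
      finally show "(\<integral>\<^sup>+x. ennreal (norm (case x of (u, z) \<Rightarrow> ?h u z)) \<partial>(lborel \<Otimes>\<^sub>M \<mu>)) < \<infinity>" .
    qed
    have eq: "(LINT z|\<mu>. ?h u z) = indicator {p..q} u *\<^sub>R (LINT z:A|\<mu>. b u z)" for u
      unfolding set_lebesgue_integral_def by simp
    have "integrable lborel (\<lambda>u. LINT z|\<mu>. ?h u z)" using P.integrable_fst'[OF ih] by simp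
    then have s: "set_integrable lborel {p..q} (\<lambda>u. LINT z:A|\<mu>. b u z)"
      unfolding eq set_integrable_def .
    have "(LBINT u:{p..q}. (LINT z:A|\<mu>. b u z)) = (LBINT u. LINT z|\<mu>. ?h u z)"
      unfolding eq set_lebesgue_integral_def[of lborel] ..
    also have "\<dots> = (LINT z|\<mu>. (LBINT u. ?h u z))"
      by (rule P.Fubini_integral[symmetric]) (rule ih)
    also have "\<dots> = (LINT z|\<mu>. indicator A z *\<^sub>R (a q z - a p z))"
    proof (rule integral_cong_AE)
      show "AE z in \<mu>. (LBINT u. ?h u z) = indicator A z *\<^sub>R (a q z - a p z)"
        using J
      proof eventually_elim
        case (elim z)
        have "(LBINT u. ?h u z) = indicator A z * (LBINT u:{p..q}. b u z)"
          unfolding set_lebesgue_integral_def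
          by (subst Bochner_Integration.integral_mult_right_zero[symmetric]) (simp add: mult_ac)
        then show ?case using FTC[OF pq elim] by (simp add: set_borel_integral_eq_integral)
      qed
    qed measurable
    also have "\<dots> = (LINT z:A|\<mu>. a q z) - (LINT z:A|\<mu>. a p z)"
      unfolding set_lebesgue_integral_def
      using integrable_mult_indicator[OF _ int_a[OF pq(1)], of A]
        integrable_mult_indicator[OF _ int_a[OF pq(2)], of A]
      by (subst Bochner_Integration.integral_diff[symmetric])
         (auto simp: right_diff_distrib \<mu>(2))
    finally show "set_integrable lborel {p..q} (\<lambda>u. LINT z:A|\<mu>. b u z) \<and>
      (LINT z:A|\<mu>. a q z) - (LINT z:A|\<mu>. a p z) = (LBINT u:{p..q}. (LINT z:A|\<mu>. b u z))"
      using s by simp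
  qed
qed

section \<open>Product laws and resampling of one coordinate\<close>

lemma upd_nth [simp]: "upd x k y $ i = (if i = k then y else x $ i)"
  by (simp add: upd_def)

lemma upd_upd [simp]: "upd (upd x k y) k z = upd x k z"
  by (simp add: upd_def vec_eq_iff)

lemma upd_self [simp]: "upd x k (x $ k) = x"
  by (simp add: upd_def vec_eq_iff)

lemma upd_commute: "i \<noteq> k \<Longrightarrow> upd (upd x i a) k b = upd (upd x k b) i a"
  by (simp add: upd_def vec_eq_iff)

lemma upd_eq_axis: "upd x k y = x + (y - x $ k) *\<^sub>R axis k 1"
  by (simp add: upd_def vec_eq_iff axis_def)

lemma measurable_vec_nth' [measurable (raw)]:
  "f \<in> borel_measurable M \<Longrightarrow> (\<lambda>w. (f w :: real ^ 'n::finite) $ k) \<in> borel_measurable M"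
  by (rule measurable_compose[OF _ borel_measurable_continuous_onI])
     (auto intro!: continuous_intros)

lemma measurable_upd [measurable (raw)]:
  fixes f :: "'a \<Rightarrow> real ^ 'n::finite"
  assumes [measurable]: "f \<in> borel_measurable M" "g \<in> borel_measurable M"
  shows "(\<lambda>w. upd (f w) k (g w)) \<in> borel_measurable M"
  unfolding upd_eq_axis by measurable

text \<open>
  The law of a vector with independent coordinates, axiomatised by invariance under redrawing the k-th
  coordinate.  An almost sure statement then holds at almost every point of almost every line, where a
  line is described by one of its points x.
\<close>

locale product_law =
  fixes N :: "(real ^ 'n::finite) measure" and I :: "'n \<Rightarrow> real set" and d :: "'n \<Rightarrow> real \<Rightarrow> real"
  assumes prob_N: "prob_space N" and sets_N [measurable_cong]: "sets N = sets borel"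
    and resample: "\<And>k f. f \<in> borel_measurable borel \<Longrightarrow>
      (\<integral>\<^sup>+x. f x \<partial>N) = (\<integral>\<^sup>+x. (\<integral>\<^sup>+y. f (upd x k y) * ennreal (d k y) \<partial>lborel) \<partial>N)"
    and open_I: "open (I k)" and connected_I: "connected (I k)"
    and d_pos: "x \<in> I k \<Longrightarrow> d k x > 0" and d_diff: "d k differentiable_on I k"
    and d_zero: "x \<notin> I k \<Longrightarrow> d k x = 0"
    and d_meas [measurable]: "d k \<in> borel_measurable borel"
begin

sublocale N: prob_space N by (rule prob_N)

abbreviation S :: "(real ^ 'n) set" where "S \<equiv> box_range I"

definition law :: "'n \<Rightarrow> real measure" where
  "law k = density lborel (\<lambda>y. ennreal (d k y))"

lemma d_nonneg: "d k y \<ge> 0"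
  using d_pos[of y k] d_zero[of y k] by (cases "y \<in> I k") auto

lemma I_borel [measurable]: "I k \<in> sets borel"
  using open_I by auto

lemma sets_law [measurable_cong]: "sets (law k) = sets borel"
  by (simp add: law_def)

lemma space_N: "space N = UNIV"
  using sets_eq_imp_space_eq[OF sets_N] by simp

lemma space_law [simp]: "space (law k) = UNIV"
  by (simp add: law_def)

lemma nn_integral_law:
  assumes [measurable]: "f \<in> borel_measurable borel"
  shows "(\<integral>\<^sup>+y. f y \<partial>law k) = (\<integral>\<^sup>+y. f y * ennreal (d k y) \<partial>lborel)"
  unfolding law_def by (subst nn_integral_density) (auto simp: mult.commute)

lemma prob_law: "prob_space (law k)"
proof
  have "(\<integral>\<^sup>+x. 1 \<partial>N) = (\<integral>\<^sup>+x. (\<integral>\<^sup>+y. 1 * ennreal (d k y) \<partial>lborel) \<partial>N)"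
    by (rule resample) simp
  then have "(\<integral>\<^sup>+y. ennreal (d k y) \<partial>lborel) = 1"
    by (simp add: N.emeasure_space_1)
  then show "emeasure (law k) (space (law k)) = 1"
    using nn_integral_law[of "\<lambda>_. 1" k] by simp
qed

sublocale law: prob_space "law k" for k by (rule prob_law)

sublocale NL: pair_prob_space N "law k" for k ..

lemma resample_law:
  assumes [measurable]: "f \<in> borel_measurable borel"
  shows "(\<integral>\<^sup>+x. f x \<partial>N) = (\<integral>\<^sup>+x. (\<integral>\<^sup>+y. f (upd x k y) \<partial>law k) \<partial>N)"
  by (subst resample[of f k], simp) (auto simp: nn_integral_law intro!: nn_integral_cong)

lemma distr_resample: "distr (N \<Otimes>\<^sub>M law k) borel (\<lambda>(x, y). upd x k y) = N"
proof (rule measure_eqI)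
  fix A assume "A \<in> sets (distr (N \<Otimes>\<^sub>M law k) borel (\<lambda>(x, y). upd x k y))"
  then have A [measurable]: "A \<in> sets borel" by simp
  have "emeasure (distr (N \<Otimes>\<^sub>M law k) borel (\<lambda>(x, y). upd x k y)) A
    = (\<integral>\<^sup>+p. indicator A (case p of (x, y) \<Rightarrow> upd x k y) \<partial>(N \<Otimes>\<^sub>M law k))"
    by (subst nn_integral_distr[where f="indicator A" and M'=borel, symmetric]) auto
  also have "\<dots> = (\<integral>\<^sup>+x. (\<integral>\<^sup>+y. indicator A (upd x k y) \<partial>law k) \<partial>N)"
    by (subst law.nn_integral_fst[symmetric]) auto
  also have "\<dots> = (\<integral>\<^sup>+x. indicator A x \<partial>N)"
    by (rule resample_law[symmetric]) measurable
  also have "\<dots> = emeasure N A" by (simp add: sets_N)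
  finally show "emeasure (distr (N \<Otimes>\<^sub>M law k) borel (\<lambda>(x, y). upd x k y)) A = emeasure N A" .
qed (simp add: sets_N)

lemma AE_law: "(AE y in law k. P y) \<longleftrightarrow> (AE y in lborel. y \<in> I k \<longrightarrow> P y)"
proof -
  have "0 < ennreal (d k y) \<longleftrightarrow> y \<in> I k" for y
    using d_pos[of y k] d_zero[of y k] by (cases "y \<in> I k") auto
  then show ?thesis unfolding law_def by (subst AE_density) auto
qed

lemma AE_law_I: "AE y in law k. y \<in> I k"
  by (simp add: AE_law)

lemma AE_resample:
  assumes "AE x in N. P x"
  shows "AE x in N. AE y in law k. P (upd x k y)"
proof -
  have "AE x in distr (N \<Otimes>\<^sub>M law k) borel (\<lambda>(x, y). upd x k y). P x"
    unfolding distr_resample using assms .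
  then obtain Z where Z: "Z \<in> null_sets (distr (N \<Otimes>\<^sub>M law k) borel (\<lambda>(x, y). upd x k y))" "{x. \<not> P x} \<subseteq> Z"
    by (auto simp: eventually_ae_filter)
  have "AE p in N \<Otimes>\<^sub>M law k. (case p of (x, y) \<Rightarrow> upd x k y) \<notin> Z"
    using AE_not_in[OF Z(1)] Z(1) by (subst (asm) AE_distr_iff) (auto dest: null_setsD2)
  from NL.AE_pair[OF this] have "AE x in N. AE y in law k. upd x k y \<notin> Z"
    by simp
  then show ?thesis using Z(2) by (auto elim!: eventually_mono)
qed

lemma AE_resample_rev:
  assumes [measurable]: "Measurable.pred borel P"
    and "AE x in N. AE y in law k. P (upd x k y)"
  shows "AE x in N. P x"
proof -
  have "AE p in N \<Otimes>\<^sub>M law k. P (case p of (x, y) \<Rightarrow> upd x k y)"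
    using assms(2) by (intro NL.AE_pair_measure) (auto simp: space_N)
  then have "AE x in distr (N \<Otimes>\<^sub>M law k) borel (\<lambda>(x, y). upd x k y). P x"
    by (subst AE_distr_iff) auto
  then show ?thesis unfolding distr_resample .
qed

lemma integral_resample:
  fixes f :: "real ^ 'n \<Rightarrow> real"
  assumes f [measurable]: "f \<in> borel_measurable borel" and int: "integrable N f"
  shows "AE x in N. integrable (law k) (\<lambda>y. f (upd x k y))"
    and "integrable N (\<lambda>x. LINT y|law k. f (upd x k y))"
    and "(LINT x|N. f x) = (LINT x|N. (LINT y|law k. f (upd x k y)))"
proof -
  have "integrable (distr (N \<Otimes>\<^sub>M law k) borel (\<lambda>(x, y). upd x k y)) f"
    using int by (simp add: distr_resample)
  then have i: "integrable (N \<Otimes>\<^sub>M law k) (\<lambda>p. f (case p of (x, y) \<Rightarrow> upd x k y))"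
    by (subst (asm) integrable_distr_eq) auto
  then have i': "integrable (N \<Otimes>\<^sub>M law k) (\<lambda>(x, y). f (upd x k y))"
    by (simp add: case_prod_unfold)
  show "AE x in N. integrable (law k) (\<lambda>y. f (upd x k y))"
    using NL.AE_integrable_fst'[OF i'] by simp
  show "integrable N (\<lambda>x. LINT y|law k. f (upd x k y))"
    using NL.integrable_fst'[OF i'] by simp
  have "(LINT x|N. f x) = (LINT x|distr (N \<Otimes>\<^sub>M law k) borel (\<lambda>(x, y). upd x k y). f x)"
    by (simp add: distr_resample)
  also have "\<dots> = (LINT p|(N \<Otimes>\<^sub>M law k). f (case p of (x, y) \<Rightarrow> upd x k y))"
    by (subst integral_distr) auto
  also have "\<dots> = (LINT p|(N \<Otimes>\<^sub>M law k). (\<lambda>(x, y). f (upd x k y)) p)"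
    by (simp add: case_prod_unfold)
  also have "\<dots> = (LINT x|N. (LINT y|law k. f (upd x k y)))"
    using NL.integral_fst'[OF i'] by simp
  finally show "(LINT x|N. f x) = (LINT x|N. (LINT y|law k. f (upd x k y)))" .
qed

lemma open_S: "open S"
proof -
  have "S = (\<Inter>k\<in>UNIV. (\<lambda>x. x $ k) -` I k)" by (auto simp: box_range_def)
  also have "open \<dots>"
    by (intro open_INT finite ballI open_vimage open_I continuous_intros)
  finally show ?thesis .
qed

lemma S_borel [measurable]: "S \<in> sets borel"
  using open_S by auto

lemma AE_S: "AE x in N. x \<in> S"
proof -
  have "AE x in N. x $ k \<in> I k" for k
    by (rule AE_resample_rev[of _ k]) (auto simp: AE_law)
  then have "AE x in N. \<forall>k\<in>UNIV. x $ k \<in> I k"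
    by (intro AE_finite_allI) auto
  then show ?thesis by eventually_elim (auto simp: box_range_def)
qed

lemma upd_in_S: "x \<in> S \<Longrightarrow> y \<in> I k \<Longrightarrow> upd x k y \<in> S"
  by (auto simp: box_range_def)

lemma S_nth: "x \<in> S \<Longrightarrow> x $ k \<in> I k"
  by (auto simp: box_range_def)

lemma continuous_on_d: "continuous_on (I k) (d k)"
  using d_diff by (rule differentiable_imp_continuous_on)

lemma d_has_derivative: "y \<in> I k \<Longrightarrow> (d k has_real_derivative deriv (d k) y) (at y)"
  using d_diff[of k] open_I[of k]
  by (simp add: DERIV_deriv_iff_real_differentiable differentiable_on_eq_differentiable_at)

lemma integrable_law:
  "f \<in> borel_measurable borel \<Longrightarrow> integrable (law k) f \<longleftrightarrow> integrable lborel (\<lambda>y. d k y * f y)"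
  for f :: "real \<Rightarrow> real"
  unfolding law_def by (subst integrable_real_density) (auto simp: d_nonneg)

lemma integral_law:
  "f \<in> borel_measurable borel \<Longrightarrow> (LINT y|law k. f y) = (LBINT y. d k y * f y)"
  for f :: "real \<Rightarrow> real"
  unfolding law_def by (subst integral_real_density) (auto simp: d_nonneg)

section \<open>Functions of class C1 along coordinate lines\<close>

text \<open>
  Extension by zero, which turns functions that are continuous on the box into Borel functions on the
  whole space.
\<close>

definition ext :: "(real ^ 'n \<Rightarrow> real) \<Rightarrow> real ^ 'n \<Rightarrow> real" where
  "ext f x = indicator S x * f x"

lemma ext_eq: "x \<in> S \<Longrightarrow> ext f x = f x"
  by (simp add: ext_def)

lemma ext_measurable [measurable]:
  "continuous_on S f \<Longrightarrow> ext f \<in> borel_measurable borel"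
  using borel_measurable_continuous_on_indicator[of S f] S_borel
  by (simp add: ext_def[abs_def])

lemma C1_imp:
  assumes "C_k_on 1 S f"
  shows "f differentiable_on S" "continuous_on S f" "continuous_on S (partial k f)"
  using assms by (auto intro: differentiable_imp_continuous_on)

lemma C2_imp_C1:
  assumes "C_k_on 2 S f"
  shows "C_k_on 1 S f" "C_k_on 1 S (partial k f)"
  using assms by (auto simp: numeral_2_eq_2 intro: differentiable_imp_continuous_on)

lemma continuous_on_line:
  assumes "continuous_on S f" "x \<in> S"
  shows "continuous_on (I k) (\<lambda>y. f (upd x k y))"
  by (rule continuous_on_compose2[OF assms(1)])
     (auto simp: upd_eq_axis upd_in_S[unfolded upd_eq_axis] assms(2) intro!: continuous_intros)

lemma C1_line_derivative:
  assumes f: "C_k_on 1 S f" and x: "x \<in> S" and y: "y \<in> I k"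
  shows "((\<lambda>t. f (upd x k t)) has_real_derivative partial k f (upd x k y)) (at y)"
proof -
  have u: "upd x k y \<in> S" using x y by (rule upd_in_S)
  have "f differentiable (at (upd x k y))"
    using C1_imp(1)[OF f] u open_S by (simp add: differentiable_on_eq_differentiable_at)
  moreover have "(\<lambda>t. upd x k t) differentiable (at y)"
    unfolding upd_eq_axis by (intro derivative_intros)
  ultimately have "(f \<circ> (\<lambda>t. upd x k t)) differentiable (at y)"
    by (intro differentiable_chain_at)
  then have "((\<lambda>t. f (upd x k t)) has_real_derivative deriv (\<lambda>t. f (upd x k t)) y) (at y)"
    by (simp add: DERIV_deriv_iff_real_differentiable o_def)
  then show ?thesis by (simp add: partial_def)
qed

lemma AE_iterated_integral_finite:
  assumes [measurable]: "f \<in> borel_measurable borel" and "integrable N f"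
  shows "AE x in N. (\<integral>\<^sup>+y. indicator (I k) y * ennreal (d k y) *
      (\<integral>\<^sup>+z. ennreal \<bar>f (upd (upd x k y) j z)\<bar> \<partial>law j) \<partial>lborel) < \<infinity>"
proof -
  let ?g = "\<lambda>x. (\<integral>\<^sup>+z. ennreal \<bar>f (upd x j z)\<bar> \<partial>law j)"
  have [measurable]: "?g \<in> borel_measurable borel" by measurable
  have "(\<integral>\<^sup>+x. (\<integral>\<^sup>+y. ?g (upd x k y) \<partial>law k) \<partial>N) = (\<integral>\<^sup>+x. ennreal \<bar>f x\<bar> \<partial>N)"
    using resample_law[of "\<lambda>x. ennreal \<bar>f x\<bar>" j] resample_law[of ?g k] by simp
  also have "\<dots> < \<infinity>" using assms(2) by (simp add: integrable_iff_bounded)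
  finally have "AE x in N. (\<integral>\<^sup>+y. ?g (upd x k y) \<partial>law k) \<noteq> \<infinity>"
    by (intro nn_integral_PInf_AE) auto
  then show ?thesis
  proof eventually_elim
    case (elim x)
    have "(\<integral>\<^sup>+y. ?g (upd x k y) \<partial>law k) = (\<integral>\<^sup>+y. ?g (upd x k y) * ennreal (d k y) \<partial>lborel)"
      by (rule nn_integral_law) measurable
    also have "\<dots> = (\<integral>\<^sup>+y. indicator (I k) y * ennreal (d k y) * ?g (upd x k y) \<partial>lborel)"
      by (intro nn_integral_cong) (auto simp: d_zero mult.commute split: split_indicator)
    finally show ?case using elim by (simp add: less_top)
  qed
qed

text \<open>
  The integral over coordinate j, as a function of another coordinate k.  It is stated for all sets A
  at once because it is applied both to the tail integral in L_op and, with A = UNIV, to the partial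
  expectation.
\<close>

lemma AE_line_other:
  assumes m: "C_k_on 1 S m" and i: "integrable N (ext m)" "integrable N (ext (partial k m))"
    and jk: "j \<noteq> k"
  shows "AE x in N. (\<forall>y\<in>I k. integrable (law j) (\<lambda>z. ext m (upd (upd x k y) j z))) \<and>
    (\<forall>A\<in>sets borel. weak_derivative_on (I k)
       (\<lambda>y. LINT z:A|law j. ext m (upd (upd x k y) j z))
       (\<lambda>y. LINT z:A|law j. ext (partial k m) (upd (upd x k y) j z)))"
proof -
  note c = C1_imp[OF m]
  have [measurable]: "ext m \<in> borel_measurable borel" "ext (partial k m) \<in> borel_measurable borel"
    using c by auto
  from AE_iterated_integral_finite[OF ext_measurable[OF c(2)] i(1), of k j]
    AE_iterated_integral_finite[OF ext_measurable[OF c(3)] i(2), of k j] AE_S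
  show ?thesis
  proof eventually_elim
    case (elim x)
    have S: "upd (upd x k y) j z \<in> S" if "y \<in> I k" "z \<in> I j" for y z
      using elim(3) that by (intro upd_in_S)
    have D: "((\<lambda>y. ext m (upd (upd x k y) j z)) has_real_derivative ext (partial k m) (upd (upd x k y) j z)) (at y)"
      if y: "y \<in> I k" and z: "z \<in> I j" for y z
    proof -
      have "((\<lambda>y. m (upd (upd x j z) k y)) has_real_derivative partial k m (upd (upd x j z) k y)) (at y)"
        using y z elim(3) by (intro C1_line_derivative m upd_in_S)
      then have "((\<lambda>y. m (upd (upd x k y) j z)) has_real_derivative partial k m (upd (upd x k y) j z)) (at y)"
        by (simp add: upd_commute[OF jk])
      then have "((\<lambda>y. ext m (upd (upd x k y) j z)) has_real_derivative partial k m (upd (upd x k y) j z)) (at y)"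
        by (rule has_field_derivative_transform_within_open[OF _ open_I y]) (simp add: ext_eq S z)
      then show ?thesis by (simp add: ext_eq S y z)
    qed
    have C: "continuous_on (I k) (\<lambda>y. ext (partial k m) (upd (upd x k y) j z))" if z: "z \<in> I j" for z
    proof -
      have "continuous_on (I k) (\<lambda>y. partial k m (upd (upd x j z) k y))"
        using z elim(3) by (intro continuous_on_line c upd_in_S)
      then show ?thesis
        by (rule continuous_on_eq) (simp add: ext_eq S z upd_commute[OF jk])
    qed
    note W = weak_derivative_on_parametric_integral[OF law.sigma_finite_measure_axioms sets_law open_I connected_I AE_law_I
        _ _ D C continuous_on_d d_pos]
    show ?case
      using elim(1,2) by (intro conjI ballI W) auto
  qed
qed

text \<open>
  The function d_k L_k whenever m is centred in direction k.
\<close>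

definition tail :: "'n \<Rightarrow> (real ^ 'n \<Rightarrow> real) \<Rightarrow> real ^ 'n \<Rightarrow> real" where
  "tail k m x = (LINT z:{x $ k<..}|law k. ext m (upd x k z))"

lemma tail_measurable [measurable]:
  assumes "continuous_on S m"
  shows "tail k m \<in> borel_measurable borel"
proof -
  have [measurable]: "ext m \<in> borel_measurable borel" using assms by auto
  have eq: "tail k m = (\<lambda>x. LINT z|law k. (if x $ k < z then ext m (upd x k z) else 0))"
    unfolding tail_def set_lebesgue_integral_def
    by (intro ext Bochner_Integration.integral_cong) auto
  show ?thesis unfolding eq by measurable
qed

lemma partial_expectation_eq:
  assumes "continuous_on S m" and x: "x \<in> S"
  shows "partial_expectation I d k m x = (LINT z|law k. ext m (upd x k z))"
proof -
  have [measurable]: "ext m \<in> borel_measurable borel" using assms by auto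
  show ?thesis
    unfolding partial_expectation_def set_lebesgue_integral_def
    by (subst integral_law)
       (auto intro!: Bochner_Integration.integral_cong simp: ext_eq d_zero upd_in_S[OF x] split: split_indicator)
qed

lemma L_op_eq:
  assumes "continuous_on S m" and x: "x \<in> S"
  shows "L_op I d k m x = 1 / d k (x $ k) *
     (LINT z:{x $ k<..}|law k. ext m (upd x k z) - (LINT z|law k. ext m (upd x k z)))"
proof -
  have [measurable]: "ext m \<in> borel_measurable borel" using assms by auto
  show ?thesis
    unfolding L_op_def set_lebesgue_integral_def partial_expectation_eq[OF assms]
    by (subst integral_law[of "\<lambda>z. indicator _ z *\<^sub>R _ z"], measurable)
       (auto intro!: arg_cong[where f="\<lambda>u. u / d k (x $ k)"] Bochner_Integration.integral_cong
         simp: ext_eq d_zero upd_in_S[OF x] split: split_indicator)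
qed

lemma L_op_eq_tail:
  assumes "continuous_on S m" and x: "x \<in> S" and "(LINT z|law k. ext m (upd x k z)) = 0"
  shows "L_op I d k m x = tail k m x / d k (x $ k)"
  using L_op_eq[OF assms(1,2)] assms(3) by (simp add: tail_def)

lemma ext_L_op_measurable [measurable]:
  assumes "continuous_on S m"
  shows "ext (L_op I d k m) \<in> borel_measurable borel"
proof -
  have [measurable]: "ext m \<in> borel_measurable borel" using assms by auto
  have eq: "ext (L_op I d k m) = (\<lambda>x. indicator S x * (1 / d k (x $ k) *
     (LINT z|law k. (if x $ k < z then ext m (upd x k z) - (LINT z|law k. ext m (upd x k z)) else 0))))"
  proof
    fix x
    show "ext (L_op I d k m) x = indicator S x * (1 / d k (x $ k) *
     (LINT z|law k. (if x $ k < z then ext m (upd x k z) - (LINT z|law k. ext m (upd x k z)) else 0)))"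
    proof (cases "x \<in> S")
      case True
      have "(LINT z:{x $ k<..}|law k. ext m (upd x k z) - (LINT z|law k. ext m (upd x k z)))
        = (LINT z|law k. (if x $ k < z then ext m (upd x k z) - (LINT z|law k. ext m (upd x k z)) else 0))"
        unfolding set_lebesgue_integral_def
        by (intro Bochner_Integration.integral_cong) auto
      then show ?thesis using L_op_eq[OF assms True] True by (simp add: ext_def)
    qed (simp add: ext_def)
  qed
  show ?thesis unfolding eq by measurable
qed

lemma tail_line_derivative:
  assumes m: "continuous_on S m" and x: "x \<in> S"
    and int: "integrable (law k) (\<lambda>z. ext m (upd x k z))" and y: "y \<in> I k"
  shows "((\<lambda>t. tail k m (upd x k t)) has_real_derivative - (m (upd x k y) * d k y)) (at y)"
proof -
  have [measurable]: "ext m \<in> borel_measurable borel" using m by auto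
  define h where "h z = d k z * ext m (upd x k z)" for z
  have hi: "integrable lborel h" using int by (simp add: integrable_law h_def[abs_def])
  have tail: "tail k m (upd x k t) = (LBINT z:{t<..}. h z)" for t
    unfolding tail_def set_lebesgue_integral_def
    by (subst integral_law) (auto intro!: Bochner_Integration.integral_cong simp: h_def)
  obtain a b where ab: "a < y" "y < b" "a \<in> I k" "b \<in> I k"
    by (rule Icc_nhd_in_open[OF open_I y]) blast
  have sub: "{a..b} \<subseteq> I k" by (rule Icc_subset_connected[OF connected_I ab(3,4)])
  have "continuous_on (I k) (\<lambda>z. d k z * m (upd x k z))"
    by (intro continuous_intros continuous_on_d continuous_on_line m x)
  then have "continuous_on (I k) h"
    by (rule continuous_on_eq) (simp add: h_def ext_eq upd_in_S x)
  then have hc: "continuous_on {a..b} h" using sub by (rule continuous_on_subset)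
  have "((\<lambda>t. (LBINT z. h z) - (LBINT z:{..t}. h z)) has_real_derivative 0 - h y) (at y)"
    by (intro DERIV_diff DERIV_const lower_integral_has_derivative[OF hi hc ab(1,2)])
  then have "((\<lambda>t. tail k m (upd x k t)) has_real_derivative 0 - h y) (at y)"
    unfolding tail LBINT_upper[OF hi] .
  then show ?thesis by (simp add: h_def ext_eq upd_in_S x y mult.commute)
qed

end

text \<open>
  The analytic content of a differentiable decomposition.  The identity F = E F + sum_k m_k enters only
  at the end; until then the sum of the m_k is kept as it stands.
\<close>

locale decomposed_statistic = product_law N I d
  for N :: "(real ^ 'n::finite) measure" and I :: "'n \<Rightarrow> real set" and d :: "'n \<Rightarrow> real \<Rightarrow> real" +
  fixes F :: "real ^ 'n \<Rightarrow> real" and m :: "'n \<Rightarrow> real ^ 'n \<Rightarrow> real"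
  assumes F_C2: "C_k_on 2 S F" and m_C1: "C_k_on 1 S (m k)"
    and m_int: "integrable N (ext (m k))" and dm_int: "integrable N (ext (partial i (m k)))"
    and m_centred: "AE x in N. partial_expectation I d k (m k) x = 0"
begin

abbreviation L where "L k \<equiv> L_op I d k (m k)"
abbreviation \<Theta> where "\<Theta> \<equiv> Theta I d F m"

lemma m_cont: "continuous_on S (m k)" using C1_imp[OF m_C1] by auto
lemma F_cont: "continuous_on S F" using C1_imp[OF C2_imp_C1(1)[OF F_C2]] by auto
lemma dF_cont: "continuous_on S (partial k F)" using C1_imp[OF C2_imp_C1(1)[OF F_C2]] by auto

lemma ext_meas [measurable]:
  "ext (m k) \<in> borel_measurable borel" "ext F \<in> borel_measurable borel"
  "ext (partial k F) \<in> borel_measurable borel" "ext (L k) \<in> borel_measurable borel"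
  "tail k (m k) \<in> borel_measurable borel"
  by (auto intro!: ext_measurable ext_L_op_measurable tail_measurable m_cont F_cont dF_cont)

lemma AE_centred: "AE x in N. (LINT z|law k. ext (m k) (upd x k z)) = 0"
  using m_centred[of k] AE_S by eventually_elim (simp add: partial_expectation_eq[OF m_cont])

lemma AE_L_line_self:
  "AE x in N. x \<in> S \<and> integrable (law k) (\<lambda>z. ext (m k) (upd x k z)) \<and>
     (LINT z|law k. ext (m k) (upd x k z)) = 0 \<and>
     (\<forall>y\<in>I k. L k (upd x k y) = tail k (m k) (upd x k y) / d k y)"
  using AE_S AE_centred[of k] integral_resample(1)[OF ext_meas(1) m_int, of k k]
proof eventually_elim
  case (elim x)
  then show ?case
    by (auto intro!: L_op_eq_tail[OF m_cont, THEN trans] upd_in_S)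
qed

text \<open>
  The partial expectation that is subtracted in L_op is known to vanish only at almost every point of
  the line.  It is itself absolutely continuous along the line, hence continuous, so it vanishes at
  every point and L_op becomes a tail integral.
\<close>

lemma AE_L_line_other:
  assumes jk: "j \<noteq> k"
  shows "AE x in N. x \<in> S \<and> (\<exists>\<phi>. weak_derivative_on (I k) (\<lambda>y. L j (upd x k y)) \<phi>)"
proof -
  from AE_S AE_line_other[OF m_C1[of j] m_int dm_int jk] AE_resample[OF AE_centred[of j], of k]
  show ?thesis
  proof eventually_elim
    case (elim x)
    define c where "c y = (LINT z|law j. ext (m j) (upd (upd x k y) j z))" for y
    have wc: "weak_derivative_on (I k) c (\<lambda>y. LINT z:UNIV|law j. ext (partial k (m j)) (upd (upd x k y) j z))"
    proof -
      have "c = (\<lambda>y. LINT z:UNIV|law j. ext (m j) (upd (upd x k y) j z))"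
        by (simp add: c_def[abs_def] set_lebesgue_integral_def)
      then show ?thesis using elim(2) by (auto dest: bspec[where x=UNIV])
    qed
    have c0: "c y = 0" if y: "y \<in> I k" for y
    proof (rule ccontr)
      assume "c y \<noteq> 0"
      have "open (I k \<inter> c -` (-{0}))"
        by (intro continuous_open_preimage weak_derivative_on_continuous[OF open_I connected_I wc] open_I) auto
      also have "I k \<inter> c -` (-{0}) = {y \<in> I k. c y \<in> -{0}}" by auto
      finally have "open {y \<in> I k. c y \<in> -{0}}" .
      moreover have "AE y in lborel. y \<in> {y \<in> I k. c y \<in> -{0}} \<longrightarrow> False"
        using elim(3) unfolding AE_law by eventually_elim (auto simp: c_def)
      ultimately show False
        using nonempty_open_not_AE_outside[of "{y \<in> I k. c y \<in> -{0}}" y "\<lambda>_. False"] y \<open>c y \<noteq> 0\<close> by auto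
    qed
    have "L j (upd x k y) = 1 / d j (x $ j) * (LINT z:{x $ j<..}|law j. ext (m j) (upd (upd x k y) j z))"
      if y: "y \<in> I k" for y
      using L_op_eq_tail[OF m_cont upd_in_S[OF elim(1) y], of j j] c0[OF y] jk
      by (simp add: tail_def c_def)
    moreover have "weak_derivative_on (I k)
       (\<lambda>y. 1 / d j (x $ j) * (LINT z:{x $ j<..}|law j. ext (m j) (upd (upd x k y) j z)))
       (\<lambda>y. 1 / d j (x $ j) * (LINT z:{x $ j<..}|law j. ext (partial k (m j)) (upd (upd x k y) j z)))"
      using elim(2) by (intro weak_derivative_on_cmult) auto
    ultimately have "weak_derivative_on (I k) (\<lambda>y. L j (upd x k y))
       (\<lambda>y. 1 / d j (x $ j) * (LINT z:{x $ j<..}|law j. ext (partial k (m j)) (upd (upd x k y) j z)))"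
      by (elim weak_derivative_on_cong[OF _ connected_I]) auto
    then show ?case using elim(1) by blast
  qed
qed

text \<open>
  Along a line in direction k, the summand with index k is a quotient by the density d_k and is
  differentiable everywhere, with a derivative that may fail to be locally integrable; the other
  summands are absolutely continuous.
\<close>

lemma AE_Theta_line_split:
  "AE x in N. x \<in> S \<and> (\<exists>P P' B b. (\<forall>y\<in>I k. \<Theta> (upd x k y) = P y + B y) \<and>
     (\<forall>y\<in>I k. (P has_real_derivative P' y) (at y)) \<and> weak_derivative_on (I k) B b)"
proof -
  have "AE x in N. \<forall>j\<in>UNIV-{k}. x \<in> S \<and> (\<exists>\<phi>. weak_derivative_on (I k) (\<lambda>y. L j (upd x k y)) \<phi>)"
    by (intro AE_finite_allI AE_L_line_other) auto
  with AE_L_line_self[of k] show ?thesis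
  proof eventually_elim
    case (elim x)
    from elim(2) obtain \<phi> where \<phi>: "\<And>j. j \<noteq> k \<Longrightarrow> weak_derivative_on (I k) (\<lambda>y. L j (upd x k y)) (\<phi> j)"
      by (metis DiffI UNIV_I singletonD)
    define P where "P y = partial k F (upd x k y) * L k (upd x k y)" for y
    define B where "B y = (\<Sum>j\<in>UNIV-{k}. partial j F (upd x k y) * L j (upd x k y))" for y
    have dF: "((\<lambda>y. partial j F (upd x k y)) has_real_derivative partial k (partial j F) (upd x k y)) (at y)"
      if "y \<in> I k" for y j
      using elim(1) that by (intro C1_line_derivative C2_imp_C1(2)[OF F_C2]) auto
    have "\<exists>D. (P has_real_derivative D) (at y)" if y: "y \<in> I k" for y
    proof -
      have "((\<lambda>t. tail k (m k) (upd x k t) / d k t) has_real_derivative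
         ((- (m k (upd x k y) * d k y)) * d k y - tail k (m k) (upd x k y) * deriv (d k) y) / (d k y * d k y)) (at y)"
        using elim(1) y d_pos[OF y]
        by (intro DERIV_divide tail_line_derivative m_cont d_has_derivative) auto
      then have "((\<lambda>t. L k (upd x k t)) has_real_derivative
         ((- (m k (upd x k y) * d k y)) * d k y - tail k (m k) (upd x k y) * deriv (d k) y) / (d k y * d k y)) (at y)"
        by (rule has_field_derivative_transform_within_open[OF _ open_I y]) (use elim(1) in auto)
      from DERIV_mult[OF dF[OF y] this] show ?thesis unfolding P_def by blast
    qed
    then obtain P' where "\<And>y. y \<in> I k \<Longrightarrow> (P has_real_derivative P' y) (at y)" by metis
    moreover have "weak_derivative_on (I k) B (\<lambda>y. \<Sum>j\<in>UNIV-{k}.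
        partial k (partial j F) (upd x k y) * L j (upd x k y) + partial j F (upd x k y) * \<phi> j y)"
      unfolding B_def
    proof (intro weak_derivative_on_sum weak_derivative_on_mult[OF connected_I])
      fix j assume "j \<in> UNIV - {k}"
      show "weak_derivative_on (I k) (\<lambda>y. partial j F (upd x k y)) (\<lambda>y. partial k (partial j F) (upd x k y))"
        using elim(1) C1_imp(3)[OF C2_imp_C1(2)[OF F_C2]]
        by (intro weak_derivative_on_C1 connected_I dF continuous_on_line) auto
      show "weak_derivative_on (I k) (\<lambda>y. L j (upd x k y)) (\<phi> j)" using \<phi> \<open>j \<in> _\<close> by auto
    qed
    moreover have "\<Theta> (upd x k y) = P y + B y" for y
      unfolding Theta_def P_def B_def by (subst sum.remove[of UNIV k]) auto
    ultimately show ?case using elim(1) by blast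
  qed
qed

section \<open>Derivatives of Theta along almost every line\<close>

lemma ext_Theta_eq: "ext \<Theta> x = (\<Sum>k\<in>UNIV. ext (partial k F) x * ext (L k) x)"
  by (simp add: ext_def Theta_def sum_distrib_left split: split_indicator)

lemma ext_Theta_measurable [measurable]: "ext \<Theta> \<in> borel_measurable borel"
  unfolding ext_Theta_eq[abs_def] by measurable

text \<open>
  A Borel version of the partial derivative of Theta, obtained as a limit of difference quotients.
\<close>

definition D\<Theta> :: "'n \<Rightarrow> real ^ 'n \<Rightarrow> real" where
  "D\<Theta> k x = lim (\<lambda>n. (ext \<Theta> (upd x k (x $ k + inverse (real (Suc n)))) - ext \<Theta> x) / inverse (real (Suc n)))"

lemma D\<Theta>_measurable [measurable]: "D\<Theta> k \<in> borel_measurable borel"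
  unfolding D\<Theta>_def[abs_def] by measurable

lemma ext_Theta_line_derivative:
  assumes "x \<in> S" "y \<in> I k"
  shows "((\<lambda>t. ext \<Theta> (upd x k t)) has_real_derivative D) (at y) \<longleftrightarrow>
    ((\<lambda>t. \<Theta> (upd x k t)) has_real_derivative D) (at y)"
  by (rule DERIV_cong_ev)
     (use assms in \<open>auto intro!: eventually_mono[OF eventually_nhds_in_open[OF open_I]] simp: ext_eq upd_in_S\<close>)

lemma D\<Theta>_eq:
  assumes "x \<in> S" "y \<in> I k" "((\<lambda>t. \<Theta> (upd x k t)) has_real_derivative D) (at y)"
  shows "D\<Theta> k (upd x k y) = D"
proof -
  have "((\<lambda>t. ext \<Theta> (upd x k t)) has_real_derivative D) (at y)"
    using assms by (simp add: ext_Theta_line_derivative)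
  then have "((\<lambda>h. (ext \<Theta> (upd x k (y + h)) - ext \<Theta> (upd x k y)) / h) \<longlongrightarrow> D) (at 0)"
    by (simp add: DERIV_def)
  moreover have "filterlim (\<lambda>n. inverse (real (Suc n))) (at 0) sequentially"
    using LIMSEQ_inverse_real_of_nat by (auto simp: filterlim_at)
  ultimately have "(\<lambda>n. (ext \<Theta> (upd x k (y + inverse (real (Suc n)))) - ext \<Theta> (upd x k y)) / inverse (real (Suc n))) \<longlonglongrightarrow> D"
    by (rule filterlim_compose)
  then show ?thesis unfolding D\<Theta>_def upd_nth upd_upd by (simp add: limI)
qed

lemma AE_Theta_line_derivative:
  "AE x in N. x \<in> S \<and> continuous_on (I k) (\<lambda>y. \<Theta> (upd x k y)) \<and>
    (AE y in law k. ((\<lambda>t. \<Theta> (upd x k t)) has_real_derivative D\<Theta> k (upd x k y)) (at y))"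
  using AE_Theta_line_split[of k]
proof eventually_elim
  case (elim x)
  then obtain P P' B b where *: "x \<in> S" "\<And>y. y \<in> I k \<Longrightarrow> \<Theta> (upd x k y) = P y + B y"
    "\<And>y. y \<in> I k \<Longrightarrow> (P has_real_derivative P' y) (at y)" "weak_derivative_on (I k) B b" by blast
  have "continuous_on (I k) (\<lambda>y. P y + B y)"
    by (intro continuous_intros weak_derivative_on_continuous[OF open_I connected_I *(4)])
       (meson *(3) DERIV_isCont continuous_at_imp_continuous_on)
  then have c: "continuous_on (I k) (\<lambda>y. \<Theta> (upd x k y))"
    by (rule continuous_on_eq) (simp add: *(2))
  have "AE y in law k. ((\<lambda>t. \<Theta> (upd x k t)) has_real_derivative D\<Theta> k (upd x k y)) (at y)"
    unfolding AE_law using weak_derivative_on_AE_deriv[OF open_I connected_I *(4)]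
  proof eventually_elim
    case (elim y)
    show ?case
    proof
      assume y: "y \<in> I k"
      have "((\<lambda>t. P t + B t) has_real_derivative P' y + b y) (at y)"
        using elim y by (intro DERIV_add *(3)) auto
      then have "((\<lambda>t. \<Theta> (upd x k t)) has_real_derivative P' y + b y) (at y)"
        by (rule has_field_derivative_transform_within_open[OF _ open_I y]) (simp add: *(2))
      then show "((\<lambda>t. \<Theta> (upd x k t)) has_real_derivative D\<Theta> k (upd x k y)) (at y)"
        using D\<Theta>_eq[OF *(1) y] by simp
    qed
  qed
  with c *(1) show ?case by blast
qed

text \<open>
  Only rational increments are tested, which makes this a Borel property of x.  On lines where Theta is
  continuous it is equivalent to differentiability at x with derivative given by the Borel version.
\<close>

definition rational_differentiability :: "'n \<Rightarrow> real ^ 'n \<Rightarrow> bool" where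
  "rational_differentiability k x \<longleftrightarrow> (\<forall>i::nat. \<exists>l::nat. \<forall>r::rat. \<bar>real_of_rat r\<bar> < inverse (real (Suc l)) \<longrightarrow>
     \<bar>ext \<Theta> (upd x k (x $ k + real_of_rat r)) - ext \<Theta> x - real_of_rat r * D\<Theta> k x\<bar> \<le> inverse (real (Suc i)) * \<bar>real_of_rat r\<bar>)"

lemma rational_differentiability_measurable [measurable]:
  "Measurable.pred borel (rational_differentiability k)"
  unfolding rational_differentiability_def[abs_def] by measurable

lemma derivative_imp_rational_differentiability:
  assumes "x \<in> S" "y \<in> I k"
    and "((\<lambda>t. \<Theta> (upd x k t)) has_real_derivative D\<Theta> k (upd x k y)) (at y)"
  shows "rational_differentiability k (upd x k y)"
  unfolding rational_differentiability_def upd_nth upd_upd if_True simp_thms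
proof (intro allI)
  fix i :: nat
  let ?e = "inverse (real (Suc i))" and ?D = "D\<Theta> k (upd x k y)"
  have "((\<lambda>t. ext \<Theta> (upd x k t)) has_real_derivative ?D) (at y)"
    using assms by (simp add: ext_Theta_line_derivative)
  then have "((\<lambda>h. (ext \<Theta> (upd x k (y + h)) - ext \<Theta> (upd x k y)) / h) \<longlongrightarrow> ?D) (at 0)"
    by (simp add: DERIV_def)
  from LIM_D[OF this, of ?e] obtain \<delta> where \<delta>: "\<delta> > 0" "\<And>h. h \<noteq> 0 \<Longrightarrow> \<bar>h\<bar> < \<delta> \<Longrightarrow>
      \<bar>(ext \<Theta> (upd x k (y + h)) - ext \<Theta> (upd x k y)) / h - ?D\<bar> < ?e"
    by auto
  obtain l where l: "inverse (real (Suc l)) < \<delta>" using reals_Archimedean[OF \<delta>(1)] by auto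
  show "\<exists>l. \<forall>r. \<bar>real_of_rat r\<bar> < inverse (real (Suc l)) \<longrightarrow>
     \<bar>ext \<Theta> (upd x k (y + real_of_rat r)) - ext \<Theta> (upd x k y) - real_of_rat r * ?D\<bar> \<le> ?e * \<bar>real_of_rat r\<bar>"
  proof (intro exI[of _ l] allI impI)
    fix r assume r: "\<bar>real_of_rat r\<bar> < inverse (real (Suc l))"
    define h where "h = real_of_rat r"
    show "\<bar>ext \<Theta> (upd x k (y + real_of_rat r)) - ext \<Theta> (upd x k y) - real_of_rat r * ?D\<bar> \<le> ?e * \<bar>real_of_rat r\<bar>"
      unfolding h_def[symmetric]
    proof (cases "h = 0")
      case False
      define A where "A = ext \<Theta> (upd x k (y + h)) - ext \<Theta> (upd x k y)"
      have "A - h * ?D = (A / h - ?D) * h"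
        using False by (simp add: left_diff_distrib)
      then have "\<bar>A - h * ?D\<bar> = \<bar>A / h - ?D\<bar> * \<bar>h\<bar>"
        by (simp add: abs_mult)
      also have "\<dots> \<le> ?e * \<bar>h\<bar>"
        using \<delta>(2)[OF False] r l by (intro mult_right_mono) (auto simp: h_def A_def)
      finally show "\<bar>ext \<Theta> (upd x k (y + h)) - ext \<Theta> (upd x k y) - h * ?D\<bar> \<le> ?e * \<bar>h\<bar>"
        unfolding A_def .
    qed simp
  qed
qed

lemma rational_differentiability_imp_derivative:
  assumes x: "x \<in> S" and c: "continuous_on (I k) (\<lambda>y. \<Theta> (upd x k y))"
    and R: "rational_differentiability k x"
  shows "((\<lambda>t. \<Theta> (upd x k t)) has_real_derivative D\<Theta> k x) (at (x $ k))"
proof -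
  let ?y = "x $ k" and ?D = "D\<Theta> k x"
  define g where "g h = ext \<Theta> (upd x k (?y + h)) - ext \<Theta> x - h * ?D" for h
  have y: "?y \<in> I k" by (rule S_nth[OF x])
  then obtain \<rho> where \<rho>: "\<rho> > 0" "ball ?y \<rho> \<subseteq> I k" using open_I open_contains_ball_eq by blast
  have \<rho>': "?y + h \<in> I k" if "\<bar>h\<bar> < \<rho>" for h
    using \<rho>(2) that by (auto simp: subset_iff dist_real_def)
  have gc: "continuous_on {-\<rho><..<\<rho>} g"
  proof -
    have "continuous_on {-\<rho><..<\<rho>} (\<lambda>h. \<Theta> (upd x k (?y + h)))"
      by (rule continuous_on_compose2[OF c]) (auto intro!: continuous_intros \<rho>' simp: abs_less_iff)
    then have "continuous_on {-\<rho><..<\<rho>} (\<lambda>h. \<Theta> (upd x k (?y + h)) - ext \<Theta> x - h * ?D)"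
      by (intro continuous_intros)
    then show ?thesis
      by (rule continuous_on_eq) (auto simp: g_def ext_eq upd_in_S[OF x \<rho>'] abs_less_iff)
  qed
  have "((\<lambda>t. ext \<Theta> (upd x k t)) has_real_derivative ?D) (at ?y)"
    unfolding DERIV_def
  proof (rule LIM_I)
    fix e :: real assume "e > 0"
    then obtain i where i: "inverse (real (Suc i)) < e" using reals_Archimedean by blast
    obtain l where l: "\<And>r. \<bar>real_of_rat r\<bar> < inverse (real (Suc l)) \<Longrightarrow>
       \<bar>g (real_of_rat r)\<bar> \<le> inverse (real (Suc i)) * \<bar>real_of_rat r\<bar>"
      using R unfolding rational_differentiability_def g_def by blast
    define \<delta> where "\<delta> = min \<rho> (inverse (real (Suc l)))"
    have \<delta>: "\<delta> > 0" using \<rho>(1) by (simp add: \<delta>_def)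
    \<comment> \<open>a violation at a real increment would persist on an open set and so occur at a rational one\<close>
    have key: "\<bar>g h\<bar> \<le> inverse (real (Suc i)) * \<bar>h\<bar>" if h: "\<bar>h\<bar> < \<delta>" for h
    proof (rule ccontr)
      assume n: "\<not> \<bar>g h\<bar> \<le> inverse (real (Suc i)) * \<bar>h\<bar>"
      define U where "U = {u \<in> {-\<delta><..<\<delta>}. \<bar>g u\<bar> - inverse (real (Suc i)) * \<bar>u\<bar> \<in> {0<..}}"
      have "continuous_on {-\<delta><..<\<delta>} (\<lambda>u. \<bar>g u\<bar> - inverse (real (Suc i)) * \<bar>u\<bar>)"
        by (intro continuous_intros continuous_on_subset[OF gc]) (auto simp: \<delta>_def)
      then have "open ({-\<delta><..<\<delta>} \<inter> (\<lambda>u. \<bar>g u\<bar> - inverse (real (Suc i)) * \<bar>u\<bar>) -` {0<..})"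
        by (rule continuous_open_preimage) auto
      also have "{-\<delta><..<\<delta>} \<inter> (\<lambda>u. \<bar>g u\<bar> - inverse (real (Suc i)) * \<bar>u\<bar>) -` {0<..} = U"
        by (auto simp: U_def)
      finally have "open U" .
      moreover have "h \<in> U" using n h by (auto simp: U_def abs_less_iff)
      ultimately obtain a where "a \<in> \<rat>" "a \<in> U" by (rule Icc_nhd_in_open) blast
      then obtain r where "a = real_of_rat r" by (auto elim: Rats_cases)
      moreover have "\<bar>a\<bar> < \<delta>" "\<not> \<bar>g a\<bar> \<le> inverse (real (Suc i)) * \<bar>a\<bar>"
        using \<open>a \<in> U\<close> by (auto simp: U_def)
      ultimately show False using l[of r] by (simp add: \<delta>_def)
    qed
    show "\<exists>s>0. \<forall>h. h \<noteq> 0 \<and> norm (h - 0) < s \<longrightarrow>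
        norm ((ext \<Theta> (upd x k (?y + h)) - ext \<Theta> (upd x k ?y)) / h - ?D) < e"
    proof (intro exI[of _ \<delta>] conjI allI impI \<delta>)
      fix h :: real assume h: "h \<noteq> 0 \<and> norm (h - 0) < \<delta>"
      have "(ext \<Theta> (upd x k (?y + h)) - ext \<Theta> (upd x k ?y)) / h - ?D = g h / h"
        using h by (simp add: g_def diff_divide_distrib)
      moreover have "\<bar>g h / h\<bar> \<le> inverse (real (Suc i))"
        using key[of h] h by (simp add: abs_divide pos_divide_le_eq)
      ultimately show "norm ((ext \<Theta> (upd x k (?y + h)) - ext \<Theta> (upd x k ?y)) / h - ?D) < e"
        using i by simp
    qed
  qed
  then show ?thesis by (simp add: ext_Theta_line_derivative[OF x y])
qed

text \<open>
  Differentiability at almost every point of almost every line does not immediately give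
  differentiability at almost every point, because the set of points of differentiability is not known
  to be measurable.  The Borel property rational_differentiability does transfer, and it implies
  differentiability on every line on which Theta is continuous.
\<close>

lemma AE_partial_Theta_eq: "AE x in N. partial k \<Theta> x = D\<Theta> k x"
proof -
  have "AE x in N. AE y in law k. rational_differentiability k (upd x k y)"
    using AE_Theta_line_derivative[of k]
  proof eventually_elim
    case (elim x)
    from conjunct2[OF conjunct2[OF elim]] AE_law_I[of k] show ?case
      by eventually_elim (use elim derivative_imp_rational_differentiability in blast)
  qed
  then have "AE x in N. rational_differentiability k x"
    by (rule AE_resample_rev[rotated]) measurable
  with AE_Theta_line_derivative[of k] show ?thesis
  proof eventually_elim
    case (elim x)
    then show ?case unfolding partial_def
      by (intro DERIV_imp_deriv rational_differentiability_imp_derivative) auto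
  qed
qed

end

section \<open>Stein kernels and absolute continuity of Theta\<close>

locale centred_statistic = decomposed_statistic N I d F m
  for N :: "(real ^ 'n::finite) measure" and I :: "'n \<Rightarrow> real set" and d :: "'n \<Rightarrow> real \<Rightarrow> real"
    and F :: "real ^ 'n \<Rightarrow> real" and m :: "'n \<Rightarrow> real ^ 'n \<Rightarrow> real" +
  assumes first_moment: "integrable lborel (\<lambda>u. u * d k u)" and mean_zero: "(LBINT u. u * d k u) = 0"
begin

text \<open>
  The product of the Stein kernel and the density.  Unlike the Stein kernel it is continuous on the
  whole line, and it is positive on the interval.
\<close>

definition T :: "'n \<Rightarrow> real \<Rightarrow> real" where "T k y = (LBINT u:{y<..}. u * d k u)"

lemma T_measurable [measurable]: "T k \<in> borel_measurable borel"
proof -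
  have eq: "T k = (\<lambda>y. LBINT u. (if y < u then u * d k u else 0))"
    unfolding T_def set_lebesgue_integral_def
    by (intro ext Bochner_Integration.integral_cong) auto
  show ?thesis unfolding eq by measurable
qed

lemma stein_kernel_eq: "stein_kernel (d k) y = T k y / d k y"
  by (simp add: stein_kernel_def T_def)

lemma set_integrable_moment: "A \<in> sets borel \<Longrightarrow> set_integrable lborel A (\<lambda>u. u * d k u)"
  unfolding set_integrable_def by (intro integrable_mult_indicator first_moment) auto

lemma T_weak_derivative: "weak_derivative_on UNIV (T k) (\<lambda>u. - (u * d k u))"
  unfolding weak_derivative_on_def
proof (intro ballI impI)
  fix a b :: real assume ab: "a \<le> b"
  have "T k b - T k a = - (LBINT u:{a..b}. u * d k u)"
    unfolding T_def LBINT_upper[OF first_moment] LBINT_lower_diff[OF first_moment ab, symmetric] by simp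
  then show "set_integrable lborel {a..b} (\<lambda>u. - (u * d k u)) \<and>
      T k b - T k a = (LBINT u:{a..b}. - (u * d k u))"
    using set_integrable_mult_right[OF set_integrable_moment[of "{a..b}" k], of "-1"]
      set_integral_mult_right[of lborel "{a..b}" "-1" "\<lambda>u. u * d k u"] by simp
qed

lemma T_continuous: "continuous_on UNIV (T k)"
  using weak_derivative_on_continuous[OF open_UNIV connected_UNIV T_weak_derivative] .

lemma integral_pos_on_open:
  fixes f :: "real \<Rightarrow> real"
  assumes i: "integrable lborel f" and nn: "\<And>u. f u \<ge> 0" and U: "open U" "y \<in> U" "\<And>u. u \<in> U \<Longrightarrow> f u > 0"
  shows "(LBINT u. f u) > 0"
proof (rule ccontr)
  assume "\<not> (LBINT u. f u) > 0"
  moreover have "(LBINT u. f u) \<ge> 0" using nn by (intro Bochner_Integration.integral_nonneg) auto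
  ultimately have "(LBINT u. f u) = 0" by simp
  then have "AE u in lborel. f u = 0" using integral_nonneg_eq_0_iff_AE[OF i] nn by auto
  then have out: "AE u in lborel. u \<in> U \<longrightarrow> False" by eventually_elim (use U(3) in force)
  show False by (rule nonempty_open_not_AE_outside[OF U(1,2) out])
qed

lemma T_pos:
  assumes y: "y \<in> I k"
  shows "T k y > 0"
proof -
  obtain a b where ab: "a < y" "y < b" "a \<in> I k" "b \<in> I k"
    by (rule Icc_nhd_in_open[OF open_I y]) blast
  have sub: "{a..b} \<subseteq> I k" by (rule Icc_subset_connected[OF connected_I ab(3,4)])
  show ?thesis
  proof (cases "y \<ge> 0")
    case True
    have "d k u > 0" if "u \<in> {y<..<b}" for u
      using sub ab that by (intro d_pos) auto
    then show ?thesis unfolding T_def set_lebesgue_integral_def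
      by (intro integral_pos_on_open[where U="{y<..<b}" and y="(y+b)/2"])
         (use True ab set_integrable_moment[of "{y<..}" k] d_nonneg in
           \<open>auto simp: set_integrable_def split: split_indicator intro!: mult_pos_pos mult_nonneg_nonneg\<close>)
  next
    case False
    have "T k y = (LBINT u. indicator {..y} u *\<^sub>R (- u * d k u))"
      using mean_zero[of k] unfolding T_def LBINT_upper[OF first_moment]
      by (simp add: set_lebesgue_integral_def)
    moreover have "integrable lborel (\<lambda>u. indicator {..y} u *\<^sub>R (- u * d k u))"
      using set_integrable_moment[of "{..y}" k] by (simp add: set_integrable_def)
    then have "0 < (LBINT u. indicator {..y} u *\<^sub>R (- u * d k u))"
    proof (rule integral_pos_on_open[where U="{a<..<y}" and y="(a+y)/2"])
      show "0 < indicator {..y} u *\<^sub>R (- u * d k u)" if "u \<in> {a<..<y}" for u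
      proof -
        have "d k u > 0" using sub ab that by (intro d_pos) auto
        then show ?thesis using that False by (simp add: mult_neg_pos)
      qed
      show "0 \<le> indicator {..y} u *\<^sub>R (- u * d k u)" for u
        using False d_nonneg[of k u] by (auto split: split_indicator intro: mult_nonpos_nonneg)
    qed (use ab in auto)
    ultimately show ?thesis by simp
  qed
qed

lemma stein_kernel_pos: "y \<in> I k \<Longrightarrow> stein_kernel (d k) y > 0"
  by (simp add: stein_kernel_eq T_pos d_pos)

lemma stein_kernel_measurable [measurable]: "stein_kernel (d k) \<in> borel_measurable borel"
  unfolding stein_kernel_eq[abs_def] by measurable

end

text \<open>
  The energy assumption is what finiteness of the last norm in the theorem provides.
\<close>

locale stein_kernel_setting = centred_statistic N I d F m
  for N :: "(real ^ 'n::finite) measure" and I :: "'n \<Rightarrow> real set" and d :: "'n \<Rightarrow> real \<Rightarrow> real"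
    and F :: "real ^ 'n \<Rightarrow> real" and m :: "'n \<Rightarrow> real ^ 'n \<Rightarrow> real" +
  assumes energy: "(\<integral>\<^sup>+x. ennreal ((D\<Theta> k x)\<^sup>2 * stein_kernel (d k) (x $ k)) \<partial>N) < \<infinity>"
begin

text \<open>
  On compact subintervals T is bounded away from 0, so finite energy makes the derivative locally
  square integrable on almost every line.
\<close>

lemma AE_D\<Theta>_set_integrable:
  "AE x in N. \<forall>a\<in>I k. \<forall>b\<in>I k. set_integrable lborel {a..b} (\<lambda>y. D\<Theta> k (upd x k y))"
proof -
  let ?f = "\<lambda>x. ennreal ((D\<Theta> k x)\<^sup>2 * stein_kernel (d k) (x $ k))"
  have "(\<integral>\<^sup>+x. (\<integral>\<^sup>+y. ?f (upd x k y) \<partial>law k) \<partial>N) < \<infinity>"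
    using energy[of k] resample_law[of ?f k] by simp
  then have "AE x in N. (\<integral>\<^sup>+y. ?f (upd x k y) \<partial>law k) \<noteq> \<infinity>"
    by (intro nn_integral_PInf_AE) auto
  then show ?thesis
  proof eventually_elim
    case (elim x)
    have "(\<integral>\<^sup>+y. ?f (upd x k y) \<partial>law k) = (\<integral>\<^sup>+y. ?f (upd x k y) * ennreal (d k y) \<partial>lborel)"
      by (rule nn_integral_law) measurable
    also have "\<dots> = (\<integral>\<^sup>+y. ennreal (indicator (I k) y * ((D\<Theta> k (upd x k y))\<^sup>2 * T k y)) \<partial>lborel)"
      by (intro nn_integral_cong)
         (auto simp: d_zero stein_kernel_eq d_nonneg ennreal_mult''[symmetric] dest: d_pos split: split_indicator)
    finally have fin: "(\<integral>\<^sup>+y. ennreal (indicator (I k) y * ((D\<Theta> k (upd x k y))\<^sup>2 * T k y)) \<partial>lborel) < \<infinity>"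
      using elim by (simp add: less_top)
    show ?case
    proof (intro ballI)
      fix a b assume ab: "a \<in> I k" "b \<in> I k"
      show "set_integrable lborel {a..b} (\<lambda>y. D\<Theta> k (upd x k y))"
      proof (cases "a \<le> b")
        case True
        have sub: "{a..b} \<subseteq> I k" by (rule Icc_subset_connected[OF connected_I ab])
        obtain y0 where y0: "y0 \<in> {a..b}" "\<And>y. y \<in> {a..b} \<Longrightarrow> T k y0 \<le> T k y"
          using continuous_attains_inf[of "{a..b}" "T k"] continuous_on_subset[OF T_continuous] True by auto
        define c where "c = T k y0"
        have c: "c > 0" "\<And>y. y \<in> {a..b} \<Longrightarrow> c \<le> T k y" using y0 T_pos sub by (auto simp: c_def)
        have "(\<integral>\<^sup>+y. ennreal (norm (indicator {a..b} y *\<^sub>R D\<Theta> k (upd x k y))) \<partial>lborel)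
          \<le> (\<integral>\<^sup>+y. ennreal (indicator {a..b} y) +
               ennreal (1/c) * ennreal (indicator (I k) y * ((D\<Theta> k (upd x k y))\<^sup>2 * T k y)) \<partial>lborel)"
        proof (intro nn_integral_mono)
          fix y
          show "ennreal (norm (indicator {a..b} y *\<^sub>R D\<Theta> k (upd x k y))) \<le> ennreal (indicator {a..b} y) +
               ennreal (1/c) * ennreal (indicator (I k) y * ((D\<Theta> k (upd x k y))\<^sup>2 * T k y))"
          proof (cases "y \<in> {a..b}")
            case True
            define z where "z = D\<Theta> k (upd x k y)"
            have "0 \<le> (\<bar>z\<bar> - 1)\<^sup>2" by simp
            then have "\<bar>z\<bar> \<le> 1 + z\<^sup>2" by (simp add: power2_diff)
            also have "z\<^sup>2 \<le> 1/c * (z\<^sup>2 * T k y)"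
              using c(1) mult_left_mono[OF c(2)[OF True], of "z\<^sup>2"] by (simp add: field_simps)
            finally have "ennreal \<bar>z\<bar> \<le> ennreal (1 + 1/c * (z\<^sup>2 * T k y))" by (rule ennreal_leI) simp
            also have "\<dots> = ennreal 1 + ennreal (1/c) * ennreal (z\<^sup>2 * T k y)"
            proof -
              have nn: "0 \<le> z\<^sup>2 * T k y" using c(1) c(2)[OF True] by simp
              then have "ennreal (1 + 1/c * (z\<^sup>2 * T k y)) = ennreal 1 + ennreal (1/c * (z\<^sup>2 * T k y))"
                using c(1) by (intro ennreal_plus) auto
              also have "ennreal (1/c * (z\<^sup>2 * T k y)) = ennreal (1/c) * ennreal (z\<^sup>2 * T k y)"
                using nn c(1) by (intro ennreal_mult) auto
              finally show ?thesis .
            qed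
            finally show ?thesis using True sub by (auto simp: z_def)
          qed simp
        qed
        also have "\<dots> = (\<integral>\<^sup>+y. ennreal (indicator {a..b} y) \<partial>lborel) + ennreal (1/c) *
            (\<integral>\<^sup>+y. ennreal (indicator (I k) y * ((D\<Theta> k (upd x k y))\<^sup>2 * T k y)) \<partial>lborel)"
          by (subst nn_integral_add) (auto simp: nn_integral_cmult)
        also have "\<dots> < \<infinity>"
          using fin by (auto simp: ennreal_mult_less_top ennreal_indicator emeasure_lborel_Icc_eq)
        finally show ?thesis unfolding set_integrable_def by (simp add: integrable_iff_bounded)
      qed (simp add: set_integrable_def)
    qed
  qed
qed

text \<open>
  Subtracting the locally integrable derivative of the absolutely continuous part leaves an everywhere
  differentiable function whose derivative is locally integrable.
\<close>

lemma AE_Theta_weak_derivative: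
  "AE x in N. x \<in> S \<and> weak_derivative_on (I k) (\<lambda>y. \<Theta> (upd x k y)) (\<lambda>y. D\<Theta> k (upd x k y))"
  using AE_Theta_line_split[of k] AE_D\<Theta>_set_integrable[of k] AE_Theta_line_derivative[of k]
proof eventually_elim
  case (elim x)
  then obtain P P' B b where *: "x \<in> S" "\<And>y. y \<in> I k \<Longrightarrow> \<Theta> (upd x k y) = P y + B y"
    "\<And>y. y \<in> I k \<Longrightarrow> (P has_real_derivative P' y) (at y)" "weak_derivative_on (I k) B b" by blast
  have "AE y in lborel. y \<in> I k \<longrightarrow> P' y = D\<Theta> k (upd x k y) - b y"
    using weak_derivative_on_AE_deriv[OF open_I connected_I *(4)]
  proof eventually_elim
    case (elim y)
    show ?case
    proof
      assume y: "y \<in> I k"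
      have "((\<lambda>t. P t + B t) has_real_derivative P' y + b y) (at y)"
        using elim y by (intro DERIV_add *(3)) auto
      then have "((\<lambda>t. \<Theta> (upd x k t)) has_real_derivative P' y + b y) (at y)"
        by (rule has_field_derivative_transform_within_open[OF _ open_I y]) (simp add: *(2))
      then show "P' y = D\<Theta> k (upd x k y) - b y" using D\<Theta>_eq[OF *(1) y] by simp
    qed
  qed
  then have "weak_derivative_on (I k) P (\<lambda>y. D\<Theta> k (upd x k y) - b y)"
    using elim(2) weak_derivative_onD(1)[OF *(4)]
    by (intro weak_derivative_on_everywhere_diff[OF connected_I *(3)] set_integral_diff) auto
  from weak_derivative_on_add[OF this *(4)]
  have "weak_derivative_on (I k) (\<lambda>y. \<Theta> (upd x k y)) (\<lambda>y. D\<Theta> k (upd x k y))"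
    by (rule weak_derivative_on_cong[OF _ connected_I]) (simp_all add: *(2))
  then show ?case using *(1) by blast
qed

end

section \<open>Integration by parts on boxes\<close>

lemma interval_exhaustion:
  fixes J :: "real set"
  assumes J: "open J" "J \<noteq> {}"
  obtains a b :: "nat \<Rightarrow> real" where "\<And>n. a n \<in> J" "\<And>n. b n \<in> J" "\<And>n. a n \<le> b n"
    "\<And>y. y \<in> J \<Longrightarrow> eventually (\<lambda>n. a n < y \<and> y < b n) sequentially"
proof -
  define r where "r = from_nat_into (\<rat> \<inter> J)"
  have cr: "countable (\<rat> \<inter> J)" using countable_rat by auto
  obtain y where "y \<in> J" using J by auto
  then obtain c where "c \<in> \<rat>" "c \<in> J" by (rule Icc_nhd_in_open[OF J(1)]) 
  then have ne: "\<rat> \<inter> J \<noteq> {}" by auto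
  have r: "r i \<in> J" for i using from_nat_into[OF ne] by (auto simp: r_def)
  define a where "a n = Min (r ` {..n})" for n
  define b where "b n = Max (r ` {..n})" for n
  have "a n \<in> r ` {..n}" "b n \<in> r ` {..n}" for n
    unfolding a_def b_def by (auto intro!: Min_in Max_in)
  moreover have "r ` {..n} \<subseteq> J" for n using r by auto
  ultimately have "a n \<in> J" "b n \<in> J" for n by blast+
  moreover have "a n \<le> b n" for n
    unfolding a_def b_def by (intro order_trans[OF Min_le Max_ge]) auto
  moreover have "eventually (\<lambda>n. a n < y \<and> y < b n) sequentially" if y: "y \<in> J" for y
  proof -
    obtain p q where pq: "p \<in> \<rat>" "q \<in> \<rat>" "p < y" "y < q" "p \<in> J" "q \<in> J"
      by (rule Icc_nhd_in_open[OF J(1) y])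
    obtain i j where ij: "r i = p" "r j = q"
      using from_nat_into_surj[OF cr] pq unfolding r_def by (metis IntI)
    have "a n < y \<and> y < b n" if "n \<ge> max i j" for n
    proof -
      have "a n \<le> r i" "r j \<le> b n" using that unfolding a_def b_def by (auto intro!: Min_le Max_ge)
      then show ?thesis using ij pq by auto
    qed
    then show ?thesis unfolding eventually_sequentially by blast
  qed
  ultimately show ?thesis by (rule that)
qed

context stein_kernel_setting
begin

lemma tail_eq_lower:
  assumes "x \<in> S" and int: "integrable (law k) (\<lambda>z. ext (m k) (upd x k z))"
    and "(LINT z|law k. ext (m k) (upd x k z)) = 0"
  shows "tail k (m k) (upd x k y) = - (LINT z:{..y}|law k. ext (m k) (upd x k z))"
proof -
  have si: "set_integrable (law k) A (\<lambda>z. ext (m k) (upd x k z))" if "A \<in> sets borel" for A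
    unfolding set_integrable_def using that by (intro integrable_mult_indicator int) (auto simp: sets_law)
  have "{..y} \<union> {y<..} = UNIV" by auto
  then have "0 = (LINT z:{..y} \<union> {y<..}|law k. ext (m k) (upd x k z))"
    using assms(3) by (simp add: set_lebesgue_integral_def)
  also have "\<dots> = (LINT z:{..y}|law k. ext (m k) (upd x k z)) + (LINT z:{y<..}|law k. ext (m k) (upd x k z))"
    by (intro set_integral_Un si) auto
  finally show ?thesis by (simp add: tail_def)
qed

lemma abs_set_integral_le_nn:
  fixes f :: "real \<Rightarrow> real"
  assumes "A \<in> sets M" "f \<in> borel_measurable M"
  shows "ennreal \<bar>LINT z:A|M. f z\<bar> \<le> (\<integral>\<^sup>+z. indicator A z * ennreal \<bar>f z\<bar> \<partial>M)"
proof -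
  have "ennreal \<bar>LINT z:A|M. f z\<bar> \<le> (\<integral>\<^sup>+z. ennreal (norm (indicator A z *\<^sub>R f z)) \<partial>M)"
    unfolding set_lebesgue_integral_def
    using integral_norm_bound_ennreal[of M "\<lambda>z. indicator A z *\<^sub>R f z"]
    by (cases "integrable M (\<lambda>z. indicator A z *\<^sub>R f z)") (auto simp: not_integrable_integral_eq)
  also have "\<dots> = (\<integral>\<^sup>+z. indicator A z * ennreal \<bar>f z\<bar> \<partial>M)"
    by (intro nn_integral_cong) (auto split: split_indicator)
  finally show ?thesis .
qed

text \<open>
  The tail integral beyond y is at most the integral of |m_k| beyond y; averaging over the other
  coordinates yields a bound by a quantity that vanishes as y approaches the upper end.
\<close>

lemma boundary_upper:
  "(\<integral>\<^sup>+x. ennreal \<bar>tail k (m k) (upd x k y)\<bar> \<partial>N) \<le> (\<integral>\<^sup>+x. ennreal (indicator {y<..} (x $ k) * \<bar>ext (m k) x\<bar>) \<partial>N)"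
proof -
  have "(\<integral>\<^sup>+x. ennreal \<bar>tail k (m k) (upd x k y)\<bar> \<partial>N)
    \<le> (\<integral>\<^sup>+x. (\<integral>\<^sup>+z. indicator {y<..} z * ennreal \<bar>ext (m k) (upd x k z)\<bar> \<partial>law k) \<partial>N)"
    unfolding tail_def upd_nth upd_upd if_True simp_thms
    by (intro nn_integral_mono abs_set_integral_le_nn) (auto simp: sets_law)
  also have "\<dots> = (\<integral>\<^sup>+x. (\<integral>\<^sup>+z. ennreal (indicator {y<..} (upd x k z $ k) * \<bar>ext (m k) (upd x k z)\<bar>) \<partial>law k) \<partial>N)"
    by (intro nn_integral_cong) (auto split: split_indicator)
  also have "\<dots> = (\<integral>\<^sup>+x. ennreal (indicator {y<..} (x $ k) * \<bar>ext (m k) x\<bar>) \<partial>N)"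
    by (rule resample_law[symmetric]) measurable
  finally show ?thesis .
qed

text \<open>
  Because m_k is centred, the tail integral beyond y is minus the integral up to y, which is small near
  the lower end.
\<close>

lemma boundary_lower:
  "(\<integral>\<^sup>+x. ennreal \<bar>tail k (m k) (upd x k y)\<bar> \<partial>N) \<le> (\<integral>\<^sup>+x. ennreal (indicator {..y} (x $ k) * \<bar>ext (m k) x\<bar>) \<partial>N)"
proof -
  have "(\<integral>\<^sup>+x. ennreal \<bar>tail k (m k) (upd x k y)\<bar> \<partial>N)
    \<le> (\<integral>\<^sup>+x. (\<integral>\<^sup>+z. indicator {..y} z * ennreal \<bar>ext (m k) (upd x k z)\<bar> \<partial>law k) \<partial>N)"
    using AE_L_line_self[of k]
  proof (intro nn_integral_mono_AE, eventually_elim)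
    case (elim x)
    then have "\<bar>tail k (m k) (upd x k y)\<bar> = \<bar>LINT z:{..y}|law k. ext (m k) (upd x k z)\<bar>"
      by (simp add: tail_eq_lower)
    then show ?case by (simp add: abs_set_integral_le_nn sets_law)
  qed
  also have "\<dots> = (\<integral>\<^sup>+x. (\<integral>\<^sup>+z. ennreal (indicator {..y} (upd x k z $ k) * \<bar>ext (m k) (upd x k z)\<bar>) \<partial>law k) \<partial>N)"
    by (intro nn_integral_cong) (auto split: split_indicator)
  also have "\<dots> = (\<integral>\<^sup>+x. ennreal (indicator {..y} (x $ k) * \<bar>ext (m k) x\<bar>) \<partial>N)"
    by (rule resample_law[symmetric]) measurable
  finally show ?thesis .
qed

lemma integrable_tail_slice: "integrable N (\<lambda>x. tail k (m k) (upd x k y))"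
proof -
  have "(\<integral>\<^sup>+x. ennreal \<bar>tail k (m k) (upd x k y)\<bar> \<partial>N) \<le> (\<integral>\<^sup>+x. ennreal (indicator {y<..} (x $ k) * \<bar>ext (m k) x\<bar>) \<partial>N)"
    by (rule boundary_upper)
  also have "\<dots> \<le> (\<integral>\<^sup>+x. ennreal \<bar>ext (m k) x\<bar> \<partial>N)"
    by (intro nn_integral_mono) (auto split: split_indicator)
  also have "\<dots> < \<infinity>" using m_int[of k] by (simp add: integrable_iff_bounded)
  finally show ?thesis by (simp add: integrable_iff_bounded)
qed

text \<open>
  The density in the denominator of L_op cancels against the one in the law of the k-th coordinate, so
  the slab contributes at most its width times E |m_k|.
\<close>

lemma slab_integrable_L:
  "integrable N (\<lambda>x. indicator {a..b} (x $ k) * ext (L k) x)"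
proof -
  have "(\<integral>\<^sup>+x. ennreal \<bar>indicator {a..b} (x $ k) * ext (L k) x\<bar> \<partial>N)
     = (\<integral>\<^sup>+x. (\<integral>\<^sup>+y. ennreal \<bar>indicator {a..b} (upd x k y $ k) * ext (L k) (upd x k y)\<bar> \<partial>law k) \<partial>N)"
    by (rule resample_law) measurable
  also have "\<dots> \<le> (\<integral>\<^sup>+x. (\<integral>\<^sup>+y. indicator {a..b} y * ennreal \<bar>tail k (m k) (upd x k y)\<bar> \<partial>lborel) \<partial>N)"
    using AE_L_line_self[of k]
  proof (intro nn_integral_mono_AE, eventually_elim)
    case (elim x)
    have "(\<integral>\<^sup>+y. ennreal \<bar>indicator {a..b} (upd x k y $ k) * ext (L k) (upd x k y)\<bar> \<partial>law k)
      = (\<integral>\<^sup>+y. ennreal \<bar>indicator {a..b} (upd x k y $ k) * ext (L k) (upd x k y)\<bar> * ennreal (d k y) \<partial>lborel)"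
      by (rule nn_integral_law) measurable
    also have "\<dots> \<le> (\<integral>\<^sup>+y. indicator {a..b} y * ennreal \<bar>tail k (m k) (upd x k y)\<bar> \<partial>lborel)"
    proof (intro nn_integral_mono)
      fix y
      show "ennreal \<bar>indicator {a..b} (upd x k y $ k) * ext (L k) (upd x k y)\<bar> * ennreal (d k y)
        \<le> indicator {a..b} y * ennreal \<bar>tail k (m k) (upd x k y)\<bar>"
      proof (cases "y \<in> I k")
        case True
        then have "d k y > 0" "ext (L k) (upd x k y) = tail k (m k) (upd x k y) / d k y"
          using elim by (auto simp: d_pos ext_eq upd_in_S)
        then show ?thesis
          by (auto simp: abs_mult abs_divide ennreal_mult''[symmetric] split: split_indicator)
      qed (simp add: d_zero)
    qed
    finally show ?case .
  qed
  also have "\<dots> = (\<integral>\<^sup>+y. (\<integral>\<^sup>+x. indicator {a..b} y * ennreal \<bar>tail k (m k) (upd x k y)\<bar> \<partial>N) \<partial>lborel)"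
  proof -
    interpret P: pair_sigma_finite lborel N ..
    show ?thesis by (intro P.Fubini') measurable
  qed
  also have "\<dots> \<le> (\<integral>\<^sup>+y. indicator {a..b} y * (\<integral>\<^sup>+x. ennreal \<bar>ext (m k) x\<bar> \<partial>N) \<partial>lborel)"
  proof (intro nn_integral_mono)
    fix y :: real
    have "(\<integral>\<^sup>+x. ennreal \<bar>tail k (m k) (upd x k y)\<bar> \<partial>N) \<le> (\<integral>\<^sup>+x. ennreal (indicator {y<..} (x $ k) * \<bar>ext (m k) x\<bar>) \<partial>N)"
      by (rule boundary_upper)
    also have "\<dots> \<le> (\<integral>\<^sup>+x. ennreal \<bar>ext (m k) x\<bar> \<partial>N)"
      by (intro nn_integral_mono) (auto split: split_indicator)
    finally show "(\<integral>\<^sup>+x. indicator {a..b} y * ennreal \<bar>tail k (m k) (upd x k y)\<bar> \<partial>N)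
      \<le> indicator {a..b} y * (\<integral>\<^sup>+x. ennreal \<bar>ext (m k) x\<bar> \<partial>N)"
      by (auto simp: nn_integral_cmult split: split_indicator)
  qed
  also have "\<dots> = (\<integral>\<^sup>+x. ennreal \<bar>ext (m k) x\<bar> \<partial>N) * emeasure lborel {a..b}"
    by (simp add: nn_integral_multc mult.commute)
  also have "\<dots> < \<infinity>"
    using m_int[of k] by (auto simp: integrable_iff_bounded ennreal_mult_less_top emeasure_lborel_Icc_eq)
  finally show ?thesis by (simp add: integrable_iff_bounded)
qed

text \<open>
  The test function psi(F) h(Theta) and, below, its derivative in direction k.
\<close>

definition Phi :: "(real \<Rightarrow> real) \<Rightarrow> (real \<Rightarrow> real) \<Rightarrow> real ^ 'n \<Rightarrow> real" where
  "Phi \<psi> h x = \<psi> (ext F x) * h (ext \<Theta> x)"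

definition dPhi :: "(real \<Rightarrow> real) \<Rightarrow> (real \<Rightarrow> real) \<Rightarrow> (real \<Rightarrow> real) \<Rightarrow> (real \<Rightarrow> real) \<Rightarrow> 'n \<Rightarrow> real ^ 'n \<Rightarrow> real" where
  "dPhi \<psi> \<psi>' h h' k x = \<psi>' (ext F x) * ext (partial k F) x * h (ext \<Theta> x) + \<psi> (ext F x) * (h' (ext \<Theta> x) * D\<Theta> k x)"

lemma line_integration_by_parts:
  assumes \<psi>: "\<And>u. (\<psi> has_real_derivative \<psi>' u) (at u)" "continuous_on UNIV \<psi>'"
    and h: "\<And>u. (h has_real_derivative h' u) (at u)" "continuous_on UNIV h'"
    and ab: "a \<in> I k" "b \<in> I k" "a \<le> b"
  shows "AE x in N. (LINT y:{a..b}|law k. Phi \<psi> h (upd x k y) * ext (m k) (upd x k y)) =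
     (LINT y:{a..b}|law k. dPhi \<psi> \<psi>' h h' k (upd x k y) * ext (L k) (upd x k y))
     - Phi \<psi> h (upd x k b) * tail k (m k) (upd x k b) + Phi \<psi> h (upd x k a) * tail k (m k) (upd x k a)"
  using AE_Theta_weak_derivative[of k] AE_L_line_self[of k]
proof eventually_elim
  case (elim x)
  have x: "x \<in> S" using elim by auto
  have cont: "continuous_on UNIV \<psi>" "continuous_on UNIV h"
    using DERIV_isCont[OF \<psi>(1)] DERIV_isCont[OF h(1)] by (auto intro: continuous_at_imp_continuous_on)
  note [measurable] = borel_measurable_continuous_onI[OF cont(1)] borel_measurable_continuous_onI[OF cont(2)]
    borel_measurable_continuous_onI[OF \<psi>(2)] borel_measurable_continuous_onI[OF h(2)]
  have sub: "{a..b} \<subseteq> I k" by (rule Icc_subset_connected[OF connected_I ab(1,2)])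
  have wF: "weak_derivative_on (I k) (\<lambda>y. F (upd x k y)) (\<lambda>y. partial k F (upd x k y))"
    by (intro weak_derivative_on_C1 connected_I C1_line_derivative C2_imp_C1(1)[OF F_C2] x continuous_on_line dF_cont)
  have wG: "weak_derivative_on (I k) (\<lambda>y. tail k (m k) (upd x k y)) (\<lambda>y. - (m k (upd x k y) * d k y))"
    using elim x by (intro weak_derivative_on_C1 connected_I tail_line_derivative m_cont)
      (auto intro!: continuous_intros continuous_on_line m_cont continuous_on_d)
  have "weak_derivative_on (I k)
    (\<lambda>y. (\<psi> (F (upd x k y)) * h (\<Theta> (upd x k y))) * tail k (m k) (upd x k y))
    (\<lambda>y. ((\<psi>' (F (upd x k y)) * partial k F (upd x k y)) * h (\<Theta> (upd x k y)) +
           \<psi> (F (upd x k y)) * (h' (\<Theta> (upd x k y)) * D\<Theta> k (upd x k y))) * tail k (m k) (upd x k y)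
       + (\<psi> (F (upd x k y)) * h (\<Theta> (upd x k y))) * (- (m k (upd x k y) * d k y)))"
    using elim by (intro weak_derivative_on_mult connected_I wG weak_derivative_on_chain[OF _ wF \<psi>]
        weak_derivative_on_chain[OF _ _ h]) auto
  then have w: "weak_derivative_on (I k)
    (\<lambda>y. Phi \<psi> h (upd x k y) * tail k (m k) (upd x k y))
    (\<lambda>y. d k y * (dPhi \<psi> \<psi>' h h' k (upd x k y) * ext (L k) (upd x k y)) -
         d k y * (Phi \<psi> h (upd x k y) * ext (m k) (upd x k y)))"
  proof (rule weak_derivative_on_cong[OF _ connected_I])
    fix y assume y: "y \<in> I k"
    have t: "tail k (m k) (upd x k y) = d k y * ext (L k) (upd x k y)"
      using elim y d_pos[OF y] x by (simp add: ext_eq upd_in_S)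
    show "((\<psi>' (F (upd x k y)) * partial k F (upd x k y)) * h (\<Theta> (upd x k y)) +
           \<psi> (F (upd x k y)) * (h' (\<Theta> (upd x k y)) * D\<Theta> k (upd x k y))) * tail k (m k) (upd x k y)
       + (\<psi> (F (upd x k y)) * h (\<Theta> (upd x k y))) * (- (m k (upd x k y) * d k y)) =
       d k y * (dPhi \<psi> \<psi>' h h' k (upd x k y) * ext (L k) (upd x k y)) -
         d k y * (Phi \<psi> h (upd x k y) * ext (m k) (upd x k y))"
      unfolding t using upd_in_S[OF x y] by (simp add: dPhi_def Phi_def ext_eq algebra_simps)
  qed (use x in \<open>simp add: Phi_def ext_eq upd_in_S\<close>)
  have "set_integrable lborel {a..b} (\<lambda>y. Phi \<psi> h (upd x k y) * ext (m k) (upd x k y) * d k y)"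
  proof (rule borel_integrable_atLeastAtMost')
    have "continuous_on (I k) (\<lambda>y. \<psi> (F (upd x k y)) * h (\<Theta> (upd x k y)) * m k (upd x k y) * d k y)"
      using elim x
      by (intro continuous_intros continuous_on_line m_cont continuous_on_d
          continuous_on_compose2[OF cont(1)] continuous_on_compose2[OF cont(2)] F_cont
          weak_derivative_on_continuous[OF open_I connected_I]) auto
    then have "continuous_on (I k) (\<lambda>y. Phi \<psi> h (upd x k y) * ext (m k) (upd x k y) * d k y)"
      by (rule continuous_on_eq) (simp add: Phi_def ext_eq upd_in_S x)
    then show "continuous_on {a..b} (\<lambda>y. Phi \<psi> h (upd x k y) * ext (m k) (upd x k y) * d k y)"
      using sub by (rule continuous_on_subset)
  qed
  then have i1: "set_integrable lborel {a..b} (\<lambda>y. d k y * (Phi \<psi> h (upd x k y) * ext (m k) (upd x k y)))"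
    by (simp add: mult_ac)
  from set_integral_add(1)[OF weak_derivative_onD(1)[OF w ab] i1]
  have i2: "set_integrable lborel {a..b} (\<lambda>y. d k y * (dPhi \<psi> \<psi>' h h' k (upd x k y) * ext (L k) (upd x k y)))"
    by simp
  have mPhi [measurable]: "Phi \<psi> h \<in> borel_measurable borel" "dPhi \<psi> \<psi>' h h' k \<in> borel_measurable borel"
    unfolding Phi_def[abs_def] dPhi_def[abs_def] by measurable
  have law_eq: "(LINT y:{a..b}|law k. f y) = (LBINT y:{a..b}. d k y * f y)"
    if [measurable]: "f \<in> borel_measurable borel" for f :: "real \<Rightarrow> real"
    unfolding set_lebesgue_integral_def
    by (subst integral_law) (auto intro!: Bochner_Integration.integral_cong)
  have "Phi \<psi> h (upd x k b) * tail k (m k) (upd x k b) - Phi \<psi> h (upd x k a) * tail k (m k) (upd x k a)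
    = (LBINT y:{a..b}. d k y * (dPhi \<psi> \<psi>' h h' k (upd x k y) * ext (L k) (upd x k y))) -
      (LBINT y:{a..b}. d k y * (Phi \<psi> h (upd x k y) * ext (m k) (upd x k y)))"
    using weak_derivative_onD(2)[OF w ab] set_integral_diff(2)[OF i2 i1] by simp
  then show ?case
    by (simp add: law_eq)
qed

end

lemma integrable_bounded_mult:
  fixes f g :: "'x \<Rightarrow> real"
  assumes "integrable M g" "f \<in> borel_measurable M" "\<And>x. \<bar>f x\<bar> \<le> C"
  shows "integrable M (\<lambda>x. f x * g x)"
proof (rule Bochner_Integration.integrable_bound[of M "\<lambda>x. C * g x"])
  show "AE x in M. norm (f x * g x) \<le> norm (C * g x)"
  proof (rule AE_I2)
    fix x
    have "\<bar>f x\<bar> \<le> \<bar>C\<bar>" using assms(3)[of x] by simp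
    then show "norm (f x * g x) \<le> norm (C * g x)" by (simp add: abs_mult mult_right_mono)
  qed
qed (use assms in auto)

locale test_functions =
  fixes \<psi> \<psi>' h h' :: "real \<Rightarrow> real" and A A' B B' :: real
  assumes \<psi>: "(\<psi> has_real_derivative \<psi>' u) (at u)" and \<psi>'_cont: "continuous_on UNIV \<psi>'"
    and h: "(h has_real_derivative h' u) (at u)" and h'_cont: "continuous_on UNIV h'"
    and bounds: "\<bar>\<psi> u\<bar> \<le> A" "\<bar>\<psi>' u\<bar> \<le> A'" "\<bar>h u\<bar> \<le> B" "\<bar>u * h u\<bar> \<le> B'"
begin

lemma test_cont: "continuous_on UNIV \<psi>" "continuous_on UNIV h"
  using DERIV_isCont[OF \<psi>] DERIV_isCont[OF h] by (auto intro: continuous_at_imp_continuous_on)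

lemma test_measurable [measurable]:
  "\<psi> \<in> borel_measurable borel" "h \<in> borel_measurable borel" "\<psi>' \<in> borel_measurable borel" "h' \<in> borel_measurable borel"
  using test_cont \<psi>'_cont h'_cont by (auto intro: borel_measurable_continuous_onI)

lemma bounds_nonneg: "0 \<le> A" "0 \<le> A'" "0 \<le> B" "0 \<le> B'"
  using bounds[of 0] by linarith+

end

locale tested_statistic = stein_kernel_setting N I d F m + test_functions \<psi> \<psi>' h h' A A' B B'
  for N :: "(real ^ 'n::finite) measure" and I :: "'n \<Rightarrow> real set" and d :: "'n \<Rightarrow> real \<Rightarrow> real"
    and F :: "real ^ 'n \<Rightarrow> real" and m :: "'n \<Rightarrow> real ^ 'n \<Rightarrow> real"
    and \<psi> \<psi>' h h' :: "real \<Rightarrow> real" and A A' B B' :: real +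
  assumes cross_int: "integrable N (\<lambda>x. h' (ext \<Theta> x) * (ext (L k) x * D\<Theta> k x))"
begin

abbreviation \<Phi> where "\<Phi> \<equiv> Phi \<psi> h"
abbreviation d\<Phi> where "d\<Phi> \<equiv> dPhi \<psi> \<psi>' h h'"

lemma \<Phi>_measurable [measurable]: "\<Phi> \<in> borel_measurable borel" "d\<Phi> k \<in> borel_measurable borel"
  unfolding Phi_def[abs_def] dPhi_def[abs_def] by measurable

lemma \<Phi>_bound: "\<bar>\<Phi> x\<bar> \<le> A * B"
  unfolding Phi_def abs_mult using bounds bounds_nonneg by (intro mult_mono) auto

lemma \<Phi>_m_int: "integrable N (\<lambda>x. \<Phi> x * ext (m k) x)"
  by (rule integrable_bounded_mult[OF m_int _ \<Phi>_bound]) measurable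

text \<open>
  Inside a compact box the derivative of F is bounded and L_op is integrable, so the one-dimensional
  integration by parts may be integrated over the remaining coordinates.
\<close>

lemma box_integration_by_parts:
  assumes ab: "\<And>j. a j \<in> I j" "\<And>j. b j \<in> I j" "\<And>j. a j \<le> b j"
  defines "Q \<equiv> {x::real^'n. \<forall>j. x $ j \<in> {a j..b j}}"
  shows "integrable N (\<lambda>x. indicator Q x * (d\<Phi> k x * ext (L k) x))" (is ?int)
    and "\<bar>(LINT x|N. indicator Q x * (\<Phi> x * ext (m k) x)) - (LINT x|N. indicator Q x * (d\<Phi> k x * ext (L k) x))\<bar>
      \<le> A * B * (LINT x|N. indicator {b k<..} (x $ k) * \<bar>ext (m k) x\<bar>)
        + A * B * (LINT x|N. indicator {..a k} (x $ k) * \<bar>ext (m k) x\<bar>)" (is ?ineq)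
proof -
  have Q_eq: "Q = cbox (\<chi> j. a j) (\<chi> j. b j)"
    by (auto simp: Q_def mem_box_cart)
  have Qm [measurable]: "Q \<in> sets borel" by (simp add: Q_eq)
  have QS: "Q \<subseteq> S"
    using Icc_subset_connected[OF connected_I ab(1,2)] by (fastforce simp: Q_def box_range_def)
  have "bounded (partial k F ` Q)"
    by (intro compact_imp_bounded compact_continuous_image continuous_on_subset[OF dF_cont QS])
       (simp add: Q_eq)
  then obtain C where C: "\<And>x. x \<in> Q \<Longrightarrow> \<bar>partial k F x\<bar> \<le> C"
    unfolding bounded_iff real_norm_def by blast
  define C' where "C' = max C 0"
  have C': "\<bar>indicator Q x * ext (partial k F) x\<bar> \<le> C'" for x
    using C[of x] QS by (auto simp: C'_def ext_eq subset_iff split: split_indicator)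
  have "integrable N (\<lambda>x. (\<psi>' (ext F x) * (indicator Q x * ext (partial k F) x) * h (ext \<Theta> x)) *
       (indicator {a k..b k} (x $ k) * ext (L k) x))"
  proof (rule integrable_bounded_mult[OF slab_integrable_L])
    fix x show "\<bar>\<psi>' (ext F x) * (indicator Q x * ext (partial k F) x) * h (ext \<Theta> x)\<bar> \<le> A' * C' * B"
      unfolding abs_mult[of "_ * _" "h _"] abs_mult[of "\<psi>' _"]
      using bounds bounds_nonneg C' by (intro mult_mono mult_nonneg_nonneg) (auto simp: C'_def)
  qed measurable
  moreover have "integrable N (\<lambda>x. (indicator Q x * \<psi> (ext F x)) * (h' (ext \<Theta> x) * (ext (L k) x * D\<Theta> k x)))"
  proof (rule integrable_bounded_mult[OF cross_int])
    fix x show "\<bar>indicator Q x * \<psi> (ext F x)\<bar> \<le> A"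
      using bounds[of "ext F x"] bounds_nonneg by (auto split: split_indicator)
  qed measurable
  ultimately have "integrable N (\<lambda>x. (\<psi>' (ext F x) * (indicator Q x * ext (partial k F) x) * h (ext \<Theta> x)) *
       (indicator {a k..b k} (x $ k) * ext (L k) x) +
       (indicator Q x * \<psi> (ext F x)) * (h' (ext \<Theta> x) * (ext (L k) x * D\<Theta> k x)))"
    by (rule Bochner_Integration.integrable_add)
  moreover have "(\<psi>' (ext F x) * (indicator Q x * ext (partial k F) x) * h (ext \<Theta> x)) *
       (indicator {a k..b k} (x $ k) * ext (L k) x) +
       (indicator Q x * \<psi> (ext F x)) * (h' (ext \<Theta> x) * (ext (L k) x * D\<Theta> k x))
     = indicator Q x * (d\<Phi> k x * ext (L k) x)" for x
    by (auto simp: dPhi_def Q_def algebra_simps split: split_indicator)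
  ultimately show int2: ?int by simp
  have int1: "integrable N (\<lambda>x. indicator Q x * (\<Phi> x * ext (m k) x))"
    by (rule integrable_bounded_mult[OF \<Phi>_m_int, of _ 1]) (auto split: split_indicator)
  \<comment> \<open>the box without its constraint on coordinate k, which is constant along the lines\<close>
  define R where "R = {x::real^'n. \<forall>j. j \<noteq> k \<longrightarrow> x $ j \<in> {a j..b j}}"
  have Rm [measurable]: "R \<in> sets borel"
  proof -
    have "Measurable.pred borel (\<lambda>x::real^'n. \<forall>j. j \<noteq> k \<longrightarrow> x $ j \<in> {a j..b j})" by measurable
    then show ?thesis unfolding R_def pred_def by simp
  qed
  have QR: "indicator Q (upd x k y) = indicator R x * (indicator {a k..b k} y :: real)" for x y
    by (auto simp: Q_def R_def split: split_indicator)
  have res: "(LINT x|N. indicator Q x * f x) = (LINT x|N. indicator R x * (LINT y:{a k..b k}|law k. f (upd x k y)))"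
    "integrable N (\<lambda>x. indicator R x * (LINT y:{a k..b k}|law k. f (upd x k y)))"
    if [measurable]: "f \<in> borel_measurable borel" and i: "integrable N (\<lambda>x. indicator Q x * f x)"
    for f :: "real ^ 'n \<Rightarrow> real"
  proof -
    have "(LINT y|law k. indicator Q (upd x k y) * f (upd x k y)) = indicator R x * (LINT y:{a k..b k}|law k. f (upd x k y))" for x
      unfolding QR set_lebesgue_integral_def by (simp add: mult.assoc)
    then show "(LINT x|N. indicator Q x * f x) = (LINT x|N. indicator R x * (LINT y:{a k..b k}|law k. f (upd x k y)))"
      "integrable N (\<lambda>x. indicator R x * (LINT y:{a k..b k}|law k. f (upd x k y)))"
      using integral_resample(2,3)[OF _ i, of k] by simp_all
  qed
  have r1: "(LINT x|N. indicator Q x * (\<Phi> x * ext (m k) x)) =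
       (LINT x|N. indicator R x * (LINT y:{a k..b k}|law k. \<Phi> (upd x k y) * ext (m k) (upd x k y)))"
    and i1: "integrable N (\<lambda>x. indicator R x * (LINT y:{a k..b k}|law k. \<Phi> (upd x k y) * ext (m k) (upd x k y)))"
    by (rule res[of "\<lambda>x. \<Phi> x * ext (m k) x", OF _ int1]; measurable)+
  have r2: "(LINT x|N. indicator Q x * (d\<Phi> k x * ext (L k) x)) =
       (LINT x|N. indicator R x * (LINT y:{a k..b k}|law k. d\<Phi> k (upd x k y) * ext (L k) (upd x k y)))"
    and i2: "integrable N (\<lambda>x. indicator R x * (LINT y:{a k..b k}|law k. d\<Phi> k (upd x k y) * ext (L k) (upd x k y)))"
    by (rule res[of "\<lambda>x. d\<Phi> k x * ext (L k) x", OF _ int2]; measurable)+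
  let ?t = "\<lambda>y x. (indicator R x * \<Phi> (upd x k y)) * tail k (m k) (upd x k y)"
  have bd: "\<bar>indicator R x * \<Phi> (upd x k y)\<bar> \<le> A * B" for x y
    using \<Phi>_bound[of "upd x k y"] bounds_nonneg by (auto split: split_indicator)
  have ti: "integrable N (?t y)" for y
    by (rule integrable_bounded_mult[OF integrable_tail_slice _ bd]) measurable
  have tb: "\<bar>LINT x|N. ?t y x\<bar> \<le> A * B * (LINT x|N. \<bar>tail k (m k) (upd x k y)\<bar>)" for y
  proof -
    have "\<bar>LINT x|N. ?t y x\<bar> \<le> (LINT x|N. A * B * \<bar>tail k (m k) (upd x k y)\<bar>)"
    proof (rule integral_abs_bound_integral[OF ti])
      show "integrable N (\<lambda>x. A * B * \<bar>tail k (m k) (upd x k y)\<bar>)"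
        by (intro integrable_mult_right integrable_abs integrable_tail_slice)
      fix x show "\<bar>?t y x\<bar> \<le> A * B * \<bar>tail k (m k) (upd x k y)\<bar>"
        unfolding abs_mult[of "_ * _" "tail _ _ _"] by (intro mult_right_mono bd) auto
    qed
    then show ?thesis by simp
  qed
  have ib: "integrable N (\<lambda>x. indicator J (x $ k) * \<bar>ext (m k) x\<bar>)" if [measurable]: "J \<in> sets borel" for J
    by (rule integrable_bounded_mult[OF integrable_abs[OF m_int], of _ 1]) (auto split: split_indicator)
  have to_real: "(LINT x|N. \<bar>tail k (m k) (upd x k y)\<bar>) \<le> (LINT x|N. indicator J (x $ k) * \<bar>ext (m k) x\<bar>)"
    if "J \<in> sets borel" and "(\<integral>\<^sup>+x. ennreal \<bar>tail k (m k) (upd x k y)\<bar> \<partial>N) \<le> (\<integral>\<^sup>+x. ennreal (indicator J (x $ k) * \<bar>ext (m k) x\<bar>) \<partial>N)"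
    for y J
  proof -
    have "ennreal (LINT x|N. \<bar>tail k (m k) (upd x k y)\<bar>) = (\<integral>\<^sup>+x. ennreal \<bar>tail k (m k) (upd x k y)\<bar> \<partial>N)"
      by (intro nn_integral_eq_integral[symmetric] integrable_abs integrable_tail_slice) auto
    also note that(2)
    also have "(\<integral>\<^sup>+x. ennreal (indicator J (x $ k) * \<bar>ext (m k) x\<bar>) \<partial>N) = ennreal (LINT x|N. indicator J (x $ k) * \<bar>ext (m k) x\<bar>)"
      by (intro nn_integral_eq_integral ib that(1)) auto
    finally show ?thesis
      by (subst (asm) ennreal_le_iff) (auto intro!: Bochner_Integration.integral_nonneg)
  qed
  have triangle: "\<bar>- u + v\<bar> \<le> \<bar>u\<bar> + \<bar>v\<bar>" for u v :: real by linarith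
  have "(LINT x|N. indicator R x * (LINT y:{a k..b k}|law k. \<Phi> (upd x k y) * ext (m k) (upd x k y)))
     = (LINT x|N. indicator R x * (LINT y:{a k..b k}|law k. d\<Phi> k (upd x k y) * ext (L k) (upd x k y)) - ?t (b k) x + ?t (a k) x)"
  proof (rule integral_cong_AE)
    show "AE x in N. indicator R x * (LINT y:{a k..b k}|law k. \<Phi> (upd x k y) * ext (m k) (upd x k y)) =
      indicator R x * (LINT y:{a k..b k}|law k. d\<Phi> k (upd x k y) * ext (L k) (upd x k y)) - ?t (b k) x + ?t (a k) x"
      using line_integration_by_parts[OF \<psi> \<psi>'_cont h h'_cont ab(1)[of k] ab(2)[of k] ab(3)[of k]]
    proof eventually_elim
      case (elim x)
      show ?case unfolding elim by (simp add: algebra_simps)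
    qed
    show "(\<lambda>x. indicator R x * (LINT y:{a k..b k}|law k. \<Phi> (upd x k y) * ext (m k) (upd x k y))) \<in> borel_measurable N"
      using i1 by (rule borel_measurable_integrable)
    show "(\<lambda>x. indicator R x * (LINT y:{a k..b k}|law k. d\<Phi> k (upd x k y) * ext (L k) (upd x k y)) - ?t (b k) x + ?t (a k) x) \<in> borel_measurable N"
      using i2 ti[of "b k"] ti[of "a k"] by (intro borel_measurable_add borel_measurable_diff borel_measurable_integrable)
  qed
  also have "\<dots> = (LINT x|N. indicator R x * (LINT y:{a k..b k}|law k. d\<Phi> k (upd x k y) * ext (L k) (upd x k y)))
      - (LINT x|N. ?t (b k) x) + (LINT x|N. ?t (a k) x)"
    unfolding Bochner_Integration.integral_add[OF Bochner_Integration.integrable_diff[OF i2 ti] ti]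
      Bochner_Integration.integral_diff[OF i2 ti] ..
  finally have diff: "(LINT x|N. indicator Q x * (\<Phi> x * ext (m k) x)) - (LINT x|N. indicator Q x * (d\<Phi> k x * ext (L k) x))
    = - (LINT x|N. ?t (b k) x) + (LINT x|N. ?t (a k) x)"
    unfolding r1 r2 by simp
  show ?ineq
    unfolding diff
  proof (rule order_trans[OF triangle])
    show "\<bar>LINT x|N. ?t (b k) x\<bar> + \<bar>LINT x|N. ?t (a k) x\<bar>
        \<le> A * B * (LINT x|N. indicator {b k<..} (x $ k) * \<bar>ext (m k) x\<bar>)
        + A * B * (LINT x|N. indicator {..a k} (x $ k) * \<bar>ext (m k) x\<bar>)"
    proof (rule add_mono)
    have AB: "0 \<le> A * B" using bounds_nonneg by simp
    have "A * B * (LINT x|N. \<bar>tail k (m k) (upd x k (b k))\<bar>) \<le> A * B * (LINT x|N. indicator {b k<..} (x $ k) * \<bar>ext (m k) x\<bar>)"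
      by (rule mult_left_mono[OF to_real[OF _ boundary_upper] AB]) simp
    with tb[of "b k"] show "\<bar>LINT x|N. ?t (b k) x\<bar> \<le> A * B * (LINT x|N. indicator {b k<..} (x $ k) * \<bar>ext (m k) x\<bar>)"
      by (rule order_trans)
    have "A * B * (LINT x|N. \<bar>tail k (m k) (upd x k (a k))\<bar>) \<le> A * B * (LINT x|N. indicator {..a k} (x $ k) * \<bar>ext (m k) x\<bar>)"
      by (rule mult_left_mono[OF to_real[OF _ boundary_lower] AB]) simp
    with tb[of "a k"] show "\<bar>LINT x|N. ?t (a k) x\<bar> \<le> A * B * (LINT x|N. indicator {..a k} (x $ k) * \<bar>ext (m k) x\<bar>)"
      by (rule order_trans)
    qed
  qed
qed

lemma cross_sum_int: "integrable N (\<lambda>x. \<psi> (ext F x) * (h' (ext \<Theta> x) * (\<Sum>k\<in>UNIV. ext (L k) x * D\<Theta> k x)))"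
proof -
  have "integrable N (\<lambda>x. \<psi> (ext F x) * (\<Sum>k\<in>UNIV. h' (ext \<Theta> x) * (ext (L k) x * D\<Theta> k x)))"
    by (rule integrable_bounded_mult[OF Bochner_Integration.integrable_sum[OF cross_int] _ bounds(1)]) measurable
  then show ?thesis by (simp add: sum_distrib_left)
qed

lemma diagonal_int: "integrable N (\<lambda>x. \<psi>' (ext F x) * (ext \<Theta> x * h (ext \<Theta> x)))"
  by (rule integrable_bounded_mult[OF N.integrable_const_bound[of _ B'], of _ _ A'])
     (use bounds in auto)

text \<open>
  Summation over k replaces the products of partial derivatives of F and L_op by Theta, and
  Theta h(Theta) is bounded.  Hence both sides converge by dominated convergence as the boxes exhaust
  the range, although single summands need not be integrable over the whole range.
\<close>

lemma global_integration_by_parts: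
  "(LINT x|N. \<Phi> x * (\<Sum>k\<in>UNIV. ext (m k) x)) =
   (LINT x|N. \<psi>' (ext F x) * (ext \<Theta> x * h (ext \<Theta> x))) +
   (LINT x|N. \<psi> (ext F x) * (h' (ext \<Theta> x) * (\<Sum>k\<in>UNIV. ext (L k) x * D\<Theta> k x)))"
proof -
  define f where "f x = (\<Sum>k\<in>UNIV. \<Phi> x * ext (m k) x)" for x
  define g where "g x = (\<Sum>k\<in>UNIV. d\<Phi> k x * ext (L k) x)" for x
  have g_eq: "g x = \<psi>' (ext F x) * (ext \<Theta> x * h (ext \<Theta> x)) +
      \<psi> (ext F x) * (h' (ext \<Theta> x) * (\<Sum>k\<in>UNIV. ext (L k) x * D\<Theta> k x))" for x
    unfolding g_def dPhi_def ext_Theta_eq[of x]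
    by (simp add: sum_distrib_left sum_distrib_right sum.distrib[symmetric] algebra_simps)
  have fi: "integrable N f" unfolding f_def[abs_def] by (intro Bochner_Integration.integrable_sum \<Phi>_m_int)
  have gi: "integrable N g" unfolding g_eq[abs_def] by (intro Bochner_Integration.integrable_add diagonal_int cross_sum_int)
  have "S \<noteq> {}"
  proof
    assume "S = {}"
    then have "AE x in N. x \<notin> S" by (intro AE_I2) simp
    from N.AE_contr[OF AE_S this] show False .
  qed
  then obtain x0 where x0: "x0 \<in> S" by blast
  have "\<forall>k. \<exists>a b :: nat \<Rightarrow> real. (\<forall>n. a n \<in> I k \<and> b n \<in> I k \<and> a n \<le> b n) \<and>
      (\<forall>y\<in>I k. eventually (\<lambda>n. a n < y \<and> y < b n) sequentially)"
  proof
    fix k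
    have "I k \<noteq> {}" using S_nth[OF x0] by auto
    with open_I obtain a b :: "nat \<Rightarrow> real" where "\<And>n. a n \<in> I k" "\<And>n. b n \<in> I k" "\<And>n. a n \<le> b n"
      "\<And>y. y \<in> I k \<Longrightarrow> eventually (\<lambda>n. a n < y \<and> y < b n) sequentially"
      by (rule interval_exhaustion) blast
    then show "\<exists>a b :: nat \<Rightarrow> real. (\<forall>n. a n \<in> I k \<and> b n \<in> I k \<and> a n \<le> b n) \<and>
      (\<forall>y\<in>I k. eventually (\<lambda>n. a n < y \<and> y < b n) sequentially)" by blast
  qed
  from choice[OF this] obtain a :: "'n \<Rightarrow> nat \<Rightarrow> real" where
    "\<forall>k. \<exists>b :: nat \<Rightarrow> real. (\<forall>n. a k n \<in> I k \<and> b n \<in> I k \<and> a k n \<le> b n) \<and>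
      (\<forall>y\<in>I k. eventually (\<lambda>n. a k n < y \<and> y < b n) sequentially)" by blast
  from choice[OF this] obtain b :: "'n \<Rightarrow> nat \<Rightarrow> real" where
    *: "\<forall>k. (\<forall>n. a k n \<in> I k \<and> b k n \<in> I k \<and> a k n \<le> b k n) \<and>
      (\<forall>y\<in>I k. eventually (\<lambda>n. a k n < y \<and> y < b k n) sequentially)" by blast
  have ab: "\<And>k n. a k n \<in> I k" "\<And>k n. b k n \<in> I k" "\<And>k n. a k n \<le> b k n"
    "\<And>k y. y \<in> I k \<Longrightarrow> eventually (\<lambda>n. a k n < y \<and> y < b k n) sequentially"
    using * by blast+
  define Q where "Q n = {x::real^'n. \<forall>j. x $ j \<in> {a j n..b j n}}" for n
  have "Q n = cbox (\<chi> j. a j n) (\<chi> j. b j n)" for n by (auto simp: Q_def mem_box_cart)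
  then have Qm [measurable]: "Q n \<in> sets borel" for n by simp
  have evQ: "eventually (\<lambda>n. x \<in> Q n) sequentially" if "x \<in> S" for x
  proof -
    have "eventually (\<lambda>n. \<forall>k\<in>UNIV. a k n < x $ k \<and> x $ k < b k n) sequentially"
      using ab(4) S_nth[OF that] by (intro eventually_ball_finite) auto
    then show ?thesis by eventually_elim (auto simp: Q_def less_imp_le)
  qed
  have conv: "(\<lambda>n. LINT x|N. indicator (Q n) x * u x) \<longlonglongrightarrow> (LINT x|N. u x)"
    if u: "integrable N u" for u :: "real ^ 'n \<Rightarrow> real"
  proof (rule integral_dominated_convergence[where w="\<lambda>x. \<bar>u x\<bar>"])
    show "integrable N (\<lambda>x. \<bar>u x\<bar>)" using u by (rule integrable_abs)
    show "AE x in N. (\<lambda>n. indicator (Q n) x * u x) \<longlonglongrightarrow> u x"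
      using AE_S
    proof eventually_elim
      case (elim x)
      show ?case by (rule tendsto_eventually, use evQ[OF elim] in eventually_elim) simp
    qed
    show "AE x in N. norm (indicator (Q n) x * u x) \<le> \<bar>u x\<bar>" for n
      by (auto split: split_indicator)
  qed (use u in \<open>auto intro!: borel_measurable_times borel_measurable_integrable\<close>)
  define err where "err n = (\<Sum>k\<in>UNIV. A * B * (LINT x|N. indicator {b k n<..} (x $ k) * \<bar>ext (m k) x\<bar>)
        + A * B * (LINT x|N. indicator {..a k n} (x $ k) * \<bar>ext (m k) x\<bar>))" for n
  have e0: "(\<lambda>n. LINT x|N. indicator (J n) (x $ k) * \<bar>ext (m k) x\<bar>) \<longlonglongrightarrow> (LINT x|N. 0)"
    if [measurable]: "\<And>n. J n \<in> sets borel" and ev: "\<And>y. y \<in> I k \<Longrightarrow> eventually (\<lambda>n. y \<notin> J n) sequentially"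
    for J :: "nat \<Rightarrow> real set" and k
  proof (rule integral_dominated_convergence[where w="\<lambda>x. \<bar>ext (m k) x\<bar>"])
    show "AE x in N. (\<lambda>n. indicator (J n) (x $ k) * \<bar>ext (m k) x\<bar>) \<longlonglongrightarrow> 0"
      using AE_S
    proof eventually_elim
      case (elim x)
      show ?case by (rule tendsto_eventually, use ev[OF S_nth[OF elim]] in eventually_elim) simp
    qed
    show "AE x in N. norm (indicator (J n) (x $ k) * \<bar>ext (m k) x\<bar>) \<le> \<bar>ext (m k) x\<bar>" for n
      by (auto split: split_indicator)
  qed (auto intro!: integrable_abs m_int)
  have "(\<lambda>n. err n) \<longlonglongrightarrow> (\<Sum>k::'n\<in>UNIV. A * B * (LINT x|N. 0) + A * B * (LINT x|N. 0))"
    unfolding err_def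
  proof (intro tendsto_sum tendsto_add tendsto_mult tendsto_const e0)
    fix k and y assume "y \<in> I k"
    from ab(4)[OF this] show "eventually (\<lambda>n. y \<notin> {b k n<..}) sequentially"
      and "eventually (\<lambda>n. y \<notin> {..a k n}) sequentially"
      by (eventually_elim, simp)+
  qed auto
  then have err0: "err \<longlonglongrightarrow> 0" by simp
  have step: "\<bar>(LINT x|N. indicator (Q n) x * f x) - (LINT x|N. indicator (Q n) x * g x)\<bar> \<le> err n" for n
  proof -
    note ibp = box_integration_by_parts[of "\<lambda>j. a j n" "\<lambda>j. b j n", OF ab(1,2,3), folded Q_def]
    have "(LINT x|N. indicator (Q n) x * f x) = (\<Sum>k\<in>UNIV. LINT x|N. indicator (Q n) x * (\<Phi> x * ext (m k) x))"
      unfolding f_def sum_distrib_left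
      by (rule Bochner_Integration.integral_sum)
         (rule integrable_bounded_mult[OF \<Phi>_m_int, of _ 1], auto split: split_indicator)
    moreover have "(LINT x|N. indicator (Q n) x * g x) = (\<Sum>k\<in>UNIV. LINT x|N. indicator (Q n) x * (d\<Phi> k x * ext (L k) x))"
      unfolding g_def sum_distrib_left by (rule Bochner_Integration.integral_sum) (rule ibp(1))
    ultimately have "\<bar>(LINT x|N. indicator (Q n) x * f x) - (LINT x|N. indicator (Q n) x * g x)\<bar>
      = \<bar>\<Sum>k\<in>UNIV. (LINT x|N. indicator (Q n) x * (\<Phi> x * ext (m k) x)) - (LINT x|N. indicator (Q n) x * (d\<Phi> k x * ext (L k) x))\<bar>"
      by (simp add: sum_subtractf)
    also have "\<dots> \<le> err n"
      unfolding err_def by (rule order_trans[OF sum_abs sum_mono]) (rule ibp(2))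
    finally show ?thesis .
  qed
  have "(\<lambda>n. (LINT x|N. indicator (Q n) x * f x) - (LINT x|N. indicator (Q n) x * g x)) \<longlonglongrightarrow> (LINT x|N. f x) - (LINT x|N. g x)"
    by (intro tendsto_diff conv fi gi)
  moreover have "(\<lambda>n. (LINT x|N. indicator (Q n) x * f x) - (LINT x|N. indicator (Q n) x * g x)) \<longlonglongrightarrow> 0"
    by (rule Lim_null_comparison[OF _ err0]) (use step in \<open>auto intro!: always_eventually\<close>)
  ultimately have "(LINT x|N. f x) - (LINT x|N. g x) = 0" by (rule LIMSEQ_unique)
  then show ?thesis
    unfolding f_def g_eq
    by (simp add: sum_distrib_left Bochner_Integration.integral_add[OF diagonal_int cross_sum_int, unfolded sum_distrib_left])
qed

end

section \<open>The score identity\<close>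

context stein_kernel_setting
begin

text \<open>
  The functions h(u) = u / (u^2 + epsilon) approximate 1 / u; they satisfy |u h(u)| \<le> 1 and
  |u^2 h'(u)| \<le> 1 uniformly in epsilon, which provides the majorants for the limit epsilon to 0.
\<close>

lemma score_identity:
  assumes nz: "AE x in N. \<Theta> x \<noteq> 0"
    and K: "\<And>k. integrable N (\<lambda>x. ext (L k) x * D\<Theta> k x / (ext \<Theta> x)\<^sup>2)"
    and R: "integrable N (\<lambda>x. (\<Sum>k\<in>UNIV. ext (m k) x) / ext \<Theta> x)"
    and \<psi>: "\<And>u. (\<psi> has_real_derivative \<psi>' u) (at u)" "continuous_on UNIV \<psi>'"
      "\<And>u. \<bar>\<psi> u\<bar> \<le> A" "\<And>u. \<bar>\<psi>' u\<bar> \<le> A'"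
  shows "(LINT x|N. \<psi>' (ext F x)) = (LINT x|N. \<psi> (ext F x) *
    ((\<Sum>k\<in>UNIV. ext (m k) x) / ext \<Theta> x + (\<Sum>k\<in>UNIV. ext (L k) x * D\<Theta> k x / (ext \<Theta> x)\<^sup>2)))"
proof -
  define \<epsilon> where "\<epsilon> n = inverse (real (Suc n))" for n
  define h where "h n u = u / (u\<^sup>2 + \<epsilon> n)" for n and u :: real
  define h' where "h' n u = (\<epsilon> n - u\<^sup>2) / (u\<^sup>2 + \<epsilon> n)\<^sup>2" for n and u :: real
  have \<epsilon>: "\<epsilon> n > 0" for n by (simp add: \<epsilon>_def)
  have \<epsilon>0: "\<epsilon> \<longlonglongrightarrow> 0" unfolding \<epsilon>_def by (rule LIMSEQ_inverse_real_of_nat)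
  have pos: "u\<^sup>2 + \<epsilon> n > 0" for u :: real and n
    using \<epsilon>[of n] by (simp add: add_nonneg_pos)
  have h_deriv: "(h n has_real_derivative h' n u) (at u)" for n u
    unfolding h_def[abs_def] h'_def using pos[of u n]
    by (auto intro!: derivative_eq_intros simp: power2_eq_square field_simps)
  have h'_cont: "continuous_on UNIV (h' n)" for n
    unfolding h'_def[abs_def] using pos by (intro continuous_intros) (simp add: less_imp_neq[symmetric])
  have uh: "\<bar>u * h n u\<bar> \<le> 1" for n u
    using pos[of u n] \<epsilon>[of n] by (simp add: h_def power2_eq_square abs_mult abs_divide divide_le_eq)
  have h'_bound: "\<bar>h' n u * u\<^sup>2\<bar> \<le> 1" for n u
  proof -
    have "\<bar>\<epsilon> n - u\<^sup>2\<bar> \<le> u\<^sup>2 + \<epsilon> n" using \<epsilon>[of n] by (simp add: abs_le_iff)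
    moreover have "u\<^sup>2 \<le> u\<^sup>2 + \<epsilon> n" using \<epsilon>[of n] by simp
    ultimately have "\<bar>\<epsilon> n - u\<^sup>2\<bar> * u\<^sup>2 \<le> (u\<^sup>2 + \<epsilon> n) * (u\<^sup>2 + \<epsilon> n)"
      by (intro mult_mono) auto
    then show ?thesis using pos[of u n]
      by (simp add: h'_def abs_mult abs_divide power2_eq_square[of "u\<^sup>2 + \<epsilon> n"] divide_le_eq)
  qed
  have h_bound: "\<bar>h n u\<bar> \<le> 1 + 1 / \<epsilon> n" for n u
  proof -
    have "\<bar>u\<bar> \<le> 1 + u\<^sup>2"
    proof -
      have "0 \<le> (\<bar>u\<bar> - 1)\<^sup>2" by simp
      then show ?thesis by (simp add: power2_diff)
    qed
    also have "\<dots> \<le> (1 + 1 / \<epsilon> n) * (u\<^sup>2 + \<epsilon> n)"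
      using \<epsilon>[of n] by (simp add: field_simps)
    finally show ?thesis using pos[of u n] by (simp add: h_def abs_divide divide_le_eq)
  qed
  have [measurable]: "h n \<in> borel_measurable borel" "h' n \<in> borel_measurable borel" for n
    unfolding h_def[abs_def] h'_def[abs_def] by measurable
  have \<psi>c: "continuous_on UNIV \<psi>" using DERIV_isCont[OF \<psi>(1)] by (auto intro: continuous_at_imp_continuous_on)
  note [measurable] = borel_measurable_continuous_onI[OF \<psi>c] borel_measurable_continuous_onI[OF \<psi>(2)]
  have nz': "AE x in N. ext \<Theta> x \<noteq> 0"
    using nz AE_S by eventually_elim (simp add: ext_eq)
  have tested: "tested_statistic N I d F m \<psi> \<psi>' (h n) (h' n) A A' (1 + 1 / \<epsilon> n) 1" for n
  proof unfold_locales
    fix k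
    have "integrable N (\<lambda>x. (h' n (ext \<Theta> x) * (ext \<Theta> x)\<^sup>2) * (ext (L k) x * D\<Theta> k x / (ext \<Theta> x)\<^sup>2))"
      by (rule integrable_bounded_mult[OF K _ h'_bound]) measurable
    then show "integrable N (\<lambda>x. h' n (ext \<Theta> x) * (ext (L k) x * D\<Theta> k x))"
    proof (rule integrable_cong_AE_imp)
      show "AE x in N. (h' n (ext \<Theta> x) * (ext \<Theta> x)\<^sup>2) * (ext (L k) x * D\<Theta> k x / (ext \<Theta> x)\<^sup>2) =
          h' n (ext \<Theta> x) * (ext (L k) x * D\<Theta> k x)"
        using nz' by eventually_elim simp
    qed measurable
  qed (use \<psi> h_deriv h'_cont h_bound uh in auto)
  let ?M = "\<lambda>x. \<Sum>k\<in>UNIV. ext (m k) x"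
  let ?K = "\<lambda>x. \<Sum>k\<in>UNIV. ext (L k) x * D\<Theta> k x / (ext \<Theta> x)\<^sup>2"
  have Ki: "integrable N ?K" by (intro Bochner_Integration.integrable_sum K)
  have lim_uh: "(\<lambda>n. u * h n u) \<longlonglongrightarrow> 1" if "u \<noteq> 0" for u
  proof -
    have "(\<lambda>n. u * (u / (u\<^sup>2 + \<epsilon> n))) \<longlonglongrightarrow> u * (u / (u\<^sup>2 + 0))"
      using that by (intro tendsto_intros \<epsilon>0) auto
    then show ?thesis using that by (simp add: h_def power2_eq_square)
  qed
  have lim_h': "(\<lambda>n. h' n u * u\<^sup>2) \<longlonglongrightarrow> - 1" if "u \<noteq> 0" for u
  proof -
    have "(\<lambda>n. (\<epsilon> n - u\<^sup>2) / (u\<^sup>2 + \<epsilon> n)\<^sup>2 * u\<^sup>2) \<longlonglongrightarrow> (0 - u\<^sup>2) / (u\<^sup>2 + 0)\<^sup>2 * u\<^sup>2"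
      using that by (intro tendsto_intros \<epsilon>0) auto
    then show ?thesis using that by (simp add: h'_def power2_eq_square)
  qed
  have id: "(LINT x|N. \<psi> (ext F x) * h n (ext \<Theta> x) * ?M x) =
    (LINT x|N. \<psi>' (ext F x) * (ext \<Theta> x * h n (ext \<Theta> x))) +
    (LINT x|N. \<psi> (ext F x) * (h' n (ext \<Theta> x) * (\<Sum>k\<in>UNIV. ext (L k) x * D\<Theta> k x)))" for n
    using tested_statistic.global_integration_by_parts[OF tested[of n]] by (simp add: Phi_def)
  have 1: "(\<lambda>n. LINT x|N. \<psi> (ext F x) * h n (ext \<Theta> x) * ?M x) \<longlonglongrightarrow> (LINT x|N. \<psi> (ext F x) * (?M x / ext \<Theta> x))"
  proof (rule integral_dominated_convergence[where w="\<lambda>x. A * \<bar>?M x / ext \<Theta> x\<bar>"])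
    show "integrable N (\<lambda>x. A * \<bar>?M x / ext \<Theta> x\<bar>)" by (intro integrable_mult_right integrable_abs R)
    show "AE x in N. (\<lambda>n. \<psi> (ext F x) * h n (ext \<Theta> x) * ?M x) \<longlonglongrightarrow> \<psi> (ext F x) * (?M x / ext \<Theta> x)"
      using nz'
    proof eventually_elim
      case (elim x)
      have "(\<lambda>n. \<psi> (ext F x) * (?M x / ext \<Theta> x) * (ext \<Theta> x * h n (ext \<Theta> x))) \<longlonglongrightarrow> \<psi> (ext F x) * (?M x / ext \<Theta> x) * 1"
        by (intro tendsto_mult tendsto_const lim_uh elim)
      then show ?case using elim by (simp add: mult_ac)
    qed
    show "AE x in N. norm (\<psi> (ext F x) * h n (ext \<Theta> x) * ?M x) \<le> A * \<bar>?M x / ext \<Theta> x\<bar>" for n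
      using nz'
    proof eventually_elim
      case (elim x)
      have "\<bar>\<psi> (ext F x) * h n (ext \<Theta> x) * ?M x\<bar> = \<bar>\<psi> (ext F x)\<bar> * (\<bar>ext \<Theta> x * h n (ext \<Theta> x)\<bar> * \<bar>?M x / ext \<Theta> x\<bar>)"
        using elim by (simp add: abs_mult abs_divide)
      also have "\<dots> \<le> A * (1 * \<bar>?M x / ext \<Theta> x\<bar>)"
        using \<psi>(3)[of "ext F x"] by (intro mult_mono \<psi>(3) uh) auto
      finally show ?case by simp
    qed
  qed measurable
  have 2: "(\<lambda>n. LINT x|N. \<psi>' (ext F x) * (ext \<Theta> x * h n (ext \<Theta> x))) \<longlonglongrightarrow> (LINT x|N. \<psi>' (ext F x))"
  proof (rule integral_dominated_convergence[where w="\<lambda>x. A'"])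
    show "AE x in N. (\<lambda>n. \<psi>' (ext F x) * (ext \<Theta> x * h n (ext \<Theta> x))) \<longlonglongrightarrow> \<psi>' (ext F x)"
      using nz'
    proof eventually_elim
      case (elim x)
      have "(\<lambda>n. \<psi>' (ext F x) * (ext \<Theta> x * h n (ext \<Theta> x))) \<longlonglongrightarrow> \<psi>' (ext F x) * 1"
        by (intro tendsto_mult tendsto_const lim_uh elim)
      then show ?case by simp
    qed
    show "AE x in N. norm (\<psi>' (ext F x) * (ext \<Theta> x * h n (ext \<Theta> x))) \<le> A'" for n
    proof (rule AE_I2)
      fix x
      have "\<bar>\<psi>' (ext F x)\<bar> * \<bar>ext \<Theta> x * h n (ext \<Theta> x)\<bar> \<le> A' * 1"
        using \<psi>(4)[of "ext F x"] by (intro mult_mono \<psi>(4) uh) auto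
      then show "norm (\<psi>' (ext F x) * (ext \<Theta> x * h n (ext \<Theta> x))) \<le> A'" by (simp add: abs_mult)
    qed
  qed auto
  have 3: "(\<lambda>n. LINT x|N. \<psi> (ext F x) * (h' n (ext \<Theta> x) * (\<Sum>k\<in>UNIV. ext (L k) x * D\<Theta> k x)))
      \<longlonglongrightarrow> (LINT x|N. - (\<psi> (ext F x) * ?K x))"
  proof (rule integral_dominated_convergence[where w="\<lambda>x. A * \<bar>?K x\<bar>"])
    have eq: "\<psi> (ext F x) * (h' n (ext \<Theta> x) * (\<Sum>k\<in>UNIV. ext (L k) x * D\<Theta> k x)) =
      \<psi> (ext F x) * ?K x * (h' n (ext \<Theta> x) * (ext \<Theta> x)\<^sup>2)" if "ext \<Theta> x \<noteq> 0" for x n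
      using that by (simp add: sum_divide_distrib[symmetric])
    show "integrable N (\<lambda>x. A * \<bar>?K x\<bar>)" by (intro integrable_mult_right integrable_abs Ki)
    show "AE x in N. (\<lambda>n. \<psi> (ext F x) * (h' n (ext \<Theta> x) * (\<Sum>k\<in>UNIV. ext (L k) x * D\<Theta> k x))) \<longlonglongrightarrow> - (\<psi> (ext F x) * ?K x)"
      using nz'
    proof eventually_elim
      case (elim x)
      have "(\<lambda>n. \<psi> (ext F x) * ?K x * (h' n (ext \<Theta> x) * (ext \<Theta> x)\<^sup>2)) \<longlonglongrightarrow> \<psi> (ext F x) * ?K x * (-1)"
        by (intro tendsto_mult[OF tendsto_const] lim_h' elim)
      then show ?case unfolding eq[OF elim] by simp
    qed
    show "AE x in N. norm (\<psi> (ext F x) * (h' n (ext \<Theta> x) * (\<Sum>k\<in>UNIV. ext (L k) x * D\<Theta> k x))) \<le> A * \<bar>?K x\<bar>" for n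
      using nz'
    proof eventually_elim
      case (elim x)
      have "\<bar>\<psi> (ext F x) * ?K x * (h' n (ext \<Theta> x) * (ext \<Theta> x)\<^sup>2)\<bar> =
         \<bar>\<psi> (ext F x)\<bar> * \<bar>?K x\<bar> * \<bar>h' n (ext \<Theta> x) * (ext \<Theta> x)\<^sup>2\<bar>"
        unfolding abs_mult ..
      also have "\<dots> \<le> (A * \<bar>?K x\<bar>) * 1"
        using \<psi>(3)[of "ext F x"] by (intro mult_mono h'_bound \<psi>(3)) auto
      finally show ?case unfolding eq[OF elim] by simp
    qed
  qed measurable
  have "(\<lambda>n. LINT x|N. \<psi> (ext F x) * h n (ext \<Theta> x) * ?M x) \<longlonglongrightarrow>
      (LINT x|N. \<psi>' (ext F x)) + (LINT x|N. - (\<psi> (ext F x) * ?K x))"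
    unfolding id by (intro tendsto_add 2 3)
  from LIMSEQ_unique[OF 1 this]
  have "(LINT x|N. \<psi>' (ext F x)) = (LINT x|N. \<psi> (ext F x) * (?M x / ext \<Theta> x)) + (LINT x|N. \<psi> (ext F x) * ?K x)"
    by simp
  also have "\<dots> = (LINT x|N. \<psi> (ext F x) * (?M x / ext \<Theta> x) + \<psi> (ext F x) * ?K x)"
    by (intro Bochner_Integration.integral_add[symmetric] integrable_bounded_mult[OF R _ \<psi>(3)]
        integrable_bounded_mult[OF Ki _ \<psi>(3)]) measurable
  finally show ?thesis by (simp only: distrib_left)
qed

end

section \<open>Densities from a score\<close>

text \<open>
  A random variable Y together with W such that - E[W | Y] is the score of Y in the weak sense.
\<close>

locale score_representation = prob_space M for M :: "'a measure" +
  fixes Y W :: "'a \<Rightarrow> real"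
  assumes Y [measurable]: "Y \<in> borel_measurable M" and W [measurable]: "W \<in> borel_measurable M"
    and W2: "integrable M (\<lambda>\<omega>. (W \<omega>)\<^sup>2)" and Y2: "integrable M (\<lambda>\<omega>. (Y \<omega>)\<^sup>2)"
    and ibp: "\<And>\<psi> \<psi>' A A'. (\<And>u. (\<psi> has_real_derivative \<psi>' u) (at u)) \<Longrightarrow> continuous_on UNIV \<psi>' \<Longrightarrow>
      (\<And>u. \<bar>\<psi> u\<bar> \<le> A) \<Longrightarrow> (\<And>u. \<bar>\<psi>' u\<bar> \<le> A') \<Longrightarrow>
      (LINT \<omega>|M. \<psi>' (Y \<omega>)) = (LINT \<omega>|M. \<psi> (Y \<omega>) * W \<omega>)"
begin

lemma W_int: "integrable M W"
  using square_integrable_imp_integrable[OF W W2] .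

definition g :: "real \<Rightarrow> real" where
  "g y = (LINT \<omega>|M. indicator {y..} (Y \<omega>) * W \<omega>)"

lemma slice_int: "B \<in> sets borel \<Longrightarrow> integrable M (\<lambda>\<omega>. indicator B (Y \<omega>) * W \<omega>)"
  by (rule integrable_bounded_mult[OF W_int, of _ 1]) (auto split: split_indicator)

lemma g_measurable [measurable]: "g \<in> borel_measurable borel"
proof -
  have eq: "g = (\<lambda>y. LINT \<omega>|M. (if y \<le> Y \<omega> then W \<omega> else 0))"
    unfolding g_def by (intro ext Bochner_Integration.integral_cong) auto
  show ?thesis unfolding eq by measurable
qed

definition K :: real where "K = (LINT \<omega>|M. \<bar>W \<omega>\<bar>)"

lemma K_nonneg: "K \<ge> 0"
  by (simp add: K_def)

lemma g_bound: "\<bar>g y\<bar> \<le> K"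
proof -
  have "\<bar>g y\<bar> \<le> (LINT \<omega>|M. \<bar>indicator {y..} (Y \<omega>) * W \<omega>\<bar>)"
    unfolding g_def by (rule integral_abs_bound)
  also have "\<dots> \<le> K"
    unfolding K_def by (intro integral_mono integrable_abs slice_int W_int) (auto split: split_indicator)
  finally show ?thesis .
qed

text \<open>
  The test function is the primitive psi of phi that vanishes at minus infinity: psi(Y) is the integral
  of phi over (-\<infinity>, Y], and Fubini turns E[psi(Y) W] into the integral of phi g.
\<close>

lemma weighted_density:
  assumes c: "continuous_on UNIV \<phi>" and supp: "\<And>u. u \<notin> {p..q} \<Longrightarrow> \<phi> u = 0" and b: "\<And>u. \<bar>\<phi> u\<bar> \<le> A'"
  shows "(LINT \<omega>|M. \<phi> (Y \<omega>)) = (LBINT y. \<phi> y * g y)"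
proof -
  have [measurable]: "\<phi> \<in> borel_measurable borel" using c by (rule borel_measurable_continuous_onI)
  have \<phi>i: "integrable lborel \<phi>"
  proof -
    have "set_integrable lborel {p..q} \<phi>"
      by (intro borel_integrable_atLeastAtMost' continuous_on_subset[OF c]) auto
    moreover have "indicator {p..q} u *\<^sub>R \<phi> u = \<phi> u" for u
      using supp[of u] by (auto split: split_indicator)
    ultimately show ?thesis unfolding set_integrable_def by (simp only:)
  qed
  have \<phi>s: "set_integrable lborel J \<phi>" if "J \<in> sets borel" for J
    using integrable_mult_indicator[OF _ \<phi>i, of J] that by (simp add: set_integrable_def)
  define \<psi> where "\<psi> u = (LBINT t:{..u}. \<phi> t)" for u
  have \<psi>: "(\<psi> has_real_derivative \<phi> u) (at u)" for u
    unfolding \<psi>_def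
    by (rule lower_integral_has_derivative[OF \<phi>i continuous_on_subset[OF c], of "u-1" "u+1"]) auto
  have \<psi>b: "\<bar>\<psi> u\<bar> \<le> (LBINT t. \<bar>\<phi> t\<bar>)" for u
    unfolding \<psi>_def set_lebesgue_integral_def
    by (rule Bochner_Integration.integral_abs_bound_integral)
       (use \<phi>s[of "{..u}"] \<phi>i in \<open>auto simp: set_integrable_def split: split_indicator\<close>)
  interpret P: pair_sigma_finite M lborel ..
  have int: "integrable (M \<Otimes>\<^sub>M lborel) (\<lambda>(\<omega>, t). indicator {..Y \<omega>} t * \<phi> t * W \<omega>)"
  proof (rule P.Fubini_integrable)
    show m: "(\<lambda>(\<omega>, t). indicator {..Y \<omega>} t * \<phi> t * W \<omega>) \<in> borel_measurable (M \<Otimes>\<^sub>M lborel)"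
    proof -
      have eq: "(\<lambda>(\<omega>, t). indicator {..Y \<omega>} t * \<phi> t * W \<omega>) = (\<lambda>(\<omega>, t). (if t \<le> Y \<omega> then \<phi> t * W \<omega> else 0))"
        by (auto simp: fun_eq_iff)
      show ?thesis unfolding eq by measurable
    qed
    have le: "norm (indicator {..Y \<omega>} t * \<phi> t * W \<omega>) \<le> \<bar>\<phi> t\<bar> * \<bar>W \<omega>\<bar>" for \<omega> t
      by (auto simp: abs_mult split: split_indicator)
    have it: "integrable lborel (\<lambda>t. indicator {..Y \<omega>} t * \<phi> t * W \<omega>)" for \<omega>
      using \<phi>s[of "{..Y \<omega>}"] by (intro integrable_mult_left) (simp add: set_integrable_def)
    then show "AE \<omega> in M. integrable lborel (\<lambda>t. case (\<omega>, t) of (\<omega>, t) \<Rightarrow> indicator {..Y \<omega>} t * \<phi> t * W \<omega>)"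
      by simp
    show "integrable M (\<lambda>\<omega>. LBINT t. norm (case (\<omega>, t) of (\<omega>, t) \<Rightarrow> indicator {..Y \<omega>} t * \<phi> t * W \<omega>))"
    proof (rule Bochner_Integration.integrable_bound)
      show "integrable M (\<lambda>\<omega>. (LBINT t. \<bar>\<phi> t\<bar>) * \<bar>W \<omega>\<bar>)" by (intro integrable_mult_right integrable_abs W_int)
      show "(\<lambda>\<omega>. LBINT t. norm (case (\<omega>, t) of (\<omega>, t) \<Rightarrow> indicator {..Y \<omega>} t * \<phi> t * W \<omega>)) \<in> borel_measurable M"
        using m by (intro lborel.borel_measurable_lebesgue_integral) (simp add: case_prod_unfold)
      show "AE \<omega> in M. norm (LBINT t. norm (case (\<omega>, t) of (\<omega>, t) \<Rightarrow> indicator {..Y \<omega>} t * \<phi> t * W \<omega>)) \<le> norm ((LBINT t. \<bar>\<phi> t\<bar>) * \<bar>W \<omega>\<bar>)"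
      proof (rule AE_I2)
        fix \<omega>
        have "(LBINT t. norm (indicator {..Y \<omega>} t * \<phi> t * W \<omega>)) \<le> (LBINT t. \<bar>\<phi> t\<bar> * \<bar>W \<omega>\<bar>)"
          using le it \<phi>i by (intro integral_mono) (auto intro!: integrable_norm)
        then show "norm (LBINT t. norm (case (\<omega>, t) of (\<omega>, t) \<Rightarrow> indicator {..Y \<omega>} t * \<phi> t * W \<omega>)) \<le> norm ((LBINT t. \<bar>\<phi> t\<bar>) * \<bar>W \<omega>\<bar>)"
          by simp
      qed
    qed
  qed
  have "(LINT \<omega>|M. \<phi> (Y \<omega>)) = (LINT \<omega>|M. \<psi> (Y \<omega>) * W \<omega>)"
    by (rule ibp[OF \<psi> c \<psi>b b])
  also have "\<dots> = (LINT \<omega>|M. (LBINT t. indicator {..Y \<omega>} t * \<phi> t * W \<omega>))"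
    unfolding \<psi>_def set_lebesgue_integral_def by simp
  also have "\<dots> = (LBINT t. (LINT \<omega>|M. indicator {..Y \<omega>} t * \<phi> t * W \<omega>))"
    by (rule P.Fubini_integral[symmetric]) (rule int)
  also have "\<dots> = (LBINT y. \<phi> y * g y)"
  proof (rule Bochner_Integration.integral_cong[OF refl])
    fix t
    have "(LINT \<omega>|M. indicator {..Y \<omega>} t * \<phi> t * W \<omega>) = (LINT \<omega>|M. \<phi> t * (indicator {t..} (Y \<omega>) * W \<omega>))"
      by (intro Bochner_Integration.integral_cong) (auto split: split_indicator)
    then show "(LINT \<omega>|M. indicator {..Y \<omega>} t * \<phi> t * W \<omega>) = \<phi> t * g t" by (simp add: g_def)
  qed
  finally show ?thesis .
qed

text \<open>
  Trapezoidal functions decrease to the indicator function of the interval.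
\<close>

lemma prob_Icc:
  assumes "a \<le> b"
  shows "prob {\<omega> \<in> space M. Y \<omega> \<in> {a..b}} = (LBINT y:{a..b}. g y)"
proof -
  \<comment> \<open>the inner maximum is the distance from u to the interval\<close>
  define \<phi> where "\<phi> n u = max 0 (1 - real (Suc n) * max 0 (max (a - u) (u - b)))" for n u
  have \<phi>c: "continuous_on UNIV (\<phi> n)" for n unfolding \<phi>_def[abs_def] by (intro continuous_intros)
  have \<phi>b: "\<bar>\<phi> n u\<bar> \<le> 1" for n u by (simp add: \<phi>_def)
  have \<phi>s: "\<phi> n u = 0" if "u \<notin> {a-1..b+1}" for n u
  proof -
    have "1 \<le> max 0 (max (a - u) (u - b))" using that by auto
    then have "1 * 1 \<le> real (Suc n) * max 0 (max (a - u) (u - b))" by (intro mult_mono) auto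
    then show ?thesis by (simp add: \<phi>_def)
  qed
  have [measurable]: "\<phi> n \<in> borel_measurable borel" for n
    using \<phi>c by (rule borel_measurable_continuous_onI)
  have lim: "(\<lambda>n. \<phi> n u) \<longlonglongrightarrow> indicator {a..b} u" for u
  proof (cases "u \<in> {a..b}")
    case False
    define r where "r = max 0 (max (a - u) (u - b))"
    have "r > 0" using False by (auto simp: r_def)
    then obtain k :: nat where k: "inverse (real (Suc k)) < r" using reals_Archimedean by blast
    have "\<phi> n u = 0" if "n \<ge> k" for n
    proof -
      have "1 \<le> real (Suc k) * r" using k by (simp add: field_simps)
      also have "\<dots> \<le> real (Suc n) * r" using that \<open>r > 0\<close> by (intro mult_right_mono) auto
      finally show ?thesis by (simp add: \<phi>_def r_def)
    qed
    then have "eventually (\<lambda>n. \<phi> n u = indicator {a..b} u) sequentially"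
      unfolding eventually_sequentially using False by auto
    then show ?thesis by (rule tendsto_eventually)
  qed (auto simp: \<phi>_def intro!: tendsto_eventually always_eventually)
  have 1: "(\<lambda>n. LINT \<omega>|M. \<phi> n (Y \<omega>)) \<longlonglongrightarrow> (LINT \<omega>|M. indicator {a..b} (Y \<omega>))"
    by (rule integral_dominated_convergence[where w="\<lambda>_. 1"]) (use lim \<phi>b in auto)
  have 2: "(\<lambda>n. LBINT y. \<phi> n y * g y) \<longlonglongrightarrow> (LBINT y. indicator {a..b} y * g y)"
  proof (rule integral_dominated_convergence[where w="\<lambda>y. indicator {a-1..b+1} y * K"])
    show "integrable lborel (\<lambda>y. indicator {a-1..b+1} y * K)"
      by (intro integrable_mult_left integrable_real_indicator) (auto simp: emeasure_lborel_Icc_eq)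
    show "AE y in lborel. (\<lambda>n. \<phi> n y * g y) \<longlonglongrightarrow> indicator {a..b} y * g y"
      by (intro AE_I2 tendsto_mult lim tendsto_const)
    show "AE y in lborel. norm (\<phi> n y * g y) \<le> indicator {a-1..b+1} y * K" for n
    proof (rule AE_I2)
      fix y
      have "\<bar>\<phi> n y\<bar> * \<bar>g y\<bar> \<le> 1 * K" by (intro mult_mono \<phi>b g_bound) auto
      then show "norm (\<phi> n y * g y) \<le> indicator {a-1..b+1} y * K"
        using \<phi>s[of y n] by (auto simp: abs_mult split: split_indicator)
    qed
  qed measurable
  have eq: "(LINT \<omega>|M. \<phi> n (Y \<omega>)) = (LBINT y. \<phi> n y * g y)" for n
    by (rule weighted_density[OF \<phi>c \<phi>s \<phi>b])
  have "(LINT \<omega>|M. indicator {a..b} (Y \<omega>)) = (LBINT y. indicator {a..b} y * g y)"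
    by (rule LIMSEQ_unique[OF 1 2[folded eq]])
  moreover have "(LINT \<omega>|M. indicator {a..b} (Y \<omega>)) = (LINT \<omega>|M. indicator {\<omega> \<in> space M. Y \<omega> \<in> {a..b}} \<omega> :: real)"
    by (intro Bochner_Integration.integral_cong) (auto split: split_indicator)
  ultimately show ?thesis by (simp add: set_lebesgue_integral_def)
qed

lemma AE_no_atom: "AE \<omega> in M. Y \<omega> \<noteq> c"
proof -
  have "(LBINT y:{c..c}. g y) = 0"
    unfolding set_lebesgue_integral_def
    by (rule integral_eq_zero_AE) (auto intro: eventually_mono[OF AE_lborel_singleton[of c]])
  then have "prob {\<omega> \<in> space M. Y \<omega> \<in> {c..c}} = 0" using prob_Icc[of c c] by simp
  then show ?thesis by (subst (asm) prob_eq_0) (auto elim: eventually_mono)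
qed

lemma g_continuous: "isCont g y"
  unfolding continuous_at_sequentially
proof (intro allI impI)
  fix x :: "nat \<Rightarrow> real" assume x: "x \<longlonglongrightarrow> y"
  show "(g \<circ> x) \<longlonglongrightarrow> g y"
    unfolding g_def o_def
  proof (rule integral_dominated_convergence[where w="\<lambda>\<omega>. \<bar>W \<omega>\<bar>"])
    show "AE \<omega> in M. (\<lambda>n. indicator {x n..} (Y \<omega>) * W \<omega>) \<longlonglongrightarrow> indicator {y..} (Y \<omega>) * W \<omega>"
      using AE_no_atom[of y]
    proof eventually_elim
      case (elim \<omega>)
      have "eventually (\<lambda>n. indicator {x n..} (Y \<omega>) * W \<omega> = indicator {y..} (Y \<omega>) * W \<omega>) sequentially"
      proof (cases "y < Y \<omega>")
        case True
        from order_tendstoD(2)[OF x this] show ?thesis by eventually_elim (use True in auto)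
      next
        case False
        then have "Y \<omega> < y" using elim by auto
        from order_tendstoD(1)[OF x this] show ?thesis by eventually_elim (use \<open>Y \<omega> < y\<close> in auto)
      qed
      then show ?case by (rule tendsto_eventually)
    qed
  qed (auto intro!: integrable_abs W_int split: split_indicator)
qed

lemma g_nonneg: "g y \<ge> 0"
proof (rule ccontr)
  assume "\<not> g y \<ge> 0"
  then have neg: "g y < 0" by simp
  from order_tendstoD(2)[OF g_continuous[of y, unfolded isCont_def], of "g y / 2"] neg
  have "eventually (\<lambda>u. g u < g y / 2) (at y)" by simp
  then obtain \<delta> where \<delta>: "\<delta> > 0" "\<And>u. u \<noteq> y \<Longrightarrow> dist u y < \<delta> \<Longrightarrow> g u < g y / 2"
    unfolding eventually_at by auto
  have "0 \<le> prob {\<omega> \<in> space M. Y \<omega> \<in> {y..y+\<delta>/2}}" by simp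
  also have "\<dots> = (LBINT u:{y..y+\<delta>/2}. g u)" using \<delta> by (intro prob_Icc) auto
  also have "\<dots> \<le> (LBINT u:{y..y+\<delta>/2}. g y / 2)"
  proof (rule set_integral_mono)
    have "isCont g u" for u by (rule g_continuous)
    then show "set_integrable lborel {y..y+\<delta>/2} g"
      by (intro borel_integrable_atLeastAtMost' continuous_at_imp_continuous_on) auto
    show "set_integrable lborel {y..y+\<delta>/2} (\<lambda>u. g y / 2)"
      by (intro borel_integrable_atLeastAtMost' continuous_on_const)
    show "g u \<le> g y / 2" if "u \<in> {y..y+\<delta>/2}" for u
      using \<delta>(2)[of u] \<delta>(1) neg that by (cases "u = y") (auto simp: dist_real_def)
  qed
  also have "\<dots> = g y / 2 * (\<delta> / 2)"
    using \<delta> by (simp add: set_lebesgue_integral_def)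
  also have "\<dots> < 0" using neg \<delta> by (simp add: mult_neg_pos)
  finally show False by simp
qed

lemma distr_eq_density: "distr M lborel Y = density lborel (\<lambda>y. ennreal (g y))"
proof (rule measure_eqI_lessThan)
  have Icc: "emeasure (distr M lborel Y) {x..x + real n} = emeasure (density lborel (\<lambda>y. ennreal (g y))) {x..x + real n}"
    for x :: real and n :: nat
  proof -
    have si: "set_integrable lborel {x..x + real n} g"
      by (intro borel_integrable_atLeastAtMost' continuous_at_imp_continuous_on) (auto intro: g_continuous)
    have "emeasure (distr M lborel Y) {x..x + real n} = ennreal (prob {\<omega> \<in> space M. Y \<omega> \<in> {x..x + real n}})"
      by (subst emeasure_distr) (auto simp: emeasure_eq_measure intro!: arg_cong[where f="measure M"])
    also have "\<dots> = ennreal (LBINT y:{x..x + real n}. g y)" by (subst prob_Icc) auto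
    also have "\<dots> = (\<integral>\<^sup>+y. ennreal (indicator {x..x + real n} y *\<^sub>R g y) \<partial>lborel)"
      using si g_nonneg unfolding set_lebesgue_integral_def set_integrable_def
      by (intro nn_integral_eq_integral[symmetric]) auto
    also have "\<dots> = emeasure (density lborel (\<lambda>y. ennreal (g y))) {x..x + real n}"
      by (subst emeasure_density) (auto intro!: nn_integral_cong split: split_indicator)
    finally show ?thesis .
  qed
  have Ici: "emeasure \<mu> {x<..} = (SUP n. emeasure \<mu> {x..x + real n})"
    if s: "sets \<mu> = sets borel" and z: "emeasure \<mu> {x} = 0" for \<mu> and x :: real
  proof -
    have "(SUP n. emeasure \<mu> {x..x + real n}) = emeasure \<mu> (\<Union>n. {x..x + real n})"
      by (rule SUP_emeasure_incseq) (auto simp: s incseq_def)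
    also have "(\<Union>n. {x..x + real n}) = {x} \<union> {x<..}"
    proof -
      have "\<exists>n. y \<le> x + real n" for y using real_arch_simple[of "y - x"] by (auto simp: algebra_simps)
      then show ?thesis by auto
    qed
    also have "emeasure \<mu> \<dots> = emeasure \<mu> {x} + emeasure \<mu> {x<..}"
      by (rule plus_emeasure[symmetric]) (auto simp: s)
    finally show ?thesis using z by simp
  qed
  fix x :: real
  have "emeasure (distr M lborel Y) {x} = emeasure (density lborel (\<lambda>y. ennreal (g y))) {x}"
    using Icc[of x 0] by simp
  moreover have "emeasure (density lborel (\<lambda>y. ennreal (g y))) {x} = 0"
  proof -
    have "{x} \<in> null_sets lborel" by (rule finite_imp_null_set_lborel) simp
    then show ?thesis
      using absolutely_continuousI_density[of "\<lambda>y. ennreal (g y)" lborel]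
      by (auto simp: absolutely_continuous_def dest!: subsetD)
  qed
  ultimately show "emeasure (distr M lborel Y) {x<..} = emeasure (density lborel (\<lambda>y. ennreal (g y))) {x<..}"
    by (subst (1 2) Ici) (auto simp: Icc)
  show "emeasure (distr M lborel Y) {x<..} < \<infinity>"
    by (subst emeasure_distr) (auto simp: emeasure_eq_measure)
qed auto

lemma distributed_g: "distributed M lborel Y (\<lambda>y. ennreal (g y))"
  unfolding distributed_def using distr_eq_density by simp

lemma g_diff:
  assumes "a \<le> b"
  shows "g b - g a = - (LINT \<omega>|M. indicator {a..<b} (Y \<omega>) * W \<omega>)"
proof -
  have "g a = (LINT \<omega>|M. indicator {a..<b} (Y \<omega>) * W \<omega> + indicator {b..} (Y \<omega>) * W \<omega>)"
    unfolding g_def using assms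
    by (intro Bochner_Integration.integral_cong) (auto split: split_indicator)
  also have "\<dots> = (LINT \<omega>|M. indicator {a..<b} (Y \<omega>) * W \<omega>) + g b"
    unfolding g_def by (intro Bochner_Integration.integral_add slice_int) auto
  finally show ?thesis by simp
qed

lemma prob_le_lebesgue:
  assumes B [measurable]: "B \<in> sets borel" and "emeasure lborel B \<le> ennreal c" "c \<ge> 0"
  shows "(LINT \<omega>|M. indicator B (Y \<omega>)) \<le> K * c"
proof -
  have "ennreal (LINT \<omega>|M. indicator B (Y \<omega>)) = (\<integral>\<^sup>+\<omega>. indicator B (Y \<omega>) \<partial>M)"
    by (subst nn_integral_eq_integral[symmetric])
       (auto intro!: integrable_const_bound[of _ 1] nn_integral_cong split: split_indicator)
  also have "\<dots> = emeasure (distr M lborel Y) B"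
    by (subst nn_integral_indicator[symmetric], simp, subst nn_integral_distr) auto
  also have "\<dots> = (\<integral>\<^sup>+y. ennreal (g y) * indicator B y \<partial>lborel)"
    unfolding distr_eq_density by (subst emeasure_density) auto
  also have "\<dots> \<le> (\<integral>\<^sup>+y. ennreal K * indicator B y \<partial>lborel)"
    using g_bound by (intro nn_integral_mono mult_right_mono ennreal_leI) (auto simp: abs_le_iff)
  also have "\<dots> = ennreal K * emeasure lborel B" by (subst nn_integral_cmult) auto
  also have "\<dots> \<le> ennreal K * ennreal c" by (intro mult_left_mono assms) auto
  also have "\<dots> = ennreal (K * c)" using K_nonneg assms(3) by (simp add: ennreal_mult)
  finally show ?thesis using K_nonneg assms(3) by (subst (asm) ennreal_le_iff) auto
qed

text \<open>
  The increments over disjoint intervals add up to at most E[|W|; Y in U] for their union U.  This is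
  at most l E[W^2] / 2 + P(Y in U) / (2 l), and P(Y in U) is at most a constant times the length of U
  because g is bounded.  The number l is chosen first, then the length.
\<close>

lemma g_absolutely_continuous: "absolutely_continuous_fun g"
  unfolding absolutely_continuous_fun_def
proof (intro allI impI)
  fix e :: real assume e: "e > 0"
  define V where "V = (LINT \<omega>|M. (W \<omega>)\<^sup>2)"
  have V: "V \<ge> 0" by (simp add: V_def)
  define l where "l = e / (2 * (V + 1))"
  have l: "l > 0" using e V by (simp add: l_def)
  define \<delta> where "\<delta> = e * l / (K + 1)"
  have \<delta>: "\<delta> > 0" using e l K_nonneg by (simp add: \<delta>_def)
  show "\<exists>\<delta>>0. \<forall>(N::nat) a b. (\<forall>i<N. a i \<le> b i) \<and> disjoint_family_on (\<lambda>i. {a i<..<b i}) {..<N} \<and>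
        (\<Sum>i<N. b i - a i) < \<delta> \<longrightarrow> (\<Sum>i<N. \<bar>g (b i) - g (a i)\<bar>) < e"
  proof (intro exI[of _ \<delta>] conjI \<delta> allI impI)
    fix N :: nat and a b :: "nat \<Rightarrow> real"
    assume H: "(\<forall>i<N. a i \<le> b i) \<and> disjoint_family_on (\<lambda>i. {a i<..<b i}) {..<N} \<and> (\<Sum>i<N. b i - a i) < \<delta>"
    define U where "U = (\<Union>i<N. {a i<..<b i})"
    have [measurable]: "U \<in> sets borel" by (auto simp: U_def)
    have len: "(\<Sum>i<N. b i - a i) \<ge> 0" using H by (intro sum_nonneg) auto
    have "emeasure lborel U = (\<Sum>i<N. emeasure lborel {a i<..<b i})"
      unfolding U_def using H by (intro sum_emeasure[symmetric]) auto
    also have "\<dots> = (\<Sum>i<N. ennreal (b i - a i))" using H by (intro sum.cong) auto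
    also have "\<dots> = ennreal (\<Sum>i<N. b i - a i)" using H by (intro sum_ennreal) auto
    finally have pU: "(LINT \<omega>|M. indicator U (Y \<omega>)) \<le> K * (\<Sum>i<N. b i - a i)"
      using len by (intro prob_le_lebesgue) auto
    have ind_int: "integrable M (\<lambda>\<omega>. indicator U (Y \<omega>) :: real)"
      by (rule integrable_const_bound[of _ 1]) (auto split: split_indicator)
    have "(\<Sum>i<N. \<bar>g (b i) - g (a i)\<bar>) \<le> (\<Sum>i<N. LINT \<omega>|M. indicator {a i<..<b i} (Y \<omega>) * \<bar>W \<omega>\<bar>)"
    proof (rule sum_mono)
      fix i assume "i \<in> {..<N}"
      then have "\<bar>g (b i) - g (a i)\<bar> = \<bar>LINT \<omega>|M. indicator {a i..<b i} (Y \<omega>) * W \<omega>\<bar>"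
        using H by (subst g_diff) auto
      also have "\<dots> \<le> (LINT \<omega>|M. \<bar>indicator {a i..<b i} (Y \<omega>) * W \<omega>\<bar>)" by (rule integral_abs_bound)
      also have "\<dots> = (LINT \<omega>|M. indicator {a i<..<b i} (Y \<omega>) * \<bar>W \<omega>\<bar>)"
        by (rule Bochner_Integration.integral_cong_AE, measurable)
           (use AE_no_atom[of "a i"] in \<open>eventually_elim, auto simp: abs_mult split: split_indicator\<close>)
      finally show "\<bar>g (b i) - g (a i)\<bar> \<le> (LINT \<omega>|M. indicator {a i<..<b i} (Y \<omega>) * \<bar>W \<omega>\<bar>)" .
    qed
    also have "\<dots> = (LINT \<omega>|M. (\<Sum>i<N. indicator {a i<..<b i} (Y \<omega>) * \<bar>W \<omega>\<bar>))"
      by (rule Bochner_Integration.integral_sum[symmetric])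
         (rule integrable_bounded_mult[OF integrable_abs[OF W_int], of _ 1], auto split: split_indicator)
    also have "\<dots> = (LINT \<omega>|M. indicator U (Y \<omega>) * \<bar>W \<omega>\<bar>)"
    proof (rule Bochner_Integration.integral_cong[OF refl])
      fix \<omega>
      have "(\<Sum>i<N. indicator {a i<..<b i} (Y \<omega>)) = (indicator U (Y \<omega>) :: real)"
        unfolding U_def using H by (intro indicator_UN_disjoint[symmetric]) auto
      then show "(\<Sum>i<N. indicator {a i<..<b i} (Y \<omega>) * \<bar>W \<omega>\<bar>) = indicator U (Y \<omega>) * \<bar>W \<omega>\<bar>"
        by (simp flip: sum_distrib_right)
    qed
    also have "\<dots> \<le> (LINT \<omega>|M. l / 2 * (W \<omega>)\<^sup>2 + 1 / (2 * l) * indicator U (Y \<omega>))"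
    proof (rule integral_mono)
      show "integrable M (\<lambda>\<omega>. indicator U (Y \<omega>) * \<bar>W \<omega>\<bar>)"
        by (rule integrable_bounded_mult[OF integrable_abs[OF W_int], of _ 1]) (auto split: split_indicator)
      show "integrable M (\<lambda>\<omega>. l / 2 * (W \<omega>)\<^sup>2 + 1 / (2 * l) * indicator U (Y \<omega>))"
        by (intro Bochner_Integration.integrable_add integrable_mult_right W2 ind_int)
      fix \<omega>
      have "0 \<le> (l * \<bar>W \<omega>\<bar> - 1)\<^sup>2" by simp
      then have "2 * l * \<bar>W \<omega>\<bar> \<le> l\<^sup>2 * (W \<omega>)\<^sup>2 + 1" by (simp add: power2_diff power_mult_distrib)
      then have "\<bar>W \<omega>\<bar> \<le> l / 2 * (W \<omega>)\<^sup>2 + 1 / (2 * l)"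
        using l by (simp add: field_simps power2_eq_square)
      then show "indicator U (Y \<omega>) * \<bar>W \<omega>\<bar> \<le> l / 2 * (W \<omega>)\<^sup>2 + 1 / (2 * l) * indicator U (Y \<omega>)"
        using l by (auto split: split_indicator)
    qed
    also have "\<dots> = l / 2 * V + 1 / (2 * l) * (LINT \<omega>|M. indicator U (Y \<omega>))"
      by (subst Bochner_Integration.integral_add) (auto simp: V_def intro!: W2 ind_int integrable_mult_right)
    also have "\<dots> \<le> l / 2 * V + 1 / (2 * l) * (K * \<delta>)"
    proof -
      have "K * (\<Sum>i<N. b i - a i) \<le> K * \<delta>" using H K_nonneg by (intro mult_left_mono) auto
      then have "(LINT \<omega>|M. indicator U (Y \<omega>)) \<le> K * \<delta>" using pU by simp
      then show ?thesis using l by (intro add_left_mono mult_left_mono) auto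
    qed
    also have "\<dots> < e"
    proof -
      have "l / 2 * V \<le> e / 4"
        using e V by (simp add: l_def field_simps)
      moreover have "1 / (2 * l) * (K * \<delta>) \<le> e / 2"
        using e l K_nonneg by (simp add: \<delta>_def field_simps)
      ultimately show ?thesis using e by linarith
    qed
    finally show "(\<Sum>i<N. \<bar>g (b i) - g (a i)\<bar>) < e" .
  qed
qed

text \<open>
  The measure B \<mapsto> E[V; Y in B] is absolutely continuous with respect to the law of Y, hence with
  respect to Lebesgue measure; f is its Radon-Nikodym density.
\<close>

lemma transfer_to_density:
  assumes V: "integrable M V" "\<And>\<omega>. V \<omega> \<ge> 0"
  obtains f where "integrable lborel f"
    "\<And>u C. u \<in> borel_measurable borel \<Longrightarrow> (\<And>y. \<bar>u y\<bar> \<le> C) \<Longrightarrow>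
      (LINT \<omega>|M. u (Y \<omega>) * V \<omega>) = (LBINT y. u y * (f y :: real))"
proof -
  have [measurable]: "V \<in> borel_measurable M" using V(1) by auto
  define \<nu> where "\<nu> = distr (density M (\<lambda>\<omega>. ennreal (V \<omega>))) lborel Y"
  have [measurable]: "Y \<in> measurable (density M (\<lambda>\<omega>. ennreal (V \<omega>))) lborel" by simp
  have em: "emeasure \<nu> B = (\<integral>\<^sup>+\<omega>. ennreal (V \<omega>) * indicator B (Y \<omega>) \<partial>M)" if [measurable]: "B \<in> sets borel" for B
  proof -
    have "emeasure \<nu> B = emeasure (density M (\<lambda>\<omega>. ennreal (V \<omega>))) (Y -` B \<inter> space M)"
      unfolding \<nu>_def by (subst emeasure_distr) auto
    also have "\<dots> = (\<integral>\<^sup>+\<omega>. ennreal (V \<omega>) * indicator (Y -` B \<inter> space M) \<omega> \<partial>M)"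
      by (rule emeasure_density) auto
    also have "\<dots> = (\<integral>\<^sup>+\<omega>. ennreal (V \<omega>) * indicator B (Y \<omega>) \<partial>M)"
      by (intro nn_integral_cong) (auto split: split_indicator)
    finally show ?thesis .
  qed
  have sets\<nu>: "sets \<nu> = sets lborel" by (simp add: \<nu>_def)
  have fin: "finite_measure \<nu>"
  proof
    have "emeasure \<nu> UNIV = (\<integral>\<^sup>+\<omega>. ennreal (V \<omega>) \<partial>M)" by (subst em) auto
    then show "emeasure \<nu> (space \<nu>) \<noteq> \<infinity>"
      using V by (simp add: \<nu>_def nn_integral_eq_integral)
  qed
  have ac: "absolutely_continuous lborel \<nu>"
    unfolding absolutely_continuous_def
  proof
    fix B :: "real set" assume B: "B \<in> null_sets lborel"
    then have Bm [measurable]: "B \<in> sets borel" by auto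
    have "emeasure (distr M lborel Y) B = 0"
      unfolding distr_eq_density using B absolutely_continuousI_density[of "\<lambda>y. ennreal (g y)" lborel]
      by (auto simp: absolutely_continuous_def dest!: subsetD)
    then have "emeasure M (Y -` B \<inter> space M) = 0" by (subst (asm) emeasure_distr) auto
    then have "AE \<omega> in M. \<omega> \<notin> Y -` B \<inter> space M" by (intro AE_not_in null_setsI) auto
    then have "AE \<omega> in M. ennreal (V \<omega>) * indicator B (Y \<omega>) = 0"
      using AE_space by eventually_elim (auto split: split_indicator)
    then have "emeasure \<nu> B = 0" by (subst em) (auto simp: nn_integral_0_iff_AE)
    then show "B \<in> null_sets \<nu>" using Bm sets\<nu> by (intro null_setsI) auto
  qed
  obtain D where D [measurable]: "D \<in> borel_measurable lborel"
    and RN: "AE x in lborel. RN_deriv lborel \<nu> x = ennreal (D x)" and Dp: "\<And>x. 0 \<le> D x"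
    using sigma_finite_measure.real_RN_deriv[OF sigma_finite_lborel fin ac sets\<nu>] by metis
  have "density lborel (RN_deriv lborel \<nu>) = \<nu>" by (rule sigma_finite_measure.density_RN_deriv[OF sigma_finite_lborel ac sets\<nu>])
  moreover have "density lborel (RN_deriv lborel \<nu>) = density lborel (\<lambda>x. ennreal (D x))"
    by (rule density_cong) (use RN in auto)
  ultimately have dens: "\<nu> = density lborel (\<lambda>x. ennreal (D x))" by simp
  show ?thesis
  proof (rule that[of D])
    have "(\<integral>\<^sup>+x. ennreal (D x) \<partial>lborel) = emeasure \<nu> UNIV" unfolding dens by (subst emeasure_density) auto
    also have "\<dots> < \<infinity>" using finite_measure.emeasure_finite[OF fin, of UNIV] by (simp add: less_top)
    finally show "integrable lborel D" using Dp by (simp add: integrable_iff_bounded)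
    fix u :: "real \<Rightarrow> real" and C assume [measurable]: "u \<in> borel_measurable borel" and u: "\<And>y. \<bar>u y\<bar> \<le> C"
    have "(LINT \<omega>|M. u (Y \<omega>) * V \<omega>) = (LINT \<omega>|density M (\<lambda>\<omega>. ennreal (V \<omega>)). u (Y \<omega>))"
      using V(2) by (subst integral_real_density) (auto simp: mult.commute)
    also have "\<dots> = (LINT y|\<nu>. u y)" unfolding \<nu>_def by (subst integral_distr) auto
    also have "\<dots> = (LBINT y. D y * u y)" unfolding dens using Dp by (subst integral_real_density) auto
    finally show "(LINT \<omega>|M. u (Y \<omega>) * V \<omega>) = (LBINT y. u y * D y)" by (simp add: mult.commute)
  qed
qed

lemma density_derivative:
  obtains f where "integrable lborel f"
    "\<And>u C. u \<in> borel_measurable borel \<Longrightarrow> (\<And>y. \<bar>u y\<bar> \<le> C) \<Longrightarrow>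
      (LINT \<omega>|M. u (Y \<omega>) * W \<omega>) = (LBINT y. u y * f y)"
    "AE y in lborel. deriv g y = - f y"
proof -
  obtain f1 where f1: "integrable lborel f1"
    "\<And>u C. u \<in> borel_measurable borel \<Longrightarrow> (\<And>y. \<bar>u y\<bar> \<le> C) \<Longrightarrow>
      (LINT \<omega>|M. u (Y \<omega>) * max 0 (W \<omega>)) = (LBINT y. u y * (f1 y :: real))"
    by (rule transfer_to_density[of "\<lambda>\<omega>. max 0 (W \<omega>)"])
       (use W_int in \<open>auto intro!: integrable_max\<close>)
  obtain f2 where f2: "integrable lborel f2"
    "\<And>u C. u \<in> borel_measurable borel \<Longrightarrow> (\<And>y. \<bar>u y\<bar> \<le> C) \<Longrightarrow>
      (LINT \<omega>|M. u (Y \<omega>) * max 0 (- W \<omega>)) = (LBINT y. u y * (f2 y :: real))"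
    by (rule transfer_to_density[of "\<lambda>\<omega>. max 0 (- W \<omega>)"])
       (use W_int in \<open>auto intro!: integrable_max\<close>)
  define f where "f y = f1 y - f2 y" for y
  have fi: "integrable lborel f" unfolding f_def[abs_def] using f1(1) f2(1) by auto
  have f: "(LINT \<omega>|M. u (Y \<omega>) * W \<omega>) = (LBINT y. u y * f y)"
    if [measurable]: "u \<in> borel_measurable borel" and b: "\<And>y. \<bar>u y\<bar> \<le> C" for u C
  proof -
    have i: "integrable M (\<lambda>\<omega>. u (Y \<omega>) * max 0 (W \<omega>))" "integrable M (\<lambda>\<omega>. u (Y \<omega>) * max 0 (- W \<omega>))"
      using b W_int by (auto intro!: integrable_bounded_mult integrable_max)
    have j: "integrable lborel (\<lambda>y. u y * f1 y)" "integrable lborel (\<lambda>y. u y * f2 y)"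
      using b f1(1) f2(1) by (auto intro!: integrable_bounded_mult)
    have "(LINT \<omega>|M. u (Y \<omega>) * W \<omega>) = (LINT \<omega>|M. u (Y \<omega>) * max 0 (W \<omega>) - u (Y \<omega>) * max 0 (- W \<omega>))"
      by (intro Bochner_Integration.integral_cong) (auto simp: max_def)
    also have "\<dots> = (LBINT y. u y * f1 y) - (LBINT y. u y * f2 y)"
      using i by (subst Bochner_Integration.integral_diff) (auto simp: f1(2)[OF that] f2(2)[OF that])
    also have "\<dots> = (LBINT y. u y * f1 y - u y * f2 y)"
      using j by (subst Bochner_Integration.integral_diff) auto
    finally show ?thesis by (simp add: f_def right_diff_distrib)
  qed
  have gG: "g y = (LBINT t. f t) - (LBINT t:{..y}. f t)" for y
  proof -
    have "g y = (LBINT t. indicator {y..} t * f t)"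
      unfolding g_def by (rule f[of _ 1]) (auto split: split_indicator)
    also have "\<dots> = (LBINT t:{y<..}. f t)"
      unfolding set_lebesgue_integral_def
      by (rule Bochner_Integration.integral_cong_AE)
         (use fi in \<open>auto intro!: eventually_mono[OF AE_lborel_singleton[of y]] split: split_indicator\<close>)
    also have "\<dots> = (LBINT t. f t) - (LBINT t:{..y}. f t)" by (rule LBINT_upper[OF fi])
    finally show ?thesis .
  qed
  have "AE y in lborel. deriv g y = - f y"
    using lebesgue_differentiation[OF fi]
  proof eventually_elim
    case (elim y)
    then have "((\<lambda>y. (LBINT t. f t) - (LBINT t:{..y}. f t)) has_real_derivative 0 - f y) (at y)"
      by (intro DERIV_diff DERIV_const)
    then show ?case unfolding gG[symmetric] by (simp add: DERIV_imp_deriv)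
  qed
  with fi f show ?thesis by (rule that)
qed

text \<open>
  With v the score plus the identity, E[u(Y) v(Y)] = E[u(Y) (Y - W)] for bounded u.  Taking for u the
  truncations w of v gives E[w(Y)^2] \<le> E[w(Y)^2] / 2 + E[(Y - W)^2] / 2, and the truncations increase to
  v in absolute value.
\<close>

theorem fisher_distance_le: "fisher_distance M Y g \<le> ennreal (LINT \<omega>|M. (Y \<omega> - W \<omega>)\<^sup>2)"
proof -
  obtain f where fi: "integrable lborel f"
    and f: "\<And>u C. u \<in> borel_measurable borel \<Longrightarrow> (\<And>y. \<bar>u y\<bar> \<le> C) \<Longrightarrow>
      (LINT \<omega>|M. u (Y \<omega>) * W \<omega>) = (LBINT y. u y * f y)"
    and df: "AE y in lborel. deriv g y = - f y"
    by (rule density_derivative) blast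
  have [measurable]: "f \<in> borel_measurable borel" using fi by (simp add: integrable_iff_bounded)
  have Yi: "integrable M Y" using square_integrable_imp_integrable[OF Y Y2] .
  have YWi: "integrable M (\<lambda>\<omega>. (Y \<omega> - W \<omega>)\<^sup>2)"
  proof (rule Bochner_Integration.integrable_bound)
    show "integrable M (\<lambda>\<omega>. 2 * (Y \<omega>)\<^sup>2 + 2 * (W \<omega>)\<^sup>2)"
      by (intro Bochner_Integration.integrable_add integrable_mult_right Y2 W2)
    have "(Y \<omega> - W \<omega>)\<^sup>2 \<le> 2 * (Y \<omega>)\<^sup>2 + 2 * (W \<omega>)\<^sup>2" for \<omega>
      using zero_le_power2[of "Y \<omega> + W \<omega>"] by (simp add: power2_sum power2_diff)
    then show "AE \<omega> in M. norm ((Y \<omega> - W \<omega>)\<^sup>2) \<le> norm (2 * (Y \<omega>)\<^sup>2 + 2 * (W \<omega>)\<^sup>2)" by simp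
  qed measurable
  define v where "v y = (if g y > 0 then y - f y / g y else 0)" for y
  have [measurable]: "v \<in> borel_measurable borel" unfolding v_def[abs_def] by measurable
  define w where "w n y = (if \<bar>v y\<bar> \<le> real n then v y else 0)" for n y
  have [measurable]: "w n \<in> borel_measurable borel" for n unfolding w_def[abs_def] by measurable
  have wb: "\<bar>w n y\<bar> \<le> real n" for n y by (simp add: w_def)
  have w0: "w n y = 0" if "\<not> g y > 0" for n y using that by (simp add: w_def v_def)
  have bound: "(LINT \<omega>|M. (w n (Y \<omega>))\<^sup>2) \<le> (LINT \<omega>|M. (Y \<omega> - W \<omega>)\<^sup>2)" for n
  proof -
    have wY: "integrable M (\<lambda>\<omega>. w n (Y \<omega>) * Y \<omega>)" and wW: "integrable M (\<lambda>\<omega>. w n (Y \<omega>) * W \<omega>)"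
      by (auto intro!: integrable_bounded_mult[OF _ _ wb] Yi W_int)
    have w2: "integrable M (\<lambda>\<omega>. (w n (Y \<omega>))\<^sup>2)"
      unfolding power2_eq_square
      by (rule integrable_bounded_mult[OF integrable_const_bound[of _ "real n"] _ wb]) (use wb in auto)
    have wf: "integrable lborel (\<lambda>y. w n y * f y)" by (rule integrable_bounded_mult[OF fi _ wb]) auto
    have "(LINT \<omega>|M. w n (Y \<omega>) * Y \<omega>) = (LBINT y. g y * (w n y * y))"
      by (rule distributed_integral[OF distributed_g, symmetric]) (auto simp: g_nonneg)
    moreover have "integrable lborel (\<lambda>y. g y * (w n y * y))"
      using wY by (subst distributed_integrable[OF distributed_g]) (auto simp: g_nonneg)
    moreover have "(LINT \<omega>|M. w n (Y \<omega>) * W \<omega>) = (LBINT y. w n y * f y)"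
      by (rule f[OF _ wb]) measurable
    moreover have "(LINT \<omega>|M. (w n (Y \<omega>))\<^sup>2) = (LBINT y. g y * (w n y)\<^sup>2)"
      by (rule distributed_integral[OF distributed_g, symmetric]) (auto simp: g_nonneg)
    moreover have "g y * (w n y)\<^sup>2 = g y * (w n y * y) - w n y * f y" for y
    proof (cases "g y > 0")
      case True
      then show ?thesis by (auto simp: w_def v_def power2_eq_square field_simps)
    qed (simp add: w0)
    ultimately have "(LINT \<omega>|M. (w n (Y \<omega>))\<^sup>2) = (LINT \<omega>|M. w n (Y \<omega>) * Y \<omega>) - (LINT \<omega>|M. w n (Y \<omega>) * W \<omega>)"
      using wf by simp
    also have "\<dots> = (LINT \<omega>|M. w n (Y \<omega>) * Y \<omega> - w n (Y \<omega>) * W \<omega>)"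
      using wY wW by simp
    also have "\<dots> \<le> (LINT \<omega>|M. (w n (Y \<omega>))\<^sup>2 / 2 + (Y \<omega> - W \<omega>)\<^sup>2 / 2)"
    proof (rule integral_mono)
      show "integrable M (\<lambda>\<omega>. w n (Y \<omega>) * Y \<omega> - w n (Y \<omega>) * W \<omega>)" using wY wW by simp
      show "integrable M (\<lambda>\<omega>. (w n (Y \<omega>))\<^sup>2 / 2 + (Y \<omega> - W \<omega>)\<^sup>2 / 2)" using w2 YWi by simp
      fix \<omega>
      show "w n (Y \<omega>) * Y \<omega> - w n (Y \<omega>) * W \<omega> \<le> (w n (Y \<omega>))\<^sup>2 / 2 + (Y \<omega> - W \<omega>)\<^sup>2 / 2"
        using zero_le_power2[of "w n (Y \<omega>) - (Y \<omega> - W \<omega>)"]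
        unfolding power2_diff[of "w n (Y \<omega>)" "Y \<omega> - W \<omega>"] by (simp add: algebra_simps)
    qed
    also have "\<dots> = (LINT \<omega>|M. (w n (Y \<omega>))\<^sup>2) / 2 + (LINT \<omega>|M. (Y \<omega> - W \<omega>)\<^sup>2) / 2"
      using w2 YWi by simp
    finally show ?thesis by simp
  qed
  have "AE \<omega> in M. deriv g (Y \<omega>) = - f (Y \<omega>) \<and> g (Y \<omega>) > 0"
  proof -
    have "AE y in density lborel (\<lambda>y. ennreal (g y)). deriv g y = - f y \<and> g y > 0"
      using df by (subst AE_density) (auto elim: eventually_mono)
    then show ?thesis
      unfolding distr_eq_density[symmetric] by (rule AE_distrD[rotated]) simp
  qed
  then have sc: "AE \<omega> in M. score g (Y \<omega>) + Y \<omega> = v (Y \<omega>)"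
    by eventually_elim (simp add: score_def v_def)
  have "fisher_distance M Y g = (\<integral>\<^sup>+\<omega>. ennreal ((v (Y \<omega>))\<^sup>2) \<partial>M)"
    unfolding fisher_distance_def by (rule nn_integral_cong_AE) (use sc in \<open>eventually_elim, simp\<close>)
  also have "\<dots> = (\<integral>\<^sup>+\<omega>. (SUP n. ennreal ((w n (Y \<omega>))\<^sup>2)) \<partial>M)"
  proof (rule nn_integral_cong)
    fix \<omega>
    obtain n where n: "\<bar>v (Y \<omega>)\<bar> \<le> real n" using real_arch_simple by blast
    show "ennreal ((v (Y \<omega>))\<^sup>2) = (SUP n. ennreal ((w n (Y \<omega>))\<^sup>2))"
    proof (rule antisym)
      show "ennreal ((v (Y \<omega>))\<^sup>2) \<le> (SUP n. ennreal ((w n (Y \<omega>))\<^sup>2))"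
        by (rule SUP_upper2[of n]) (use n in \<open>auto simp: w_def\<close>)
      show "(SUP n. ennreal ((w n (Y \<omega>))\<^sup>2)) \<le> ennreal ((v (Y \<omega>))\<^sup>2)"
        by (rule SUP_least) (auto simp: w_def)
    qed
  qed
  also have "\<dots> = (SUP n. \<integral>\<^sup>+\<omega>. ennreal ((w n (Y \<omega>))\<^sup>2) \<partial>M)"
    by (rule nn_integral_monotone_convergence_SUP) (auto simp: incseq_def le_fun_def w_def)
  also have "\<dots> \<le> ennreal (LINT \<omega>|M. (Y \<omega> - W \<omega>)\<^sup>2)"
  proof (rule SUP_least)
    fix n
    have "(\<integral>\<^sup>+\<omega>. ennreal ((w n (Y \<omega>))\<^sup>2) \<partial>M) = ennreal (LINT \<omega>|M. (w n (Y \<omega>))\<^sup>2)"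
    proof (rule nn_integral_eq_integral)
      show "integrable M (\<lambda>\<omega>. (w n (Y \<omega>))\<^sup>2)"
        unfolding power2_eq_square
        by (rule integrable_bounded_mult[OF integrable_const_bound[of _ "real n"] _ wb]) (use wb in auto)
    qed auto
    also have "\<dots> \<le> ennreal (LINT \<omega>|M. (Y \<omega> - W \<omega>)\<^sup>2)" by (intro ennreal_leI bound)
    finally show "(\<integral>\<^sup>+\<omega>. ennreal ((w n (Y \<omega>))\<^sup>2) \<partial>M) \<le> ennreal (LINT \<omega>|M. (Y \<omega> - W \<omega>)\<^sup>2)" .
  qed
  finally show ?thesis .
qed

theorem has_ac_density_g: "has_ac_density M Y g"
  unfolding has_ac_density_def using g_nonneg g_absolutely_continuous distributed_g by blast

end

section \<open>The Hoelder inequality with three weights\<close>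

text \<open>
  Jensen's inequality for the logarithm, read off from ln u \<le> u - 1 at the three numbers divided by their
  weighted mean.
\<close>

lemma weighted_AM_GM3:
  fixes x y z \<alpha> \<beta> \<gamma> :: real
  assumes "0 \<le> \<alpha>" "0 \<le> \<beta>" "0 \<le> \<gamma>" "\<alpha> + \<beta> + \<gamma> = 1" and nn: "0 \<le> x" "0 \<le> y" "0 \<le> z"
  shows "x powr \<alpha> * y powr \<beta> * z powr \<gamma> \<le> \<alpha> * x + \<beta> * y + \<gamma> * z"
proof (cases "x = 0 \<or> y = 0 \<or> z = 0")
  case True
  then have zero: "x powr \<alpha> * y powr \<beta> * z powr \<gamma> = 0" by auto
  show ?thesis unfolding zero using assms by (intro add_nonneg_nonneg mult_nonneg_nonneg)
next
  case False
  then have pos: "x > 0" "y > 0" "z > 0" using nn by auto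
  define s where "s = \<alpha> * x + \<beta> * y + \<gamma> * z"
  have s: "s > 0"
  proof -
    have "0 < min x (min y z)" using pos by auto
    also have "\<dots> = (\<alpha> + \<beta> + \<gamma>) * min x (min y z)" using assms(4) by simp
    also have "\<dots> = \<alpha> * min x (min y z) + \<beta> * min x (min y z) + \<gamma> * min x (min y z)"
      by (simp add: distrib_right)
    also have "\<dots> \<le> s" unfolding s_def using assms by (intro add_mono mult_left_mono) auto
    finally show ?thesis .
  qed
  have l: "ln u \<le> ln s + (u / s - 1)" if "u > 0" for u
    using ln_le_minus_one[of "u / s"] s that by (simp add: ln_div)
  have "\<alpha> * ln x + \<beta> * ln y + \<gamma> * ln z
    \<le> \<alpha> * (ln s + (x / s - 1)) + \<beta> * (ln s + (y / s - 1)) + \<gamma> * (ln s + (z / s - 1))"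
    using assms pos by (intro add_mono mult_left_mono l)
  also have "\<dots> = (\<alpha> + \<beta> + \<gamma>) * (ln s - 1) + (\<alpha> * (x / s) + \<beta> * (y / s) + \<gamma> * (z / s))"
    by (simp add: algebra_simps)
  also have "\<alpha> * (x / s) + \<beta> * (y / s) + \<gamma> * (z / s) = s / s"
    unfolding times_divide_eq_right add_divide_distrib[symmetric] s_def[symmetric] ..
  also have "(\<alpha> + \<beta> + \<gamma>) * (ln s - 1) + s / s = ln s" using s assms(4) by simp
  finally have "\<alpha> * ln x + \<beta> * ln y + \<gamma> * ln z \<le> ln s" .
  then have "exp (\<alpha> * ln x + \<beta> * ln y + \<gamma> * ln z) \<le> s" using s by (subst ln_ge_iff[symmetric]) auto
  then show ?thesis using pos by (simp add: powr_def exp_add s_def)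
qed

text \<open>
  A weight may be 0, so that on a probability space the version with two factors is the case C = 1.
\<close>

lemma Hoelder3:
  fixes A B C :: "'x \<Rightarrow> real"
  assumes w: "0 \<le> \<alpha>" "0 \<le> \<beta>" "0 \<le> \<gamma>" "\<alpha> + \<beta> + \<gamma> = 1"
    and int: "integrable M A" "integrable M B" "integrable M C"
    and nn: "\<And>x. 0 \<le> A x" "\<And>x. 0 \<le> B x" "\<And>x. 0 \<le> C x"
  shows "integrable M (\<lambda>x. A x powr \<alpha> * B x powr \<beta> * C x powr \<gamma>)"
    and "(LINT x|M. A x powr \<alpha> * B x powr \<beta> * C x powr \<gamma>)
      \<le> (LINT x|M. A x) powr \<alpha> * (LINT x|M. B x) powr \<beta> * (LINT x|M. C x) powr \<gamma>"
proof -
  have [measurable]: "A \<in> borel_measurable M" "B \<in> borel_measurable M" "C \<in> borel_measurable M"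
    using int by auto
  let ?P = "\<lambda>x. A x powr \<alpha> * B x powr \<beta> * C x powr \<gamma>"
  have ge: "0 \<le> (LINT x|M. A x)" "0 \<le> (LINT x|M. B x)" "0 \<le> (LINT x|M. C x)"
    using nn by (auto intro!: Bochner_Integration.integral_nonneg)
  show "integrable M ?P"
  proof (rule Bochner_Integration.integrable_bound)
    show "integrable M (\<lambda>x. \<alpha> * A x + \<beta> * B x + \<gamma> * C x)" using int by auto
    show "AE x in M. norm (?P x) \<le> norm (\<alpha> * A x + \<beta> * B x + \<gamma> * C x)"
      using weighted_AM_GM3[OF w nn(1) nn(2) nn(3)] w nn by (intro AE_I2) auto
  qed measurable
  show "(LINT x|M. ?P x) \<le> (LINT x|M. A x) powr \<alpha> * (LINT x|M. B x) powr \<beta> * (LINT x|M. C x) powr \<gamma>"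
  proof (cases "(LINT x|M. A x) = 0 \<or> (LINT x|M. B x) = 0 \<or> (LINT x|M. C x) = 0")
    case True
    then have "(AE x in M. A x = 0) \<or> (AE x in M. B x = 0) \<or> (AE x in M. C x = 0)"
      using int nn by (auto simp: integral_nonneg_eq_0_iff_AE)
    then have "AE x in M. ?P x = 0" by (auto elim: eventually_mono)
    then have "(LINT x|M. ?P x) = 0" by (rule integral_eq_zero_AE)
    then show ?thesis by simp
  next
    case False
    define a b c where "a = (LINT x|M. A x)" and "b = (LINT x|M. B x)" and "c = (LINT x|M. C x)"
    have pos: "a > 0" "b > 0" "c > 0" using False ge by (auto simp: a_def b_def c_def)
    define k where "k = a powr \<alpha> * b powr \<beta> * c powr \<gamma>"
    have k: "k > 0" using pos by (simp add: k_def)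
    have "(LINT x|M. ?P x) \<le> (LINT x|M. k * (\<alpha> * (A x / a) + \<beta> * (B x / b) + \<gamma> * (C x / c)))"
    proof (rule integral_mono)
      show "integrable M ?P" by fact
      show "integrable M (\<lambda>x. k * (\<alpha> * (A x / a) + \<beta> * (B x / b) + \<gamma> * (C x / c)))" using int by auto
      fix x
      have "?P x = k * ((A x / a) powr \<alpha> * (B x / b) powr \<beta> * (C x / c) powr \<gamma>)"
        using pos nn by (simp add: k_def powr_divide)
      also have "\<dots> \<le> k * (\<alpha> * (A x / a) + \<beta> * (B x / b) + \<gamma> * (C x / c))"
        using k pos nn by (intro mult_left_mono weighted_AM_GM3 w) auto
      finally show "?P x \<le> k * (\<alpha> * (A x / a) + \<beta> * (B x / b) + \<gamma> * (C x / c))" .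
    qed
    also have "\<dots> = k * (\<alpha> * (a / a) + \<beta> * (b / b) + \<gamma> * (c / c))"
      using int by (simp add: a_def b_def c_def)
    also have "\<dots> = k" using pos w(4) by simp
    finally show ?thesis by (simp add: k_def a_def b_def c_def)
  qed
qed

lemma power2_eq_powr: "(x::real)\<^sup>2 = (\<bar>x\<bar> powr (2 * p)) powr (1 / p)" if "p > 0"
  using that by (cases "x = 0") (auto simp: powr_powr powr_numeral)

lemma Lp_norm_power2: "(Lp_norm M (2 * p) U)\<^sup>2 = (LINT \<omega>|M. \<bar>U \<omega>\<bar> powr (2 * p)) powr (1 / p)" if "p > 0"
proof -
  have "(0::real) \<le> (LINT \<omega>|M. \<bar>U \<omega>\<bar> powr (2 * p))" by (rule Bochner_Integration.integral_nonneg) auto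
  then show ?thesis unfolding Lp_norm_def
    using that by (cases "(LINT \<omega>|M. \<bar>U \<omega>\<bar> powr (2 * p)) = 0")
      (auto simp: powr_powr simp flip: powr_numeral)
qed

lemma in_Lp_integrable:
  assumes "prob_space M" "in_Lp M p U" "p \<ge> 1"
  shows "integrable M U"
proof -
  interpret prob_space M by fact
  show ?thesis
  proof (rule Bochner_Integration.integrable_bound)
    show "integrable M (\<lambda>\<omega>. 1 + \<bar>U \<omega>\<bar> powr p)" using assms(2) by (simp add: in_Lp_def)
    show "AE \<omega> in M. norm (U \<omega>) \<le> norm (1 + \<bar>U \<omega>\<bar> powr p)"
    proof (rule AE_I2)
      fix \<omega>
      show "norm (U \<omega>) \<le> norm (1 + \<bar>U \<omega>\<bar> powr p)"
      proof (cases "\<bar>U \<omega>\<bar> \<le> 1")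
        case False
        then have "\<bar>U \<omega>\<bar> powr 1 \<le> \<bar>U \<omega>\<bar> powr p" using assms(3) by (intro powr_mono) auto
        then show ?thesis using False by simp
      qed (simp add: add_increasing2)
    qed
  qed (use assms(2) in \<open>simp add: in_Lp_def\<close>)
qed

section \<open>Law of a vector with independent coordinates\<close>

text \<open>
  The product measure splits into the k-th factor and the rest; the inner integral with a redrawn k-th
  coordinate does not depend on the old one.
\<close>

lemma (in prob_space) product_law_distr:
  fixes X :: "'a \<Rightarrow> real ^ 'n::finite"
  assumes indep: "indep_vars (\<lambda>_. borel) (\<lambda>k \<omega>. X \<omega> $ k) UNIV"
    and dist: "\<And>k. distributed M lborel (\<lambda>\<omega>. X \<omega> $ k) (\<lambda>x. ennreal (d k x))"
    and I: "\<And>k. open (I k)" "\<And>k. connected (I k)"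
    and d: "\<And>k x. x \<in> I k \<Longrightarrow> d k x > 0" "\<And>k. d k differentiable_on I k" "\<And>k x. x \<notin> I k \<Longrightarrow> d k x = 0"
  shows "X \<in> borel_measurable M" "product_law (distr M borel X) I d"
proof -
  have rv [measurable]: "(\<lambda>\<omega>. X \<omega> $ k) \<in> borel_measurable M" for k
    using indep unfolding indep_vars_def by simp
  have mchi: "(\<lambda>z. \<chi> i. z i) \<in> borel_measurable (PiM UNIV (\<lambda>i::'n. borel :: real measure))"
    by (subst borel_measurable_euclidean_space)
       (auto simp: Basis_vec_def cart_eq_inner_axis[symmetric] inner_axis intro!: measurable_component_singleton)
  show Xm [measurable]: "X \<in> borel_measurable M"
    by (subst borel_measurable_euclidean_space)
       (auto simp: Basis_vec_def inner_axis)
  define \<mu> where "\<mu> k = density lborel (\<lambda>y. ennreal (d k y))" for k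
  have dn: "d k y \<ge> 0" for k y using d(1)[of y k] d(3)[of y k] by (cases "y \<in> I k") auto
  have dm [measurable]: "d k \<in> borel_measurable borel" for k
  proof -
    have "(\<lambda>x. ennreal (d k x)) \<in> borel_measurable lborel" using dist[of k] by (simp add: distributed_def)
    then have "(\<lambda>x. enn2real (ennreal (d k x))) \<in> borel_measurable lborel" by measurable
    then show ?thesis using dn by simp
  qed
  have \<mu>: "distr M borel (\<lambda>\<omega>. X \<omega> $ k) = \<mu> k" for k
  proof -
    have "distr M borel (\<lambda>\<omega>. X \<omega> $ k) = distr M lborel (\<lambda>\<omega>. X \<omega> $ k)" by (rule distr_cong) auto
    then show ?thesis using dist[of k] by (simp add: distributed_def \<mu>_def)
  qed
  have p\<mu>: "prob_space (\<mu> k)" for k unfolding \<mu>[symmetric] by (rule prob_space_distr) measurable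
  have s\<mu> [measurable_cong]: "sets (\<mu> k) = sets borel" for k by (simp add: \<mu>_def)
  interpret \<mu>: product_sigma_finite \<mu>
    unfolding product_sigma_finite_def using p\<mu> prob_space_imp_sigma_finite by blast
  have pi_eq: "distr M (PiM UNIV (\<lambda>i. borel)) (\<lambda>\<omega>. \<lambda>i\<in>UNIV. X \<omega> $ i) = PiM UNIV \<mu>"
    using indep_vars_iff_distr_eq_PiM[where I=UNIV and M'="\<lambda>_. borel" and X="\<lambda>k \<omega>. X \<omega> $ k"] indep by (simp add: \<mu>)
  have sPi: "sets (PiM J \<mu>) = sets (PiM J (\<lambda>i. borel))" for J by (intro sets_PiM_cong) (simp_all add: s\<mu>)
  have mchi' [measurable]: "(\<lambda>z. \<chi> i. z i) \<in> borel_measurable (PiM UNIV \<mu>)"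
    using mchi by (simp add: measurable_cong_sets[OF sPi refl])
  have nnX: "(\<integral>\<^sup>+x. f x \<partial>distr M borel X) = (\<integral>\<^sup>+z. f (\<chi> i. z i) \<partial>PiM UNIV \<mu>)"
    if [measurable]: "f \<in> borel_measurable borel" for f
  proof -
    have [measurable]: "(\<lambda>\<omega>. \<lambda>i\<in>UNIV. X \<omega> $ i) \<in> measurable M (PiM UNIV (\<lambda>i. borel))"
      by (intro measurable_restrict) measurable
    have "(\<integral>\<^sup>+z. f (\<chi> i. z i) \<partial>PiM UNIV \<mu>) = (\<integral>\<^sup>+\<omega>. f (\<chi> i. (\<lambda>i\<in>UNIV. X \<omega> $ i) i) \<partial>M)"
      unfolding pi_eq[symmetric] using mchi by (subst nn_integral_distr) auto
    also have "\<dots> = (\<integral>\<^sup>+x. f x \<partial>distr M borel X)"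
      by (subst nn_integral_distr) (auto simp: restrict_def)
    finally show ?thesis ..
  qed
  have resample: "(\<integral>\<^sup>+x. f x \<partial>distr M borel X) =
      (\<integral>\<^sup>+x. (\<integral>\<^sup>+y. f (upd x k y) * ennreal (d k y) \<partial>lborel) \<partial>distr M borel X)"
    if f [measurable]: "f \<in> borel_measurable borel" for f k
  proof -
    have ins: "insert k (UNIV - {k}) = UNIV" by auto
    define g where "g x = (\<integral>\<^sup>+y. f (upd x k y) * ennreal (d k y) \<partial>lborel)" for x
    have gm [measurable]: "g \<in> borel_measurable borel" unfolding g_def by measurable
    have g_eq: "g x = (\<integral>\<^sup>+y. f (upd x k y) \<partial>\<mu> k)" for x
      unfolding g_def \<mu>_def by (subst nn_integral_density) (auto simp: mult.commute)
    have split: "(\<integral>\<^sup>+z. h (\<chi> i. z i) \<partial>PiM UNIV \<mu>) =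
        (\<integral>\<^sup>+z. (\<integral>\<^sup>+y. h (\<chi> i. (z(k := y)) i) \<partial>\<mu> k) \<partial>PiM (UNIV - {k}) \<mu>)"
      if [measurable]: "h \<in> borel_measurable borel" for h :: "real ^ 'n \<Rightarrow> ennreal"
      using \<mu>.product_nn_integral_insert[of "UNIV - {k}" k "\<lambda>z. h (\<chi> i. z i)"] unfolding ins by auto
    have u: "upd (\<chi> i. (z(k := y')) i) k y = (\<chi> i. (z(k := y)) i)" for z y y'
      by (simp add: upd_def vec_eq_iff)
    have "(\<integral>\<^sup>+x. g x \<partial>distr M borel X) = (\<integral>\<^sup>+z. (\<integral>\<^sup>+y'. g (\<chi> i. (z(k := y')) i) \<partial>\<mu> k) \<partial>PiM (UNIV - {k}) \<mu>)"
      by (subst nnX[OF gm], rule split) measurable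
    also have "\<dots> = (\<integral>\<^sup>+z. (\<integral>\<^sup>+y. f (\<chi> i. (z(k := y)) i) \<partial>\<mu> k) \<partial>PiM (UNIV - {k}) \<mu>)"
      unfolding g_eq u by (simp add: prob_space.emeasure_space_1[OF p\<mu>] fun_upd_def)
    also have "\<dots> = (\<integral>\<^sup>+x. f x \<partial>distr M borel X)"
      by (subst nnX[OF f], rule split[symmetric]) measurable
    finally show ?thesis unfolding g_def ..
  qed
  have "prob_space (distr M borel X)" by (rule prob_space_distr) measurable
  then show "product_law (distr M borel X) I d"
    by (intro product_law.intro resample I d dm) auto
qed

section \<open>The bound on the Fisher distance\<close>

text \<open>
  The Cauchy-Schwarz inequality with the factors weighted by sqrt tau_k.
\<close>

lemma weighted_cross_bound:
  fixes l e \<tau> :: "'i \<Rightarrow> real"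
  assumes "finite J" "\<And>k. k \<in> J \<Longrightarrow> \<tau> k > 0"
  shows "(\<Sum>k\<in>J. l k * e k / \<theta>\<^sup>2)\<^sup>2 \<le> ((\<Sum>k\<in>J. \<bar>l k\<bar>\<^sup>2 / \<tau> k) / \<theta> ^ 4) * (\<Sum>k\<in>J. \<bar>e k\<bar>\<^sup>2 * \<tau> k)"
proof -
  have "(\<Sum>k\<in>J. l k * e k / \<theta>\<^sup>2) = (\<Sum>k\<in>J. (l k / sqrt (\<tau> k) / \<theta>\<^sup>2) * (e k * sqrt (\<tau> k)))"
    using assms(2) by (intro sum.cong refl) (auto simp: less_imp_le dest: assms(2))
  also have "\<dots>\<^sup>2 \<le> (\<Sum>k\<in>J. (l k / sqrt (\<tau> k) / \<theta>\<^sup>2)\<^sup>2) * (\<Sum>k\<in>J. (e k * sqrt (\<tau> k))\<^sup>2)"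
    by (rule Cauchy_Schwarz_ineq_sum)
  also have "(\<Sum>k\<in>J. (l k / sqrt (\<tau> k) / \<theta>\<^sup>2)\<^sup>2) = (\<Sum>k\<in>J. \<bar>l k\<bar>\<^sup>2 / \<tau> k) / \<theta> ^ 4"
    unfolding sum_divide_distrib
    by (intro sum.cong refl) (use assms(2) in \<open>auto simp: power_divide power_mult_distrib less_imp_le simp flip: power_mult\<close>)
  also have "(\<Sum>k\<in>J. (e k * sqrt (\<tau> k))\<^sup>2) = (\<Sum>k\<in>J. \<bar>e k\<bar>\<^sup>2 * \<tau> k)"
    by (intro sum.cong refl) (use assms(2) in \<open>auto simp: power_mult_distrib less_imp_le\<close>)
  finally show ?thesis .
qed

theorem theorem3p1:
  fixes M :: "'a measure" and X :: "'a \<Rightarrow> real ^ 'n::finite"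
    and I :: "'n \<Rightarrow> real set" and d :: "'n \<Rightarrow> real \<Rightarrow> real"
    and F :: "real ^ 'n \<Rightarrow> real" and m :: "'n \<Rightarrow> real ^ 'n \<Rightarrow> real"
    and p q r s t :: real
  assumes "prob_space M"
    and "prob_space.indep_vars M (\<lambda>_. borel) (\<lambda>k \<omega>. X \<omega> $ k) UNIV"
    and "\<And>k. integrable M (\<lambda>\<omega>. X \<omega> $ k)"
    and "\<And>k. prob_space.expectation M (\<lambda>\<omega>. X \<omega> $ k) = 0"
    and "\<And>k. prob_space.variance M (\<lambda>\<omega>. X \<omega> $ k) = 1"
    and "\<And>k. distributed M lborel (\<lambda>\<omega>. X \<omega> $ k) (\<lambda>x. ennreal (d k x))"
    and "\<And>k. open (I k)" and "\<And>k. connected (I k)"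
    and "\<And>k x. x \<in> I k \<Longrightarrow> d k x > 0"
    and "\<And>k. d k differentiable_on I k"
    and "\<And>k x. x \<notin> I k \<Longrightarrow> d k x = 0"
    and "C_k_on 2 (box_range I) F"
    and "integrable M (\<lambda>\<omega>. F (X \<omega>))"
    and "prob_space.expectation M (\<lambda>\<omega>. F (X \<omega>)) = 0"
    and "prob_space.variance M (\<lambda>\<omega>. F (X \<omega>)) = 1"
    and "differentiable_decomposition M X I d F m"
    and "AE \<omega> in M. Theta I d F m (X \<omega>) \<noteq> 0"
    and "p > 1" "q > 1" "r > 1" "s > 1" "t > 1"
    and "1 / p + 1 / q + 1 / r = 1" and "1 / s + 1 / t = 1"
    and "in_Lp M (2 * p) (\<lambda>\<omega>. F (X \<omega>))"
    and "in_Lp M (2 * q) (\<lambda>\<omega>. inverse (Theta I d F m (X \<omega>)))"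
    and "in_Lp M (2 * r) (\<lambda>\<omega>. 1 - Theta I d F m (X \<omega>))"
    and "in_Lp M s (\<lambda>\<omega>. (\<Sum>k\<in>UNIV. \<bar>L_op I d k (m k) (X \<omega>)\<bar>\<^sup>2 / stein_kernel (d k) (X \<omega> $ k))
                        / Theta I d F m (X \<omega>) ^ 4)"
    and "in_Lp M t (\<lambda>\<omega>. \<Sum>k\<in>UNIV. \<bar>partial k (Theta I d F m) (X \<omega>)\<bar>\<^sup>2
                                   * stein_kernel (d k) (X \<omega> $ k))"
  shows "\<exists>g. has_ac_density M (\<lambda>\<omega>. F (X \<omega>)) g \<and>
    fisher_distance M (\<lambda>\<omega>. F (X \<omega>)) g \<le> ennreal (
      2 * (Lp_norm M (2 * p) (\<lambda>\<omega>. F (X \<omega>)))\<^sup>2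
        * (Lp_norm M (2 * q) (\<lambda>\<omega>. inverse (Theta I d F m (X \<omega>))))\<^sup>2
        * (Lp_norm M (2 * r) (\<lambda>\<omega>. 1 - Theta I d F m (X \<omega>)))\<^sup>2
      + 2 * Lp_norm M s (\<lambda>\<omega>. (\<Sum>k\<in>UNIV. \<bar>L_op I d k (m k) (X \<omega>)\<bar>\<^sup>2 / stein_kernel (d k) (X \<omega> $ k))
                              / Theta I d F m (X \<omega>) ^ 4)
          * Lp_norm M t (\<lambda>\<omega>. \<Sum>k\<in>UNIV. \<bar>partial k (Theta I d F m) (X \<omega>)\<bar>\<^sup>2
                                         * stein_kernel (d k) (X \<omega> $ k)))"
proof -
  interpret prob_space M by fact
  let ?N = "distr M borel X"
  let ?\<Theta> = "Theta I d F m"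
  have X [measurable]: "X \<in> borel_measurable M"
    by (rule product_law_distr(1)[where I=I and d=d]) (use assms(2,6-11) in auto)
  have PL: "product_law ?N I d"
    by (rule product_law_distr(2)) (use assms(2,6-11) in auto)
  interpret PL: product_law ?N I d by (rule PL)
  have AE_X: "AE \<omega> in M. P (X \<omega>)" if "AE x in ?N. P x" for P
    using that by (rule AE_distrD[OF X])
  have inS: "AE \<omega> in M. X \<omega> \<in> box_range I" by (rule AE_X[OF PL.AE_S])
  have dec: "decomposition M X I d F m" and mC1: "\<And>k. C_k_on 1 (box_range I) (m k)"
    and dmi: "\<And>i k. integrable M (\<lambda>\<omega>. partial i (m k) (X \<omega>))"
    using assms(16) unfolding differentiable_decomposition_def by blast+
  have Fsum: "AE \<omega> in M. F (X \<omega>) = (\<Sum>k\<in>UNIV. m k (X \<omega>))"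
    and centred: "\<And>k. AE \<omega> in M. partial_expectation I d k (m k) (X \<omega>) = 0"
    and mi: "\<And>k. integrable M (\<lambda>\<omega>. m k (X \<omega>))"
    using dec assms(14) unfolding decomposition_def by auto
  have to_N: "integrable ?N (PL.ext u)" if c: "continuous_on (box_range I) u" and i: "integrable M (\<lambda>\<omega>. u (X \<omega>))" for u
  proof -
    have [measurable]: "PL.ext u \<in> borel_measurable borel" by (rule PL.ext_measurable[OF c])
    have "integrable M (\<lambda>\<omega>. PL.ext u (X \<omega>))"
      using i
    proof (rule integrable_cong_AE_imp)
      show "AE \<omega> in M. u (X \<omega>) = PL.ext u (X \<omega>)"
        using inS by eventually_elim (simp add: PL.ext_eq)
    qed measurable
    then show ?thesis by (subst integrable_distr_eq) auto
  qed
  have PE: "AE x in ?N. partial_expectation I d k (m k) x = 0" for k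
  proof -
    have mc: "continuous_on (box_range I) (m k)" by (rule PL.C1_imp(2)[OF mC1])
    have [measurable]: "PL.ext (m k) \<in> borel_measurable borel" by (rule PL.ext_measurable[OF mc])
    have "AE \<omega> in M. (LINT z|PL.law k. PL.ext (m k) (upd (X \<omega>) k z)) = 0"
      using inS centred[of k] by eventually_elim (simp add: PL.partial_expectation_eq[OF mc])
    then have "AE x in ?N. (LINT z|PL.law k. PL.ext (m k) (upd x k z)) = 0"
      by (subst AE_distr_iff) auto
    with PL.AE_S show ?thesis
      by eventually_elim (simp add: PL.partial_expectation_eq[OF mc])
  qed
  interpret CS: centred_statistic ?N I d F m
  proof unfold_locales
    fix i k
    show "C_k_on 2 (box_range I) F" by (rule assms(12))
    show "C_k_on 1 (box_range I) (m k)" by (rule mC1)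
    show "integrable ?N (PL.ext (m k))" by (rule to_N[OF PL.C1_imp(2)[OF mC1] mi])
    show "integrable ?N (PL.ext (partial i (m k)))" by (rule to_N[OF PL.C1_imp(3)[OF mC1] dmi])
    show "AE x in ?N. partial_expectation I d k (m k) x = 0" by (rule PE)
    have dn: "\<And>x. 0 \<le> d k x" by (rule PL.d_nonneg)
    have "integrable lborel (\<lambda>u. d k u * u)"
      using assms(3)[of k] by (subst distributed_integrable[OF assms(6)[of k]]) (auto simp: dn)
    then show "integrable lborel (\<lambda>u. u * d k u)" by (simp add: mult.commute)
    have "(LBINT u. d k u * u) = expectation (\<lambda>\<omega>. X \<omega> $ k)"
      by (rule distributed_integral[OF assms(6)[of k]]) (auto simp: dn)
    then show "(LBINT u. u * d k u) = 0" using assms(4)[of k] by (simp add: mult.commute)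
  qed
  define A where "A \<omega> = (\<Sum>k\<in>UNIV. \<bar>L_op I d k (m k) (X \<omega>)\<bar>\<^sup>2 / stein_kernel (d k) (X \<omega> $ k)) / ?\<Theta> (X \<omega>) ^ 4" for \<omega>
  define B where "B \<omega> = (\<Sum>k\<in>UNIV. \<bar>partial k ?\<Theta> (X \<omega>)\<bar>\<^sup>2 * stein_kernel (d k) (X \<omega> $ k))" for \<omega>
  have A: "in_Lp M s A" using assms(28) unfolding A_def .
  have B: "in_Lp M t B" using assms(29) unfolding B_def .
  have D\<Theta>: "AE \<omega> in M. \<forall>k\<in>UNIV. partial k ?\<Theta> (X \<omega>) = CS.D\<Theta> k (X \<omega>)"
    by (intro AE_finite_allI AE_X[OF CS.AE_partial_Theta_eq]) auto
  have \<tau>: "stein_kernel (d k) (X \<omega> $ k) > 0" if "X \<omega> \<in> box_range I" for \<omega> k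
    using PL.S_nth[OF that] by (rule CS.stein_kernel_pos)
  interpret SK: stein_kernel_setting ?N I d F m
  proof unfold_locales
    fix k
    have "integrable M B" by (rule in_Lp_integrable[OF assms(1) B]) (use assms(22) in simp)
    have "(\<integral>\<^sup>+x. ennreal ((CS.D\<Theta> k x)\<^sup>2 * stein_kernel (d k) (x $ k)) \<partial>?N) =
        (\<integral>\<^sup>+\<omega>. ennreal ((CS.D\<Theta> k (X \<omega>))\<^sup>2 * stein_kernel (d k) (X \<omega> $ k)) \<partial>M)"
      by (subst nn_integral_distr) auto
    also have "\<dots> \<le> (\<integral>\<^sup>+\<omega>. ennreal (norm (B \<omega>)) \<partial>M)"
    proof (rule nn_integral_mono_AE, use inS D\<Theta> in eventually_elim)
      case (elim \<omega>)
      have "(CS.D\<Theta> k (X \<omega>))\<^sup>2 * stein_kernel (d k) (X \<omega> $ k)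
          \<le> (\<Sum>k\<in>UNIV. \<bar>CS.D\<Theta> k (X \<omega>)\<bar>\<^sup>2 * stein_kernel (d k) (X \<omega> $ k))"
        using member_le_sum[of k UNIV "\<lambda>k. \<bar>CS.D\<Theta> k (X \<omega>)\<bar>\<^sup>2 * stein_kernel (d k) (X \<omega> $ k)"]
          \<tau>[OF elim(1)] by (simp add: less_imp_le)
      also have "\<dots> = B \<omega>" using elim(2) by (simp add: B_def)
      finally show ?case by (intro ennreal_leI) simp
    qed
    also have "\<dots> < \<infinity>" using \<open>integrable M B\<close> by (simp add: integrable_iff_bounded)
    finally show "(\<integral>\<^sup>+x. ennreal ((CS.D\<Theta> k x)\<^sup>2 * stein_kernel (d k) (x $ k)) \<partial>?N) < \<infinity>" .
  qed
  have square_sum_le: "(u + v)\<^sup>2 \<le> 2 * u\<^sup>2 + 2 * v\<^sup>2" for u v :: real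
    using zero_le_power2[of "u - v"] by (simp add: power2_sum power2_diff)
  define Y where "Y \<omega> = F (X \<omega>)" for \<omega>
  define \<theta> where "\<theta> \<omega> = ?\<Theta> (X \<omega>)" for \<omega>
  define \<kappa>' where "\<kappa>' k x = PL.ext (L_op I d k (m k)) x * CS.D\<Theta> k x / (PL.ext ?\<Theta> x)\<^sup>2" for k x
  define \<kappa> where "\<kappa> \<omega> = (\<Sum>k\<in>UNIV. \<kappa>' k (X \<omega>))" for \<omega>
  have [measurable]: "\<kappa>' k \<in> borel_measurable borel" for k unfolding \<kappa>'_def by measurable
  have [measurable]: "\<kappa> \<in> borel_measurable M" unfolding \<kappa>_def by measurable
  have Yp: "in_Lp M (2 * p) Y" and \<theta>q: "in_Lp M (2 * q) (\<lambda>\<omega>. inverse (\<theta> \<omega>))"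
    and \<theta>r: "in_Lp M (2 * r) (\<lambda>\<omega>. 1 - \<theta> \<omega>)"
    using assms(25-27) by (simp_all add: Y_def[abs_def] \<theta>_def[abs_def])
  have [measurable]: "Y \<in> borel_measurable M" using Yp by (simp add: in_Lp_def)
  have [measurable]: "\<theta> \<in> borel_measurable M"
  proof -
    have "(\<lambda>\<omega>. 1 - (1 - \<theta> \<omega>)) \<in> borel_measurable M"
      using \<theta>r by (intro borel_measurable_diff[of "\<lambda>_. 1" M "\<lambda>\<omega>. 1 - \<theta> \<omega>"] borel_measurable_const) (simp add: in_Lp_def)
    then show ?thesis by simp
  qed
  have nz: "AE \<omega> in M. \<theta> \<omega> \<noteq> 0" using assms(17) by (simp add: \<theta>_def)
  have good: "AE \<omega> in M. X \<omega> \<in> box_range I \<and> \<theta> \<omega> \<noteq> 0 \<and> Y \<omega> = (\<Sum>k\<in>UNIV. m k (X \<omega>)) \<and>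
      (\<forall>k. partial k ?\<Theta> (X \<omega>) = CS.D\<Theta> k (X \<omega>))"
    using inS nz Fsum D\<Theta> by eventually_elim (simp add: Y_def)
  have pqr: "0 < p" "0 < q" "0 < r" "0 < s" "0 < t" using assms(18-22) by auto
  have ip: "integrable M (\<lambda>\<omega>. \<bar>Y \<omega>\<bar> powr (2 * p))" "integrable M (\<lambda>\<omega>. \<bar>inverse (\<theta> \<omega>)\<bar> powr (2 * q))"
    "integrable M (\<lambda>\<omega>. \<bar>1 - \<theta> \<omega>\<bar> powr (2 * r))" "integrable M (\<lambda>\<omega>. \<bar>A \<omega>\<bar> powr s)" "integrable M (\<lambda>\<omega>. \<bar>B \<omega>\<bar> powr t)"
    using Yp \<theta>q \<theta>r A B by (simp_all add: in_Lp_def)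
  note H3 = Hoelder3[of "1/p" "1/q" "1/r", OF _ _ _ assms(23) ip(1-3)]
  \<comment> \<open>the summand F (1 - \<theta>) / \<theta> of W - F\<close>
  have h3: "integrable M (\<lambda>\<omega>. (Y \<omega>)\<^sup>2 * (inverse (\<theta> \<omega>))\<^sup>2 * (1 - \<theta> \<omega>)\<^sup>2)"
    "(LINT \<omega>|M. (Y \<omega>)\<^sup>2 * (inverse (\<theta> \<omega>))\<^sup>2 * (1 - \<theta> \<omega>)\<^sup>2) \<le>
      (Lp_norm M (2 * p) Y)\<^sup>2 * (Lp_norm M (2 * q) (\<lambda>\<omega>. inverse (\<theta> \<omega>)))\<^sup>2 * (Lp_norm M (2 * r) (\<lambda>\<omega>. 1 - \<theta> \<omega>))\<^sup>2"
    unfolding Lp_norm_power2[OF pqr(1)] Lp_norm_power2[OF pqr(2)] Lp_norm_power2[OF pqr(3)]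
      power2_eq_powr[OF pqr(1), of "Y _"] power2_eq_powr[OF pqr(2), of "inverse _"] power2_eq_powr[OF pqr(3), of "1 - _"]
    by (rule H3; use pqr in simp)+
  have h3': "integrable M (\<lambda>\<omega>. (Y \<omega> / \<theta> \<omega>)\<^sup>2)"
  proof -
    have "integrable M (\<lambda>\<omega>. (\<bar>Y \<omega>\<bar> powr (2 * p)) powr (1/p) * (\<bar>inverse (\<theta> \<omega>)\<bar> powr (2 * q)) powr (1/q) * 1 powr (1/r))"
      using pqr assms(23) by (intro Hoelder3(1) ip) auto
    then have "integrable M (\<lambda>\<omega>. (Y \<omega>)\<^sup>2 * (inverse (\<theta> \<omega>))\<^sup>2)"
      unfolding power2_eq_powr[OF pqr(1), of "Y _"] power2_eq_powr[OF pqr(2), of "inverse _"] by simp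
    then show ?thesis by (simp add: divide_inverse power_mult_distrib)
  qed
  have h2: "integrable M (\<lambda>\<omega>. \<bar>A \<omega>\<bar> * \<bar>B \<omega>\<bar>)" "(LINT \<omega>|M. \<bar>A \<omega>\<bar> * \<bar>B \<omega>\<bar>) \<le> Lp_norm M s A * Lp_norm M t B"
  proof -
    have pw: "\<bar>u\<bar> = (\<bar>u\<bar> powr a) powr (1 / a)" if "a > 0" for u a :: real
      using that by (simp add: powr_powr)
    have w: "1 / s + 1 / t + 0 = 1" using assms(24) by simp
    have "integrable M (\<lambda>\<omega>. (\<bar>A \<omega>\<bar> powr s) powr (1/s) * (\<bar>B \<omega>\<bar> powr t) powr (1/t) * 1 powr 0)"
      using pqr by (intro Hoelder3(1)[OF _ _ _ w] ip) auto
    then show "integrable M (\<lambda>\<omega>. \<bar>A \<omega>\<bar> * \<bar>B \<omega>\<bar>)"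
      unfolding pw[OF pqr(4), symmetric] pw[OF pqr(5), symmetric] by simp
    have "(LINT \<omega>|M. (\<bar>A \<omega>\<bar> powr s) powr (1/s) * (\<bar>B \<omega>\<bar> powr t) powr (1/t) * 1 powr 0) \<le>
        (LINT \<omega>|M. \<bar>A \<omega>\<bar> powr s) powr (1/s) * (LINT \<omega>|M. \<bar>B \<omega>\<bar> powr t) powr (1/t) * (LINT \<omega>|M. 1) powr 0"
      using pqr by (intro Hoelder3(2)[OF _ _ _ w] ip) auto
    then show "(LINT \<omega>|M. \<bar>A \<omega>\<bar> * \<bar>B \<omega>\<bar>) \<le> Lp_norm M s A * Lp_norm M t B"
      unfolding pw[OF pqr(4), symmetric] pw[OF pqr(5), symmetric] by (simp add: Lp_norm_def prob_space)
  qed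
  \<comment> \<open>arbitrary index sets, since single summands must also be seen to be integrable\<close>
  have cross: "AE \<omega> in M. (\<Sum>k\<in>J. \<kappa>' k (X \<omega>))\<^sup>2 \<le> \<bar>A \<omega>\<bar> * \<bar>B \<omega>\<bar>" for J
    using good
  proof eventually_elim
    case (elim \<omega>)
    let ?l = "\<lambda>k. L_op I d k (m k) (X \<omega>)" and ?e = "\<lambda>k. CS.D\<Theta> k (X \<omega>)" and ?\<tau> = "\<lambda>k. stein_kernel (d k) (X \<omega> $ k)"
    have pos: "?\<tau> k > 0" for k using elim by (intro \<tau>) auto
    have eq: "(\<Sum>k\<in>J. \<kappa>' k (X \<omega>)) = (\<Sum>k\<in>J. ?l k * ?e k / (\<theta> \<omega>)\<^sup>2)"
      using elim by (simp add: \<kappa>'_def PL.ext_eq \<theta>_def)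
    have "(\<Sum>k\<in>J. \<kappa>' k (X \<omega>))\<^sup>2 \<le> ((\<Sum>k\<in>J. \<bar>?l k\<bar>\<^sup>2 / ?\<tau> k) / \<theta> \<omega> ^ 4) * (\<Sum>k\<in>J. \<bar>?e k\<bar>\<^sup>2 * ?\<tau> k)"
      unfolding eq by (rule weighted_cross_bound) (auto simp: pos)
    also have "\<dots> \<le> ((\<Sum>k\<in>UNIV. \<bar>?l k\<bar>\<^sup>2 / ?\<tau> k) / \<theta> \<omega> ^ 4) * (\<Sum>k\<in>UNIV. \<bar>?e k\<bar>\<^sup>2 * ?\<tau> k)"
      using pos by (intro mult_mono divide_right_mono sum_mono2 sum_nonneg divide_nonneg_nonneg mult_nonneg_nonneg)
        (auto simp: less_imp_le)
    also have "\<dots> = A \<omega> * B \<omega>"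
      using elim by (simp add: A_def B_def \<theta>_def)
    also have "\<dots> \<le> \<bar>A \<omega>\<bar> * \<bar>B \<omega>\<bar>" by (simp flip: abs_mult)
    finally show ?case .
  qed
  have sq: "integrable M (\<lambda>\<omega>. (\<Sum>k\<in>J. \<kappa>' k (X \<omega>))\<^sup>2)" for J
  proof (rule Bochner_Integration.integrable_bound[OF h2(1)])
    show "AE \<omega> in M. norm ((\<Sum>k\<in>J. \<kappa>' k (X \<omega>))\<^sup>2) \<le> norm (\<bar>A \<omega>\<bar> * \<bar>B \<omega>\<bar>)"
      using cross[of J] by eventually_elim (simp add: abs_mult)
  qed measurable
  have \<kappa>2: "integrable M (\<lambda>\<omega>. (\<kappa> \<omega>)\<^sup>2)" using sq[of UNIV] by (simp add: \<kappa>_def)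
  have \<kappa>1: "integrable ?N (\<kappa>' k)" for k
  proof -
    have "integrable M (\<lambda>\<omega>. \<kappa>' k (X \<omega>))"
    proof (rule square_integrable_imp_integrable)
      show "integrable M (\<lambda>\<omega>. (\<kappa>' k (X \<omega>))\<^sup>2)" using sq[of "{k}"] by simp
    qed measurable
    then show ?thesis by (subst integrable_distr_eq) auto
  qed
  define W' where "W' x = (\<Sum>k\<in>UNIV. PL.ext (m k) x) / PL.ext ?\<Theta> x + (\<Sum>k\<in>UNIV. \<kappa>' k x)" for x
  define W where "W \<omega> = W' (X \<omega>)" for \<omega>
  have [measurable]: "W' \<in> borel_measurable borel" unfolding W'_def[abs_def] by measurable
  have W_eq: "AE \<omega> in M. W \<omega> = Y \<omega> / \<theta> \<omega> + \<kappa> \<omega>"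
    using good by eventually_elim (simp add: W_def W'_def \<kappa>_def PL.ext_eq \<theta>_def)
  have R: "integrable ?N (\<lambda>x. (\<Sum>k\<in>UNIV. PL.ext (m k) x) / PL.ext ?\<Theta> x)"
  proof -
    have "integrable M (\<lambda>\<omega>. Y \<omega> / \<theta> \<omega>)" by (rule square_integrable_imp_integrable[OF _ h3']) measurable
    then have "integrable M (\<lambda>\<omega>. (\<Sum>k\<in>UNIV. PL.ext (m k) (X \<omega>)) / PL.ext ?\<Theta> (X \<omega>))"
    proof (rule integrable_cong_AE_imp)
      show "AE \<omega> in M. Y \<omega> / \<theta> \<omega> = (\<Sum>k\<in>UNIV. PL.ext (m k) (X \<omega>)) / PL.ext ?\<Theta> (X \<omega>)"
        using good by eventually_elim (simp add: PL.ext_eq \<theta>_def)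
    qed measurable
    then show ?thesis by (subst integrable_distr_eq) auto
  qed
  have nzN: "AE x in ?N. ?\<Theta> x \<noteq> 0"
  proof -
    have "AE \<omega> in M. PL.ext ?\<Theta> (X \<omega>) \<noteq> 0"
      using good by eventually_elim (simp add: PL.ext_eq \<theta>_def)
    then have "AE x in ?N. PL.ext ?\<Theta> x \<noteq> 0" by (subst AE_distr_iff) auto
    with PL.AE_S show ?thesis by eventually_elim (simp add: PL.ext_eq)
  qed
  interpret SR: score_representation M Y W
  proof unfold_locales
    show "W \<in> borel_measurable M" unfolding W_def[abs_def] by measurable
    show "integrable M (\<lambda>\<omega>. (W \<omega>)\<^sup>2)"
    proof (rule Bochner_Integration.integrable_bound)
      show "integrable M (\<lambda>\<omega>. 2 * (Y \<omega> / \<theta> \<omega>)\<^sup>2 + 2 * (\<kappa> \<omega>)\<^sup>2)"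
        by (intro Bochner_Integration.integrable_add integrable_mult_right h3' \<kappa>2)
      show "(\<lambda>\<omega>. (W \<omega>)\<^sup>2) \<in> borel_measurable M" unfolding W_def[abs_def] by measurable
      show "AE \<omega> in M. norm ((W \<omega>)\<^sup>2) \<le> norm (2 * (Y \<omega> / \<theta> \<omega>)\<^sup>2 + 2 * (\<kappa> \<omega>)\<^sup>2)"
        using W_eq
      proof eventually_elim
        case (elim \<omega>)
        show ?case unfolding elim using square_sum_le[of "Y \<omega> / \<theta> \<omega>" "\<kappa> \<omega>"] by simp
      qed
    qed
    show "integrable M (\<lambda>\<omega>. (Y \<omega>)\<^sup>2)"
      using assms(14,15) not_integrable_integral_eq[of M "\<lambda>\<omega>. (Y \<omega>)\<^sup>2"] by (auto simp: Y_def)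
    fix \<psi> \<psi>' :: "real \<Rightarrow> real" and C C' :: real
    assume \<psi>: "\<And>u. (\<psi> has_real_derivative \<psi>' u) (at u)" "continuous_on UNIV \<psi>'"
      "\<And>u. \<bar>\<psi> u\<bar> \<le> C" "\<And>u. \<bar>\<psi>' u\<bar> \<le> C'"
    have \<psi>c: "continuous_on UNIV \<psi>" using DERIV_isCont[OF \<psi>(1)] by (auto intro: continuous_at_imp_continuous_on)
    note [measurable] = borel_measurable_continuous_onI[OF \<psi>c] borel_measurable_continuous_onI[OF \<psi>(2)]
    have "(LINT \<omega>|M. \<psi>' (Y \<omega>)) = (LINT \<omega>|M. \<psi>' (PL.ext F (X \<omega>)))"
    proof (rule integral_cong_AE)
      show "AE \<omega> in M. \<psi>' (Y \<omega>) = \<psi>' (PL.ext F (X \<omega>))"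
        using inS by eventually_elim (simp add: PL.ext_eq Y_def)
    qed measurable
    also have "\<dots> = (LINT x|?N. \<psi>' (PL.ext F x))" by (subst integral_distr) auto
    also have "\<dots> = (LINT x|?N. \<psi> (PL.ext F x) * W' x)"
      unfolding W'_def \<kappa>'_def
      by (rule SK.score_identity[OF nzN \<kappa>1[unfolded \<kappa>'_def] R \<psi>])
    also have "\<dots> = (LINT \<omega>|M. \<psi> (PL.ext F (X \<omega>)) * W \<omega>)" unfolding W_def by (subst integral_distr) auto
    also have "\<dots> = (LINT \<omega>|M. \<psi> (Y \<omega>) * W \<omega>)" unfolding W_def
    proof (rule integral_cong_AE)
      show "AE \<omega> in M. \<psi> (PL.ext F (X \<omega>)) * W' (X \<omega>) = \<psi> (Y \<omega>) * W' (X \<omega>)"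
        using inS by eventually_elim (simp add: PL.ext_eq Y_def)
    qed measurable
    finally show "(LINT \<omega>|M. \<psi>' (Y \<omega>)) = (LINT \<omega>|M. \<psi> (Y \<omega>) * W \<omega>)" .
  qed measurable
  have "(LINT \<omega>|M. (Y \<omega> - W \<omega>)\<^sup>2) \<le> (LINT \<omega>|M. 2 * ((Y \<omega>)\<^sup>2 * (inverse (\<theta> \<omega>))\<^sup>2 * (1 - \<theta> \<omega>)\<^sup>2) + 2 * (\<bar>A \<omega>\<bar> * \<bar>B \<omega>\<bar>))"
  proof (rule integral_mono_AE')
    show "integrable M (\<lambda>\<omega>. 2 * ((Y \<omega>)\<^sup>2 * (inverse (\<theta> \<omega>))\<^sup>2 * (1 - \<theta> \<omega>)\<^sup>2) + 2 * (\<bar>A \<omega>\<bar> * \<bar>B \<omega>\<bar>))"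
      by (intro Bochner_Integration.integrable_add integrable_mult_right h3(1) h2(1))
    show "AE \<omega> in M. (Y \<omega> - W \<omega>)\<^sup>2 \<le> 2 * ((Y \<omega>)\<^sup>2 * (inverse (\<theta> \<omega>))\<^sup>2 * (1 - \<theta> \<omega>)\<^sup>2) + 2 * (\<bar>A \<omega>\<bar> * \<bar>B \<omega>\<bar>)"
      using W_eq nz cross[of UNIV]
    proof eventually_elim
      case (elim \<omega>)
      define a where "a = Y \<omega> * inverse (\<theta> \<omega>) * (1 - \<theta> \<omega>)"
      have "Y \<omega> - W \<omega> = - (a + \<kappa> \<omega>)" using elim(1,2) by (simp add: a_def field_simps)
      then have "(Y \<omega> - W \<omega>)\<^sup>2 = (a + \<kappa> \<omega>)\<^sup>2" by (simp only: power2_minus)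
      also have "\<dots> \<le> 2 * a\<^sup>2 + 2 * (\<kappa> \<omega>)\<^sup>2"
        by (rule square_sum_le)
      also have "\<dots> \<le> 2 * a\<^sup>2 + 2 * (\<bar>A \<omega>\<bar> * \<bar>B \<omega>\<bar>)" using elim(3) by (simp add: \<kappa>_def)
      finally show ?case by (simp add: a_def power_mult_distrib)
    qed
  qed auto
  also have "\<dots> = 2 * (LINT \<omega>|M. (Y \<omega>)\<^sup>2 * (inverse (\<theta> \<omega>))\<^sup>2 * (1 - \<theta> \<omega>)\<^sup>2) + 2 * (LINT \<omega>|M. \<bar>A \<omega>\<bar> * \<bar>B \<omega>\<bar>)"
    by (subst Bochner_Integration.integral_add) (auto intro!: integrable_mult_right h3(1) h2(1))
  also have "\<dots> \<le> 2 * ((Lp_norm M (2 * p) Y)\<^sup>2 * (Lp_norm M (2 * q) (\<lambda>\<omega>. inverse (\<theta> \<omega>)))\<^sup>2 * (Lp_norm M (2 * r) (\<lambda>\<omega>. 1 - \<theta> \<omega>))\<^sup>2)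
      + 2 * (Lp_norm M s A * Lp_norm M t B)"
    using h3(2) h2(2) by (intro add_mono mult_left_mono) auto
  finally have "fisher_distance M Y SR.g \<le> ennreal (2 * (Lp_norm M (2 * p) Y)\<^sup>2 * (Lp_norm M (2 * q) (\<lambda>\<omega>. inverse (\<theta> \<omega>)))\<^sup>2 * (Lp_norm M (2 * r) (\<lambda>\<omega>. 1 - \<theta> \<omega>))\<^sup>2
      + 2 * Lp_norm M s A * Lp_norm M t B)"
    using SR.fisher_distance_le by (elim order_trans) (intro ennreal_leI, simp only: mult.assoc)
  with SR.has_ac_density_g show ?thesis
    unfolding Y_def[abs_def] \<theta>_def[abs_def] A_def[abs_def] B_def[abs_def] by blast
qed

end
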